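(* Fix $\rho_{\max}>0$ and a flux $f$ as in the context. There exists a function $C\colon(0,\infty)\times[0,\infty)\to[0,\infty)$, non-decreasing in each of its two arguments (and depending otherwise only on the fixed $f$ and $\rho_{\max}$), such that the following holds. For $i\in\{1,2\}$, let $\alpha_i\geq 0$, let $\overline{\rho}_i\colon\mathbb{R}\to[0,\rho_{\max}]$ be measurable and supported in $\mathfrak{C}=(-1,1)$, and let $(\rho_i,\xi_i)$ be a well-separated entropy solution of the one-dimensional Hughes model with initial datum $\overline{\rho}_i$ and affine cost $c_i(\rho)=1+\alpha_i\,\rho$. If $\overline{\rho}_1\in \mathrm{BV}(\mathbb{R})$, then for a.e. $t>0$, with $C=C\bigl(t,\max\{\alpha_1,\alpha_2\}\bigr)$, $$\|\rho_1(t,\cdot)-\rho_2(t,\cdot)\|_{L^1(\mathfrak{C})}\leq C\Bigl(|\alpha_1-\alpha_2|+\|\overline{\rho}_1-\overline{\rho}_2\|_{L^1(\mathfrak{C})}\Bigr).$$ In particular, for any fixed cost parameter $\alpha\geq 0$ and any initial datum $\overline{\rho}\in \mathrm{BV}(\mathbb{R})$ with values in $[0,\rho_{\max}]$ and supported in $\mathfrak{C}$, there exists at most one well-separated entropy solution of the one-dimensional Hughes model with cost $c(\rho)=1+\alpha\,\rho$ and initial datum $\overline{\rho}$.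
   Context: Setting. $\mathfrak{C}:=(-1,1)$, $\rho_{\max}>0$ is fixed. The flux $f\in W^{1,\infty}((0,\rho_{\max});[0,\infty))$ is fixed, concave, satisfies $f(0)=0=f(\rho_{\max})$, and is not affine on any nontrivial interval. A cost function is a continuous $c\colon[0,\rho_{\max}]\to[1,\infty)$. Convention: $\operatorname{sign}(0)=0$. Entropy solution. Let $\overline{\rho}\colon\mathbb{R}\to[0,\rho_{\max}]$ be measurable and supported in $\mathfrak{C}$. A couple $(\rho,\xi)$ with $$\rho\in L^1_{\rm loc}([0,\infty)\times\mathbb{R};[0,\rho_{\max}])\cap C^0([0,\infty);L^1(\mathbb{R})),\qquad \xi\colon[0,\infty)\to\mathfrak{C}\ \text{Lipschitz},$$ is an entropy solution of the one-dimensional Hughes model with cost $c$ and initial datum $\overline{\rho}$ if: (i) for a.e. $t>0$, $\int_{-1}^{\xi(t)}c(\rho(t,y))\,dy=\int_{\xi(t)}^{1}c(\rho(t,y))\,dy$; (ii) $\rho(0,x)=\overline{\rho}(x)$ for a.e. $x\in\mathbb{R}$; (iii) for all $\kappa\in[0,\rho_{\max}]$ and all $\varphi\in C_c^\infty((0,\infty)\times\mathbb{R};[0,\infty))$, $$0\leq\int_0^\infty\!\!\int_{\mathbb{R}}\Bigl(|\rho-\kappa|\,\varphi_t+\operatorname{sign}(x-\xi(t))\,\operatorname{sign}(\rho-\kappa)\,(f(\rho)-f(\kappa))\,\varphi_x\Bigr)dx\,dt+2\int_0^\infty f(\kappa)\,\varphi(t,\xi(t))\,dt .$$ Well-separated.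 An entropy solution $(\rho,\xi)$ is called well-separated if the strong one-sided traces $\rho(t,\xi(t)^{\pm})$ of $\rho$ along the Lipschitz curve $x=\xi(t)$ are equal to zero for a.e. $t>0$. Strong traces are understood in the $L^1$ sense, i.e. the one-sided traces vanish when, for every $T>0$, $\operatorname{ess\,lim}_{y\to0^+}\int_0^T\rho(t,\xi(t)\pm y)\,dt=0$ (it is a known fact that such strong traces always exist for entropy solutions under the nonlinearity assumption on $f$). *)

theory Defs
  imports "HOL-Analysis.Analysis"
begin

primrec C_order :: "nat \<Rightarrow> ('a::real_normed_vector \<Rightarrow> real) \<Rightarrow> bool" where
  "C_order 0 \<phi> \<longleftrightarrow> continuous_on UNIV \<phi>"
| "C_order (Suc k) \<phi> \<longleftrightarrow> \<phi> differentiable_on UNIV \<and>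
     (\<forall>v. C_order k (\<lambda>x. frechet_derivative \<phi> (at x) v))"

text \<open>Elements of \<open>C\<^sub>c\<^sup>\<infinity>(U)\<close>, for open \<open>U\<close>, are represented by their extensions by zero
  to the whole space.\<close>

definition test_functions :: "'a::euclidean_space set \<Rightarrow> ('a \<Rightarrow> real) set" where
  "test_functions U = {\<phi>. (\<forall>k. C_order k \<phi>) \<and>
     (\<exists>K. compact K \<and> K \<subseteq> U \<and> (\<forall>x. x \<notin> K \<longrightarrow> \<phi> x = 0))}"

definition L_infty_on :: "real set \<Rightarrow> (real \<Rightarrow> real) \<Rightarrow> bool" where
  "L_infty_on U u \<longleftrightarrow> u \<in> borel_measurable (lebesgue_on U) \<and>
     (\<exists>M. AE x in lebesgue_on U. \<bar>u x\<bar> \<le> M)"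

definition W1_infty_on :: "real set \<Rightarrow> (real \<Rightarrow> real) \<Rightarrow> bool" where
  "W1_infty_on U u \<longleftrightarrow> L_infty_on U u \<and>
     (\<exists>g. L_infty_on U g \<and>
        (\<forall>\<phi>\<in>test_functions U.
           (LINT x:U|lebesgue. u x * deriv \<phi> x) = - (LINT x:U|lebesgue. g x * \<phi> x)))"

text \<open>\<open>BV(\<real>)\<close> in the distributional sense, hence insensitive to null sets.\<close>

definition BV :: "(real \<Rightarrow> real) \<Rightarrow> bool" where
  "BV u \<longleftrightarrow> integrable lebesgue u \<and>
     (\<exists>M. \<forall>\<phi>\<in>test_functions UNIV. (\<forall>x. \<bar>\<phi> x\<bar> \<le> 1) \<longrightarrow>
        (LINT x|lebesgue. u x * deriv \<phi> x) \<le> M)"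

definition L1_loc_on :: "'a::euclidean_space set \<Rightarrow> ('a \<Rightarrow> real) \<Rightarrow> bool" where
  "L1_loc_on S u \<longleftrightarrow> (\<forall>K. compact K \<and> K \<subseteq> S \<longrightarrow> set_integrable lebesgue K u)"

definition continuous_L1 :: "(real \<Rightarrow> real \<Rightarrow> real) \<Rightarrow> bool" where
  "continuous_L1 \<rho> \<longleftrightarrow> (\<forall>t\<ge>0. integrable lebesgue (\<rho> t)) \<and>
     (\<forall>t\<ge>0. ((\<lambda>s. LINT x|lebesgue. \<bar>\<rho> s x - \<rho> t x\<bar>) \<longlongrightarrow> 0) (at t within {0..}))"

definition ess_tendsto_right_0 :: "(real \<Rightarrow> real) \<Rightarrow> real \<Rightarrow> bool" where
  "ess_tendsto_right_0 g l \<longleftrightarrow>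
     (\<forall>\<epsilon>>0. \<exists>\<delta>>0. AE y in lebesgue. 0 < y \<and> y < \<delta> \<longrightarrow> \<bar>g y - l\<bar> < \<epsilon>)"

text \<open>\<open>f\<close> is the continuous representative on \<open>{0..R}\<close> of its \<open>W\<^sup>1\<^sup>,\<^sup>\<infinity>\<close> class; its values
  outside \<open>{0..R}\<close> are irrelevant.\<close>

definition hughes_flux :: "real \<Rightarrow> (real \<Rightarrow> real) \<Rightarrow> bool" where
  "hughes_flux R f \<longleftrightarrow>
     W1_infty_on {0<..<R} f \<and> continuous_on {0..R} f \<and> (\<forall>r\<in>{0..R}. 0 \<le> f r) \<and>
     concave_on {0..R} f \<and> f 0 = 0 \<and> f R = 0 \<and>
     (\<forall>a b. 0 \<le> a \<and> a < b \<and> b \<le> R \<longrightarrow> \<not> (\<exists>m q. \<forall>r\<in>{a..b}. f r = m * r + q))"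

definition cost_function :: "real \<Rightarrow> (real \<Rightarrow> real) \<Rightarrow> bool" where
  "cost_function R c \<longleftrightarrow> continuous_on {0..R} c \<and> (\<forall>r\<in>{0..R}. 1 \<le> c r)"

definition initial_datum :: "real \<Rightarrow> (real \<Rightarrow> real) \<Rightarrow> bool" where
  "initial_datum R \<rho>0 \<longleftrightarrow> \<rho>0 \<in> borel_measurable lebesgue \<and> (\<forall>x. \<rho>0 x \<in> {0..R}) \<and>
     (\<forall>x. x \<notin> {-1<..<1} \<longrightarrow> \<rho>0 x = 0)"

text \<open>The function \<open>\<rho>\<close> is a representative of an \<open>L\<^sup>1\<^sub>l\<^sub>o\<^sub>c\<close> class chosen so that \<open>t \<mapsto> \<rho> t\<close> is
  the continuous curve in \<open>L\<^sup>1(\<real>)\<close>. Values of \<open>\<rho>\<close> and \<open>\<xi>\<close> at negative times are irrelevant.\<close>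

definition entropy_solution ::
  "real \<Rightarrow> (real \<Rightarrow> real) \<Rightarrow> (real \<Rightarrow> real) \<Rightarrow> (real \<Rightarrow> real) \<Rightarrow>
   (real \<Rightarrow> real \<Rightarrow> real) \<Rightarrow> (real \<Rightarrow> real) \<Rightarrow> bool" where
  "entropy_solution R f c \<rho>0 \<rho> \<xi> \<longleftrightarrow>
     cost_function R c \<and> initial_datum R \<rho>0 \<and>
     L1_loc_on ({0..} \<times> UNIV) (\<lambda>(t, x). \<rho> t x) \<and>
     (AE (t, x) in lebesgue_on ({0..} \<times> UNIV). \<rho> t x \<in> {0..R}) \<and>
     continuous_L1 \<rho> \<and>
     (\<forall>t\<ge>0. \<xi> t \<in> {-1<..<1}) \<and> (\<exists>L. L-lipschitz_on {0..} \<xi>) \<and>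
     (AE t in lebesgue_on {0<..}.
        (LINT y:{-1..\<xi> t}|lebesgue. c (\<rho> t y)) = (LINT y:{\<xi> t..1}|lebesgue. c (\<rho> t y))) \<and>
     (AE x in lebesgue. \<rho> 0 x = \<rho>0 x) \<and>
     (\<forall>\<kappa>\<in>{0..R}. \<forall>\<phi>\<in>test_functions ({0<..} \<times> UNIV). (\<forall>z. 0 \<le> \<phi> z) \<longrightarrow>
        0 \<le> (LINT t:{0<..}|lebesgue. LINT x|lebesgue.
               \<bar>\<rho> t x - \<kappa>\<bar> * deriv (\<lambda>s. \<phi> (s, x)) t
               + sgn (x - \<xi> t) * sgn (\<rho> t x - \<kappa>) * (f (\<rho> t x) - f \<kappa>)
                   * deriv (\<lambda>y. \<phi> (t, y)) x)
             + 2 * (LINT t:{0<..}|lebesgue. f \<kappa> * \<phi> (t, \<xi> t)))"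

definition well_separated :: "(real \<Rightarrow> real \<Rightarrow> real) \<Rightarrow> (real \<Rightarrow> real) \<Rightarrow> bool" where
  "well_separated \<rho> \<xi> \<longleftrightarrow>
     (\<forall>T>0. ess_tendsto_right_0 (\<lambda>y. LINT t:{0..T}|lebesgue. \<rho> t (\<xi> t + y)) 0 \<and>
            ess_tendsto_right_0 (\<lambda>y. LINT t:{0..T}|lebesgue. \<rho> t (\<xi> t - y)) 0)"

definition well_separated_entropy_solution ::
  "real \<Rightarrow> (real \<Rightarrow> real) \<Rightarrow> (real \<Rightarrow> real) \<Rightarrow> (real \<Rightarrow> real) \<Rightarrow>
   (real \<Rightarrow> real \<Rightarrow> real) \<Rightarrow> (real \<Rightarrow> real) \<Rightarrow> bool" where
  "well_separated_entropy_solution R f c \<rho>0 \<rho> \<xi> \<longleftrightarrow>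
     entropy_solution R f c \<rho>0 \<rho> \<xi> \<and> well_separated \<rho> \<xi>"

definition affine_cost :: "real \<Rightarrow> real \<Rightarrow> real" where
  "affine_cost \<alpha> r = 1 + \<alpha> * r"

end

theory Submission
  imports Defs
begin

text \<open>A well-separated solution decouples. Since the traces of \<open>\<rho>\<close> along the turning curve \<open>\<xi>\<close>
  vanish and \<open>f 0 = 0\<close>, the parts of \<open>\<rho>\<close> to the right and to the left of \<open>\<xi>\<close>, extended by zero, are
  Kruzhkov entropy solutions on the whole line of the scalar conservation laws with fluxes \<open>f\<close> and
  \<open>- f\<close>. Kruzhkov's \<open>L\<^sup>1\<close> contraction therefore bounds the distance of two solutions at time \<open>t\<close> by
  the distances of their right and left parts at time \<open>0\<close>, that is, by \<open>\<parallel>\<rho>01 - \<rho>02\<parallel> + 2 R \<bar>\<xi>1 0 - \<xi>2 0\<bar>\<close>.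
  The balance equation holds at every time by continuity, and at time \<open>0\<close> it controls
  \<open>\<bar>\<xi>1 0 - \<xi>2 0\<bar>\<close>, because the costs are at least \<open>1\<close>. This gives \<open>C = 1 + 2 R\<^sup>2 + R \<alpha>\<close>.\<close>

subsection \<open>Functions of class \<open>C\<^sup>k\<close>\<close>

text \<open>The gain from zero extensions is that their equations no longer mention the curve: two
  solutions obey the same pair of equations although their curves differ. The curves therefore enter
  the L1 estimate only through the splitting of the initial data, no curves are compared at positive
  times, and \<open>C\<close> comes out constant in time. The delicate step is the extension.
  Testing with functions that vanish on the curve removes the source term, at the price of a cutoff
  error that is essentially the mass of \<open>\<rho>\<close> in a strip along the curve divided by
  the width of the strip; this quotient is what the traces control. Spatial cutoffs at infinity are
  removed by integrability over time strips and not by finite speed of propagation. As a solution is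
  given by Lebesgue measurable slices, a Borel representative in both variables is fixed before
  Fubini's theorem is applied. In \<open>C\<close>, the term \<open>2 * R\<^sup>2\<close> is
  \<open>R\<close> times the bound \<open>2 * R\<close> on the mass of a datum, which multiplies
  \<open>\<bar>\<alpha>1 - \<alpha>2\<bar>\<close> in the balance; \<open>R * \<alpha>\<close> is
  the response of the balance to a change of density.\<close>

lemma C_order_imp: "C_order (Suc k) \<phi> \<Longrightarrow> C_order k \<phi>"
proof (induction k arbitrary: \<phi>)
  case 0
  then show ?case by (auto intro: differentiable_imp_continuous_on)
next
  case (Suc k)
  then show ?case by (metis C_order.simps(2))
qed

lemma C_order_continuous: "C_order k \<phi> \<Longrightarrow> continuous_on UNIV \<phi>"
  by (induction k) (auto intro: differentiable_imp_continuous_on)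

lemma C_order_SucI:
  assumes "\<And>x. (\<phi> has_derivative D x) (at x)" "\<And>v. C_order k (\<lambda>x. D x v)"
  shows "C_order (Suc k) \<phi>"
proof -
  have "frechet_derivative \<phi> (at x) = D x" for x
    using assms(1)[of x] by (metis frechet_derivative_at)
  with assms show ?thesis
    by (auto simp: differentiable_on_def differentiable_def)
qed

lemma C_order_SucD:
  assumes "C_order (Suc k) \<phi>"
  shows "(\<phi> has_derivative frechet_derivative \<phi> (at x)) (at x)"
    "C_order k (\<lambda>x. frechet_derivative \<phi> (at x) v)"
  using assms by (auto simp: differentiable_on_def frechet_derivative_works)

lemma C_order_const: "C_order k (\<lambda>x. c)"
proof (induction k arbitrary: c)
  case (Suc k)
  show ?case by (rule C_order_SucI[where D="\<lambda>x v. 0"]) (use Suc in auto)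
qed auto

lemma C_order_bounded_linear: "bounded_linear l \<Longrightarrow> C_order k l"
proof (cases k)
  case 0
  assume "bounded_linear l"
  then show ?thesis using 0 by (simp add: linear_continuous_on)
next
  case (Suc j)
  assume l: "bounded_linear l"
  show ?thesis unfolding Suc
    by (rule C_order_SucI[where D="\<lambda>x. l"])
      (use l bounded_linear_imp_has_derivative in \<open>auto simp: C_order_const\<close>)
qed

lemma C_order_add: "C_order k \<phi> \<Longrightarrow> C_order k \<psi> \<Longrightarrow> C_order k (\<lambda>x. \<phi> x + \<psi> x)"
proof (induction k arbitrary: \<phi> \<psi>)
  case 0 then show ?case by (auto intro: continuous_intros)
next
  case (Suc k)
  show ?case
  proof (rule C_order_SucI[OF has_derivative_add])
    show "(\<phi> has_derivative frechet_derivative \<phi> (at x)) (at x)" for x using C_order_SucD Suc by blast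
    show "(\<psi> has_derivative frechet_derivative \<psi> (at x)) (at x)" for x using C_order_SucD Suc by blast
  qed (use C_order_SucD Suc in blast)
qed

lemma C_order_mult: "C_order k \<phi> \<Longrightarrow> C_order k \<psi> \<Longrightarrow> C_order k (\<lambda>x. \<phi> x * \<psi> x)"
proof (induction k arbitrary: \<phi> \<psi>)
  case 0 then show ?case by (auto intro: continuous_intros)
next
  case (Suc k)
  show ?case
  proof (rule C_order_SucI[OF has_derivative_mult])
    show "(\<phi> has_derivative frechet_derivative \<phi> (at x)) (at x)" for x using C_order_SucD Suc by blast
    show "(\<psi> has_derivative frechet_derivative \<psi> (at x)) (at x)" for x using C_order_SucD Suc by blast
    show "C_order k (\<lambda>x. \<phi> x * frechet_derivative \<psi> (at x) v + frechet_derivative \<phi> (at x) v * \<psi> x)" for v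
      by (intro C_order_add Suc.IH C_order_SucD(2)[OF Suc.prems(1)] C_order_SucD(2)[OF Suc.prems(2)]
        C_order_imp[OF Suc.prems(1)] C_order_imp[OF Suc.prems(2)])
  qed
qed

text \<open>The outer function lives on the real line so that its derivative is again a real
  function of one variable. The chain rule then yields a composition times a directional derivative,
  and the induction closes with the inner function taken one order lower.\<close>

lemma C_order_compose:
  fixes g :: "real \<Rightarrow> real"
  shows "C_order k g \<Longrightarrow> C_order k \<psi> \<Longrightarrow> C_order k (\<lambda>x. g (\<psi> x))"
proof (induction k arbitrary: g \<psi>)
  case 0 then show ?case using continuous_on_compose2[of UNIV g UNIV \<psi>] by simp
next
  case (Suc k)
  let ?g = "\<lambda>x. frechet_derivative g (at x) 1"
  have lin: "frechet_derivative g (at x) h = ?g x * h" for x h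
    using bounded_linear.linear[OF has_derivative_bounded_linear[OF C_order_SucD(1)[OF Suc.prems(1), of x]]]
    by (metis linear_scale mult.right_neutral mult.commute real_scaleR_def)
  show ?case
  proof (rule C_order_SucI)
    show "((\<lambda>x. g (\<psi> x)) has_derivative (\<lambda>v. ?g (\<psi> x) * frechet_derivative \<psi> (at x) v)) (at x)" for x
      by (rule has_derivative_eq_rhs[OF has_derivative_compose[OF C_order_SucD(1)[OF Suc.prems(2)]
        C_order_SucD(1)[OF Suc.prems(1)]]]) (rule ext, rule lin)
    show "C_order k (\<lambda>x. ?g (\<psi> x) * frechet_derivative \<psi> (at x) v)" for v
      by (rule C_order_mult[OF Suc.IH[OF C_order_SucD(2)[OF Suc.prems(1)] C_order_imp[OF Suc.prems(2)]]
        C_order_SucD(2)[OF Suc.prems(2)]])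
  qed
qed

lemma C_order_real_SucI:
  fixes g :: "real \<Rightarrow> real"
  assumes "\<And>x. (g has_real_derivative g' x) (at x)" "C_order k g'"
  shows "C_order (Suc k) g"
  by (rule C_order_SucI[where D="\<lambda>x v. g' x * v"])
    (use assms in \<open>auto simp: has_field_derivative_def intro: C_order_mult C_order_const\<close>)

lemma C_order_inverse: "C_order k \<phi> \<Longrightarrow> (\<And>x. \<phi> x \<noteq> 0) \<Longrightarrow> C_order k (\<lambda>x. inverse (\<phi> x))"
proof (induction k)
  case 0 then show ?case by (auto intro: continuous_intros)
next
  case (Suc k)
  show ?case
  proof (rule C_order_SucI)
    show "((\<lambda>x. inverse (\<phi> x)) has_derivative
       (\<lambda>v. - 1 * (inverse (\<phi> x) * frechet_derivative \<phi> (at x) v * inverse (\<phi> x)))) (at x)" for x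
      using Deriv.has_derivative_inverse[OF Suc.prems(2) C_order_SucD(1)[OF Suc.prems(1)]] by simp
    show "C_order k (\<lambda>x. - 1 * (inverse (\<phi> x) * frechet_derivative \<phi> (at x) v * inverse (\<phi> x)))" for v
      by (intro C_order_mult C_order_const Suc.IH C_order_SucD(2)[OF Suc.prems(1)] C_order_imp[OF Suc.prems(1)] Suc.prems(2))
  qed
qed

definition smooth :: "('a::real_normed_vector \<Rightarrow> real) \<Rightarrow> bool" where
  "smooth \<phi> \<longleftrightarrow> (\<forall>k. C_order k \<phi>)"

lemma smooth_intros:
  "smooth (\<lambda>x. c)"
  "bounded_linear l \<Longrightarrow> smooth l"
  "smooth \<phi> \<Longrightarrow> smooth \<psi> \<Longrightarrow> smooth (\<lambda>x. \<phi> x + \<psi> x)"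
  "smooth \<phi> \<Longrightarrow> smooth \<psi> \<Longrightarrow> smooth (\<lambda>x. \<phi> x - \<psi> x)"
  "smooth \<phi> \<Longrightarrow> smooth (\<lambda>x. \<phi> x / c)"
  "smooth \<phi> \<Longrightarrow> smooth \<psi> \<Longrightarrow> smooth (\<lambda>x. \<phi> x * \<psi> x)"
  "smooth (\<lambda>x::real. x)"
  using C_order_add[of _ \<phi> "\<lambda>x. -1 * \<psi> x"] C_order_mult[of _ \<phi> "\<lambda>x. inverse c"]
    C_order_mult[OF C_order_const, of _ \<psi> "-1"] bounded_linear_ident
  by (auto simp: smooth_def C_order_const C_order_bounded_linear C_order_add C_order_mult divide_inverse)

lemma smooth_sum: "(\<And>i. i \<in> I \<Longrightarrow> smooth (\<phi> i)) \<Longrightarrow> smooth (\<lambda>x. \<Sum>i\<in>I. \<phi> i x)"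
  by (induction I rule: infinite_finite_induct) (simp_all add: smooth_intros(1,3))

lemma smooth_compose:
  fixes g :: "real \<Rightarrow> real"
  shows "smooth g \<Longrightarrow> smooth \<psi> \<Longrightarrow> smooth (\<lambda>x. g (\<psi> x))"
  by (auto simp: smooth_def C_order_compose)

lemma smooth_continuous: "smooth \<phi> \<Longrightarrow> continuous_on S \<phi>"
  unfolding smooth_def using C_order_continuous continuous_on_subset by blast

lemma smooth_has_deriv:
  fixes g :: "real \<Rightarrow> real"
  assumes "smooth g"
  shows "(g has_real_derivative deriv g x) (at x)"
proof -
  have "g differentiable (at x)"
    using C_order_SucD(1)[of 0 g x] assms by (metis smooth_def differentiable_def)
  then show ?thesis
    by (metis DERIV_deriv_iff_real_differentiable)
qed

lemma smooth_deriv: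
  fixes g :: "real \<Rightarrow> real"
  assumes "smooth g"
  shows "smooth (deriv g)"
proof -
  have "deriv g = (\<lambda>x. frechet_derivative g (at x) 1)"
  proof
    fix x
    have "frechet_derivative g (at x) = (*) (deriv g x)"
      using smooth_has_deriv[OF assms, of x] by (metis frechet_derivative_at has_field_derivative_def)
    then show "deriv g x = frechet_derivative g (at x) 1" by simp
  qed
  then show ?thesis using C_order_SucD(2) assms by (metis smooth_def)
qed

subsection \<open>Smooth steps\<close>

text \<open>The factor \<open>poly p (1 / x)\<close> makes this family closed under differentiation,
  so that smoothness at \<open>0\<close> of the classical \<open>exp (- (1 / x))\<close>, the case
  \<open>p = 1\<close>, becomes a plain induction on the order.\<close>

definition flat :: "real poly \<Rightarrow> real \<Rightarrow> real" where
  "flat p x = (if x > 0 then poly p (1 / x) * exp (- (1 / x)) else 0)"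

lemma poly_div_exp_0: "((\<lambda>y::real. poly p y * exp (- y)) \<longlongrightarrow> 0) at_top"
proof -
  have "((\<lambda>y::real. \<Sum>i\<le>degree p. coeff p i * (y ^ i / exp y)) \<longlongrightarrow> (\<Sum>i\<le>degree p. coeff p i * 0)) at_top"
    by (intro tendsto_sum tendsto_mult_left tendsto_power_div_exp_0)
  moreover have "(\<Sum>i\<le>degree p. coeff p i * (y ^ i / exp y)) = poly p y * exp (- y)" for y :: real
    by (simp add: poly_altdef sum_distrib_right exp_minus divide_inverse mult.assoc)
  ultimately show ?thesis by simp
qed

text \<open>With \<open>y = 1 / x\<close>, whose derivative is \<open>- y^2\<close>, the function
  \<open>p y * exp (- y)\<close> has derivative \<open>y^2 * (p y - p' y) * exp (- y)\<close>. At
  \<open>0\<close> the difference quotient is treated from either side separately.\<close>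

lemma flat_has_deriv:
  "(flat p has_real_derivative flat (monom 1 2 * (p - pderiv p)) x) (at x)"
proof -
  consider "x > 0" | "x < 0" | "x = 0" by linarith
  then show ?thesis
  proof cases
    case 1
    have "((\<lambda>x. poly p (1 / x) * exp (- (1 / x))) has_real_derivative flat (monom 1 2 * (p - pderiv p)) x) (at x)"
      using 1 by (auto intro!: derivative_eq_intros DERIV_chain2[OF poly_DERIV]
        simp: flat_def poly_monom field_simps power2_eq_square)
    moreover have "\<forall>\<^sub>F y in nhds x. flat p y = poly p (1 / y) * exp (- (1 / y))"
      using eventually_nhds_in_open[of "{0<..}" x] 1 by (auto elim!: eventually_mono simp: flat_def)
    ultimately show ?thesis by (subst DERIV_cong_ev) auto
  next
    case 2
    have "\<forall>\<^sub>F y in nhds x. flat p y = 0"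
      using eventually_nhds_in_open[of "{..<0}" x] 2 by (auto elim!: eventually_mono simp: flat_def)
    then show ?thesis using 2 by (subst DERIV_cong_ev[OF refl _ refl]) (auto simp: flat_def)
  next
    case 3
    have "((\<lambda>h. flat p h / h) \<longlongrightarrow> 0) (at 0)"
    proof (rule filterlim_split_at)
      show "((\<lambda>h. flat p h / h) \<longlongrightarrow> 0) (at_left 0)"
        by (rule tendsto_eventually) (auto simp: eventually_at_filter flat_def)
      \<comment> \<open>To the right of \<open>0\<close> the difference quotient is itself of flat
        form, with the polynomial \<open>y * p y\<close>, that is \<open>pCons 0 p\<close>.\<close>
      have "((\<lambda>h. poly (pCons 0 p) (inverse h) * exp (- inverse h)) \<longlongrightarrow> 0) (at_right (0::real))"
        by (rule filterlim_compose[OF poly_div_exp_0 filterlim_inverse_at_top_right])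
      then show "((\<lambda>h. flat p h / h) \<longlongrightarrow> 0) (at_right 0)"
        by (rule Lim_transform_eventually) (auto simp: eventually_at_filter flat_def field_simps)
    qed
    then show ?thesis using 3 by (simp add: DERIV_def flat_def)
  qed
qed

lemma smooth_flat: "smooth (flat p)"
proof -
  have "C_order k (flat p)" for k
  proof (induction k arbitrary: p)
    case 0
    show ?case using DERIV_continuous[OF flat_has_deriv] by (auto simp: continuous_on_eq_continuous_at)
  next
    case (Suc k)
    show ?case by (rule C_order_real_SucI[OF flat_has_deriv Suc])
  qed
  then show ?thesis by (simp add: smooth_def)
qed

text \<open>The step supplies the cutoffs and its derivative \<open>smooth_bump\<close> the
  mollifiers; using one function for both makes the derivative of a time cutoff a difference of two
  mollifiers. The denominator is positive because \<open>x\<close> or \<open>1 - x\<close>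
  is.\<close>

definition smooth_step :: "real \<Rightarrow> real" where
  "smooth_step x = flat 1 x * inverse (flat 1 x + flat 1 (1 - x))"

abbreviation "smooth_bump \<equiv> deriv smooth_step"

lemma flat1_pos: "0 \<le> flat 1 x" "x > 0 \<Longrightarrow> 0 < flat 1 x" "x \<le> 0 \<Longrightarrow> flat 1 x = 0"
  by (auto simp: flat_def)

lemma flat1_sum: "0 < flat 1 x + flat 1 (1 - x)"
proof (cases "x > 0")
  case True
  then show ?thesis using flat1_pos(2)[OF True] flat1_pos(1)[of "1-x"] by simp
next
  case False
  then show ?thesis using flat1_pos(2)[of "1-x"] flat1_pos(1)[of "x"] by simp
qed

lemma smooth_step: "smooth smooth_step"
proof -
  have "smooth (\<lambda>x. flat 1 x + flat 1 (1 - x))"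
    by (intro smooth_intros(1,3,4,7) smooth_flat smooth_compose[of "flat 1" "\<lambda>x. 1 - x"])
  then have "smooth (\<lambda>x. inverse (flat 1 x + flat 1 (1 - x)))"
    using flat1_sum by (auto simp: smooth_def less_le intro!: C_order_inverse)
  then show ?thesis
    unfolding smooth_step_def[abs_def] by (intro smooth_intros(6) smooth_flat)
qed

lemma smooth_bump: "smooth smooth_bump"
  by (rule smooth_deriv[OF smooth_step])

lemma smooth_step_0: "x \<le> 0 \<Longrightarrow> smooth_step x = 0"
  by (simp add: smooth_step_def flat1_pos)

lemma smooth_step_1: "x \<ge> 1 \<Longrightarrow> smooth_step x = 1"
  using flat1_pos(2)[of x] by (simp add: smooth_step_def flat1_pos(3))

lemma smooth_step_has_deriv: "(smooth_step has_real_derivative smooth_bump x) (at x)"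
  by (rule smooth_has_deriv[OF smooth_step])

lemma smooth_bump_nonneg: "0 \<le> smooth_bump x"
proof -
  let ?d = "flat (monom 1 2)" and ?s = "flat 1 x + flat 1 (1 - x)"
  have d: "0 \<le> ?d x" for x by (auto simp: flat_def poly_monom)
  have f: "(flat 1 has_real_derivative ?d x) (at x)" for x
    using flat_has_deriv[of 1 x] by simp
  have "(smooth_step has_real_derivative
     (?d x * ?s - flat 1 x * (?d x + ?d (1 - x) * - 1)) / ?s\<^sup>2) (at x)"
    unfolding smooth_step_def[abs_def] using flat1_sum[of x]
    by (auto intro!: derivative_eq_intros f DERIV_chain2[OF f] simp: field_simps power2_eq_square)
  \<comment> \<open>The two products \<open>?d x * flat 1 x\<close> in the numerator of the quotient
    rule cancel, and only nonnegative terms are left.\<close>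
  then have "smooth_bump x = (?d x * flat 1 (1 - x) + flat 1 x * ?d (1 - x)) / ?s\<^sup>2"
    by (subst DERIV_imp_deriv) (auto simp: algebra_simps)
  then show ?thesis using d flat1_pos by auto
qed

lemma smooth_step_mono: "x \<le> y \<Longrightarrow> smooth_step x \<le> smooth_step y"
  using DERIV_nonneg_imp_nondecreasing[of x y smooth_step] smooth_step_has_deriv smooth_bump_nonneg by blast

lemma smooth_step_range: "0 \<le> smooth_step x" "smooth_step x \<le> 1"
  using smooth_step_mono[of "min 0 x" x] smooth_step_mono[of x "max 1 x"] smooth_step_0[of "min 0 x"] smooth_step_1[of "max 1 x"]
  by auto

lemma smooth_bump_0: assumes "x \<le> 0 \<or> x \<ge> 1" shows "smooth_bump x = 0"
proof -
  have out: "smooth_bump x = 0" if "x \<in> {..<0} \<union> {1<..}" for x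
  proof -
    define c where "c = smooth_step x"
    have "\<forall>\<^sub>F y in nhds x. smooth_step y = c"
    proof (cases "x < 0")
      case True
      then show ?thesis using eventually_nhds_in_open[of "{..<0}" x]
        by (auto elim!: eventually_mono simp: c_def smooth_step_0)
    next
      case False
      then show ?thesis using eventually_nhds_in_open[of "{1<..}" x] that
        by (auto elim!: eventually_mono simp: c_def smooth_step_1)
    qed
    then have "(smooth_step has_real_derivative 0) (at x)"
      by (subst DERIV_cong_ev[OF refl _ refl]) auto
    then show ?thesis by (rule DERIV_imp_deriv)
  qed
  \<comment> \<open>At \<open>0\<close> and \<open>1\<close> the step is not locally constant; there
    the derivative vanishes by continuity.\<close>
  have cl: "closed {x. smooth_bump x = 0}"
    by (intro closed_Collect_eq smooth_continuous smooth_bump continuous_intros)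
  have "{..0} \<union> {1..} \<subseteq> {x. smooth_bump x = 0}"
    using closure_minimal[OF _ cl, of "{..<0} \<union> {1<..}"] out by (auto simp: closure_Un subset_iff)
  then show ?thesis using assms by auto
qed

lemma smooth_bump_bounded: obtains M where "M > 0" "\<And>x. smooth_bump x \<le> M"
proof -
  have "compact (smooth_bump ` {0..1})"
    by (rule compact_continuous_image[OF smooth_continuous[OF smooth_bump] compact_Icc])
  then obtain M where M: "\<forall>x\<in>{0..1}. \<bar>smooth_bump x\<bar> \<le> M"
    by (metis compact_imp_bounded bounded_iff real_norm_def image_eqI)
  show thesis
  proof (rule that[of "max 1 M"])
    show "smooth_bump x \<le> max 1 M" for x
      using M smooth_bump_0[of x] by (cases "x \<in> {0..1}") force+
  qed simp
qed

lemma smooth_bump_integral: "integrable lborel smooth_bump" "(LINT x|lborel. smooth_bump x) = 1"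
proof -
  have "has_bochner_integral lborel (\<lambda>x. indicator {0..1} x *\<^sub>R smooth_bump x) (smooth_step 1 - smooth_step 0)"
    using has_bochner_integral_FTC_Icc[of 0 1 smooth_step smooth_bump] smooth_step_has_deriv
      smooth_continuous[OF smooth_bump]
    by (metis has_field_derivative_at_within has_real_derivative_iff_has_vector_derivative zero_le_one)
  moreover have "(\<lambda>x. indicator {0..1} x *\<^sub>R smooth_bump x) = smooth_bump"
    using smooth_bump_0 by (auto simp: indicator_def fun_eq_iff) (metis linorder_le_cases)+
  ultimately show "integrable lborel smooth_bump" "(LINT x|lborel. smooth_bump x) = 1"
    by (auto simp: has_bochner_integral_iff smooth_step_0 smooth_step_1)
qed

subsection \<open>Kruzhkov's doubling of variables\<close>

lemma integral_lborel_prod: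
  fixes f :: "'a::euclidean_space \<times> 'b::euclidean_space \<Rightarrow> real"
  assumes "integrable lborel f"
  shows "(LINT p|lborel. f p) = (LINT x|lborel. LINT y|lborel. f (x, y))"
    and "(LINT p|lborel. f p) = (LINT y|lborel. LINT x|lborel. f (x, y))"
    and "AE x in lborel. integrable lborel (\<lambda>y. f (x, y))"
    and "integrable lborel (\<lambda>x. LINT y|lborel. f (x, y))"
    and "integrable lborel (\<lambda>y. LINT x|lborel. f (x, y))"
proof -
  have f: "integrable (lborel \<Otimes>\<^sub>M lborel) f" using assms by (simp add: lborel_prod)
  show "(LINT p|lborel. f p) = (LINT x|lborel. LINT y|lborel. f (x, y))"
    using lborel_pair.integral_fst'[OF f] by (simp add: lborel_prod)
  show "(LINT p|lborel. f p) = (LINT y|lborel. LINT x|lborel. f (x, y))"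
    using lborel_pair.integral_snd[of "\<lambda>x y. f (x, y)"] f by (simp add: lborel_prod)
  show "AE x in lborel. integrable lborel (\<lambda>y. f (x, y))"
    using lborel_pair.AE_integrable_fst'[OF f] .
  show "integrable lborel (\<lambda>x. LINT y|lborel. f (x, y))"
    using lborel_pair.integrable_fst'[OF f] .
  show "integrable lborel (\<lambda>y. LINT x|lborel. f (x, y))"
    using lborel_pair.integrable_snd[of "\<lambda>x y. f (x, y)"] f by simp
qed

text \<open>Vanishing off \<open>S\<close> is asked of the product and not of \<open>\<phi>\<close>,
  so that compact support may also come from the factor that is merely measurable;
  \<open>\<phi> = 1\<close> covers bounded measurable functions of compact support.\<close>

lemma integrable_bounded_times_continuous:
  fixes m \<phi> :: "'a::euclidean_space \<Rightarrow> real"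
  assumes m: "m \<in> borel_measurable borel" "\<And>p. \<bar>m p\<bar> \<le> B"
    and \<phi>: "continuous_on UNIV \<phi>" and S: "compact S" "\<And>p. p \<notin> S \<Longrightarrow> m p * \<phi> p = 0"
  shows "integrable lborel (\<lambda>p. m p * \<phi> p)"
proof (rule Bochner_Integration.integrable_bound)
  show "integrable lborel (\<lambda>p. B * (indicator S p *\<^sub>R \<phi> p))"
    using \<phi> S(1) by (intro integrable_mult_right borel_integrable_compact) (auto intro: continuous_on_subset)
  show "(\<lambda>p. m p * \<phi> p) \<in> borel_measurable lborel"
    using m(1) borel_measurable_continuous_onI[OF \<phi>] by simp
  have "norm (m p * \<phi> p) \<le> norm (B * (indicator S p *\<^sub>R \<phi> p))" for p
  proof (cases "p \<in> S")
    case True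
    have "\<bar>m p\<bar> * \<bar>\<phi> p\<bar> \<le> \<bar>B\<bar> * \<bar>\<phi> p\<bar>"
      using m(2)[of p] by (intro mult_right_mono) auto
    then show ?thesis using True by (simp add: abs_mult)
  qed (simp add: S(2))
  then show "AE p in lborel. norm (m p * \<phi> p) \<le> norm (B * (indicator S p *\<^sub>R \<phi> p))" by simp
qed

section \<open>Cutoff functions and one-sided mollifiers\<close>

definition cutoff :: "real \<Rightarrow> real \<Rightarrow> (real \<Rightarrow> real) \<Rightarrow> bool" where
  "cutoff a b g \<longleftrightarrow> smooth g \<and> (\<forall>t. 0 \<le> g t) \<and> (\<forall>t. t \<notin> {a..b} \<longrightarrow> g t = 0)"

lemma cutoffD:
  assumes "cutoff a b g"
  shows "smooth g" "0 \<le> g t" "t \<notin> {a..b} \<Longrightarrow> g t = 0"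
    "(g has_real_derivative deriv g t) (at t)"
    "continuous_on UNIV g" "continuous_on UNIV (deriv g)"
    "g \<in> borel_measurable borel" "deriv g \<in> borel_measurable borel"
proof -
  have s: "smooth g" using assms by (simp add: cutoff_def)
  then show "smooth g" "(g has_real_derivative deriv g t) (at t)" by (auto intro: smooth_has_deriv)
  show c: "continuous_on UNIV g" "continuous_on UNIV (deriv g)"
    using s smooth_continuous smooth_deriv by blast+
  show "g \<in> borel_measurable borel" "deriv g \<in> borel_measurable borel"
    using c by (auto intro: borel_measurable_continuous_onI)
qed (use assms in \<open>auto simp: cutoff_def\<close>)

lemma cutoff_deriv_0:
  assumes "cutoff a b g" "t \<notin> {a..b}"
  shows "deriv g t = 0"
proof -
  have "\<forall>\<^sub>F y in nhds t. g y = 0"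
    using eventually_nhds_in_open[of "- {a..b}" t] assms
    by (auto elim!: eventually_mono simp: cutoff_def open_Compl)
  then have "(g has_real_derivative 0) (at t)"
    by (subst DERIV_cong_ev[OF refl _ refl]) auto
  then show ?thesis by (rule DERIV_imp_deriv)
qed

lemma cutoff_mult:
  assumes "cutoff a b g" "smooth h" "\<And>t. 0 \<le> h t"
  shows "cutoff a b (\<lambda>t. g t * h t)"
  using assms by (auto simp: cutoff_def intro: smooth_intros)

lemma cutoff_bounded:
  assumes "cutoff a b g"
  obtains M where "M > 0" "\<And>x. g x \<le> M" "\<And>x. \<bar>deriv g x\<bar> \<le> M"
proof -
  have "bounded (g ` {a..b})" "bounded (deriv g ` {a..b})"
    using cutoffD[OF assms]
    by (auto intro!: compact_imp_bounded compact_continuous_image[OF _ compact_Icc] intro: continuous_on_subset)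
  then obtain M N where M: "\<forall>x\<in>{a..b}. \<bar>g x\<bar> \<le> M" and N: "\<forall>x\<in>{a..b}. \<bar>deriv g x\<bar> \<le> N"
    unfolding bounded_iff by (metis image_eqI real_norm_def)
  show thesis
  proof (rule that[of "max 1 (max M N)"])
    show "g x \<le> max 1 (max M N)" "\<bar>deriv g x\<bar> \<le> max 1 (max M N)" for x
      using M N cutoffD(3)[OF assms, of x] cutoff_deriv_0[OF assms, of x] 
      by (cases "x \<in> {a..b}"; fastforce)+
  qed simp
qed

text \<open>The support lies to the right of \<open>0\<close>: in the doubling of variables the
  second time is then never earlier than the first, so that translated test functions stay at
  positive times.\<close>

definition mollifier :: "real \<Rightarrow> (real \<Rightarrow> real) \<Rightarrow> bool" where
  "mollifier \<epsilon> d \<longleftrightarrow> cutoff 0 \<epsilon> d \<and> (LINT s|lborel. d s) = 1"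

lemma mollifier_bump:
  assumes "\<epsilon> > 0"
  shows "mollifier \<epsilon> (\<lambda>s. smooth_bump (s / \<epsilon>) / \<epsilon>)"
proof -
  have "(LINT x|lborel. smooth_bump x) = \<bar>1 / \<epsilon>\<bar> *\<^sub>R (LINT s|lborel. smooth_bump (0 + (1 / \<epsilon>) * s))"
    using assms by (intro lborel_integral_real_affine) auto
  then have "(LINT s|lborel. smooth_bump (s / \<epsilon>) / \<epsilon>) = 1"
    using assms smooth_bump_integral by simp
  moreover have "cutoff 0 \<epsilon> (\<lambda>s. smooth_bump (s / \<epsilon>) / \<epsilon>)"
    unfolding cutoff_def using assms smooth_bump_nonneg
    by (auto intro!: smooth_intros(5) smooth_compose[OF smooth_bump smooth_intros(5)[OF smooth_intros(7)]] smooth_bump_0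
      simp: field_simps)
  ultimately show ?thesis by (simp add: mollifier_def)
qed

text \<open>The Kruzhkov entropy flux \<open>sgn (a - b) * (F a - F b)\<close> (lemma \<open>kflux_sgn\<close>), in a form that
  visibly inherits the continuity of \<open>F\<close>.\<close>

definition kflux :: "(real \<Rightarrow> real) \<Rightarrow> real \<Rightarrow> real \<Rightarrow> real" where
  "kflux F a b = F (max a b) - F (min a b)"

lemma kflux_commute: "kflux F a b = kflux F b a"
  by (simp add: kflux_def max.commute min.commute)

lemma kflux_sgn: "kflux F a b = sgn (a - b) * (F a - F b)"
  by (auto simp: kflux_def max_def min_def sgn_if)

text \<open>This affine modulus replaces the Lipschitz continuity of the flux everywhere below: in one space
  dimension an error \<open>e\<close> per unit length is harmless against cutoffs of slope \<open>1 / N\<close> on a set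
  of length \<open>O(N)\<close>.\<close>

lemma continuous_modulus:
  fixes F :: "real \<Rightarrow> real"
  assumes "continuous_on {0..R} F" "e > 0"
  obtains C where "C \<ge> 0" "\<And>a b. a \<in> {0..R} \<Longrightarrow> b \<in> {0..R} \<Longrightarrow> \<bar>F a - F b\<bar> \<le> e + C * \<bar>a - b\<bar>"
proof -
  have "uniformly_continuous_on {0..R} F"
    by (intro compact_uniformly_continuous assms) auto
  then obtain d where d: "d > 0" "\<And>a b. a \<in> {0..R} \<Longrightarrow> b \<in> {0..R} \<Longrightarrow> dist b a < d \<Longrightarrow> dist (F b) (F a) < e"
    using assms(2) unfolding uniformly_continuous_on_def by meson
  have "bounded (F ` {0..R})"
    by (intro compact_imp_bounded compact_continuous_image assms) auto
  then obtain M where M: "\<And>a. a \<in> {0..R} \<Longrightarrow> \<bar>F a\<bar> \<le> M" unfolding bounded_iff by (metis image_eqI real_norm_def)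
  show thesis
  \<comment> \<open>The slope is chosen so that from distance \<open>d\<close> on the linear term
    alone exceeds the trivial bound \<open>2 * \<bar>M\<bar>\<close>.\<close>
  proof (rule that[of "2 * \<bar>M\<bar> / d"])
    fix a b assume ab: "a \<in> {0..R}" "b \<in> {0..R}"
    show "\<bar>F a - F b\<bar> \<le> e + 2 * \<bar>M\<bar> / d * \<bar>a - b\<bar>"
    proof (cases "\<bar>a - b\<bar> < d")
      case True
      then have "\<bar>F a - F b\<bar> < e" using d(2)[OF ab(2,1)] by (simp add: dist_real_def)
      moreover have "0 \<le> 2 * \<bar>M\<bar> / d * \<bar>a - b\<bar>" using d(1) by simp
      ultimately show ?thesis by linarith
    next
      case False
      have "\<bar>F a - F b\<bar> \<le> 2 * \<bar>M\<bar>" using M[OF ab(1)] M[OF ab(2)] by linarith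
      also have "\<dots> = 2 * \<bar>M\<bar> / d * d" using d(1) by simp
      also have "\<dots> \<le> 2 * \<bar>M\<bar> / d * \<bar>a - b\<bar>"
        using False d(1) by (intro mult_left_mono) auto
      finally show ?thesis using assms(2) by linarith
    qed
  qed (use d(1) in auto)
qed

text \<open>Each of \<open>max a b\<close> and \<open>min a b\<close> moves by at most
  \<open>\<bar>b - b'\<bar>\<close>, and the modulus is applied once to each, whence the factors
  \<open>2\<close>.\<close>

lemma kflux_modulus:
  assumes F: "\<And>a b. a \<in> {0..R} \<Longrightarrow> b \<in> {0..R} \<Longrightarrow> \<bar>F a - F b\<bar> \<le> e + C * \<bar>a - b\<bar>" and "C \<ge> 0"
    and "a \<in> {0..R}" "b \<in> {0..R}" "b' \<in> {0..R}"
  shows "\<bar>kflux F a b - kflux F a b'\<bar> \<le> 2 * e + 2 * C * \<bar>b - b'\<bar>"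
proof -
  have *: "C * \<bar>max a b - max a b'\<bar> \<le> C * \<bar>b - b'\<bar>" "C * \<bar>min a b - min a b'\<bar> \<le> C * \<bar>b - b'\<bar>"
    by (auto intro!: mult_left_mono \<open>C \<ge> 0\<close>)
  have "\<bar>F (max a b) - F (max a b')\<bar> \<le> e + C * \<bar>max a b - max a b'\<bar>"
    "\<bar>F (min a b) - F (min a b')\<bar> \<le> e + C * \<bar>min a b - min a b'\<bar>"
    using assms(3-5) by (auto intro!: F[unfolded atLeastAtMost_iff] simp del: max_def min_def simp: le_max_iff_disj min_le_iff_disj)
  moreover have "\<bar>kflux F a b - kflux F a b'\<bar> \<le> \<bar>F (max a b) - F (max a b')\<bar> + \<bar>F (min a b) - F (min a b')\<bar>"
    unfolding kflux_def by linarith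
  moreover have "2 * C * \<bar>b - b'\<bar> = C * \<bar>b - b'\<bar> + C * \<bar>b - b'\<bar>" by simp
  ultimately show ?thesis using * by linarith
qed

text \<open>Test functions of product form suffice for the doubling of variables.\<close>

definition kruzhkov :: "real \<Rightarrow> (real \<Rightarrow> real) \<Rightarrow> (real \<times> real \<Rightarrow> real) \<Rightarrow> bool" where
  "kruzhkov R F u \<longleftrightarrow> u \<in> borel_measurable borel \<and> (\<forall>z. u z \<in> {0..R}) \<and>
    (\<forall>\<kappa>\<in>{0..R}. \<forall>a b c g k. 0 < a \<longrightarrow> cutoff a b g \<longrightarrow> cutoff (- c) c k \<longrightarrow>
      0 \<le> (LINT z|lborel. \<bar>u z - \<kappa>\<bar> * (deriv g (fst z) * k (snd z))
            + kflux F (u z) \<kappa> * (g (fst z) * deriv k (snd z))))"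

lemma kruzhkovD:
  assumes "kruzhkov R F u"
  shows "u \<in> borel_measurable borel" "u z \<in> {0..R}"
    "\<kappa> \<in> {0..R} \<Longrightarrow> 0 < a \<Longrightarrow> cutoff a b g \<Longrightarrow> cutoff (- c) c k \<Longrightarrow>
      0 \<le> (LINT z|lborel. \<bar>u z - \<kappa>\<bar> * (deriv g (fst z) * k (snd z))
            + kflux F (u z) \<kappa> * (g (fst z) * deriv k (snd z)))"
  using assms unfolding kruzhkov_def by blast+

text \<open>Spatial supports in \<open>kruzhkov\<close> are symmetric intervals, whereas mollifiers
  centred at an arbitrary point live on other ones; these are enclosed in a symmetric
  interval.\<close>

lemma kruzhkov_lower:
  assumes "kruzhkov R F u" "\<kappa> \<in> {0..R}" "0 < a" "cutoff a b g" "cutoff c' c k"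
  shows "0 \<le> (LINT z|lborel. \<bar>u z - \<kappa>\<bar> * (deriv g (fst z) * k (snd z))
            + kflux F (u z) \<kappa> * (g (fst z) * deriv k (snd z)))"
proof -
  have "cutoff (- max \<bar>c\<bar> \<bar>c'\<bar>) (max \<bar>c\<bar> \<bar>c'\<bar>) k"
    unfolding cutoff_def
  proof (intro conjI allI impI)
    fix t assume "t \<notin> {- max \<bar>c\<bar> \<bar>c'\<bar>..max \<bar>c\<bar> \<bar>c'\<bar>}"
    then have "t \<notin> {c'..c}" by auto
    then show "k t = 0" by (rule cutoffD(3)[OF assms(5)])
  qed (use assms(5) in \<open>auto simp: cutoff_def\<close>)
  then show ?thesis by (rule kruzhkovD(3)[OF assms(1-4)])
qed

lemma flux_bounded:
  fixes F :: "real \<Rightarrow> real"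
  assumes "continuous_on UNIV F"
  obtains B where "B \<ge> 0" "\<And>a b. a \<in> {0..R} \<Longrightarrow> b \<in> {0..R} \<Longrightarrow> \<bar>a - b\<bar> \<le> B \<and> \<bar>kflux F a b\<bar> \<le> B"
proof -
  have "bounded (F ` {0..R})"
    by (intro compact_imp_bounded compact_continuous_image continuous_on_subset[OF assms]) auto
  then obtain M where M: "\<And>a. a \<in> {0..R} \<Longrightarrow> \<bar>F a\<bar> \<le> M" unfolding bounded_iff by (metis image_eqI real_norm_def)
  show thesis
  proof (rule that[of "2 * \<bar>M\<bar> + \<bar>R\<bar>"])
    fix a b assume "a \<in> {0..R}" "b \<in> {0..R}"
    moreover from this have "max a b \<in> {0..R}" "min a b \<in> {0..R}" by auto
    ultimately show "\<bar>a - b\<bar> \<le> 2 * \<bar>M\<bar> + \<bar>R\<bar> \<and> \<bar>kflux F a b\<bar> \<le> 2 * \<bar>M\<bar> + \<bar>R\<bar>"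
      using M[of "max a b"] M[of "min a b"] unfolding kflux_def atLeastAtMost_iff by linarith
  qed simp
qed

lemma kflux_measurable:
  assumes "continuous_on UNIV F" "u \<in> borel_measurable M" "v \<in> borel_measurable M"
  shows "(\<lambda>z. kflux F (u z) (v z)) \<in> borel_measurable M"
proof -
  have F: "F \<in> borel_measurable borel" by (rule borel_measurable_continuous_onI[OF assms(1)])
  show ?thesis unfolding kflux_def
    by (intro borel_measurable_diff measurable_compose[OF _ F] borel_measurable_max borel_measurable_min assms(2,3))
qed

text \<open>The point \<open>p\<close> stands for \<open>((t, x), (s, y))\<close>. The factors
  \<open>D (s - t)\<close> and \<open>E (y - x)\<close> are kept apart because a partial derivative
  of the test function replaces one of two equal mollifiers by its derivative.\<close>

lemma mollifier_integrable:
  fixes m :: "(real \<times> real) \<times> (real \<times> real) \<Rightarrow> real"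
  assumes m: "m \<in> borel_measurable borel" "\<And>p. \<bar>m p\<bar> \<le> B"
    and c: "continuous_on UNIV A" "continuous_on UNIV C" "continuous_on UNIV D" "continuous_on UNIV E"
    and z: "\<And>t. t \<notin> {a..b} \<Longrightarrow> A t = 0" "\<And>t. t \<notin> {c'..c} \<Longrightarrow> C t = 0"
      "\<And>t. t \<notin> {0..\<epsilon>} \<Longrightarrow> D t = 0" "\<And>t. t \<notin> {0..\<epsilon>} \<Longrightarrow> E t = (0::real)"
  shows "integrable lborel (\<lambda>p. m p * (A (fst (fst p)) * C (snd (fst p)) *
    (D (fst (snd p) - fst (fst p)) * E (snd (snd p) - snd (fst p)))))"
proof (rule integrable_bounded_times_continuous[OF m])
  have ce: "continuous_on UNIV (\<lambda>x. h (l x))" if "continuous_on UNIV h" "continuous_on UNIV l"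
    for h :: "real \<Rightarrow> real" and l :: "(real \<times> real) \<times> (real \<times> real) \<Rightarrow> real"
    using continuous_on_compose2[OF that(1,2)] by simp
  show "continuous_on UNIV (\<lambda>p. A (fst (fst p)) * C (snd (fst p)) *
    (D (fst (snd p) - fst (fst p)) * E (snd (snd p) - snd (fst p))))"
    by (intro continuous_on_mult ce[OF c(1)] ce[OF c(2)] ce[OF c(3)] ce[OF c(4)] continuous_intros)
  show "compact (({a..b} \<times> {c'..c}) \<times> ({a..b+\<epsilon>} \<times> {c'..c+\<epsilon>}))"
    by (intro compact_Times compact_Icc)
  fix p :: "(real \<times> real) \<times> (real \<times> real)"
  assume p: "p \<notin> ({a..b} \<times> {c'..c}) \<times> ({a..b+\<epsilon>} \<times> {c'..c+\<epsilon>})"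
  obtain t x s y where pp: "p = ((t, x), (s, y))" by (metis prod.collapse)
  have "t \<notin> {a..b} \<or> x \<notin> {c'..c} \<or> s - t \<notin> {0..\<epsilon>} \<or> y - x \<notin> {0..\<epsilon>}"
    using p pp by auto
  then show "m p * (A (fst (fst p)) * C (snd (fst p)) *
    (D (fst (snd p) - fst (fst p)) * E (snd (snd p) - snd (fst p)))) = 0"
    using z[of t] z[of x] z[of "s - t"] z[of "y - x"] by (auto simp: pp)
qed

text \<open>The inequality for \<open>u\<close> is used with the constant \<open>v (s, y)\<close>,
  the one for \<open>v\<close> with the constant \<open>u (t, x)\<close>, both with the test
  function \<open>\<theta> t * \<Psi> x * d (s - t) * d (y - x)\<close>. Derivatives falling on the
  mollifiers have opposite signs in the two inequalities and cancel in the sum. As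
  \<open>\<theta>\<close> and \<open>\<Psi>\<close> depend on the first point only, the inequality
  for \<open>v\<close> contributes no other terms.\<close>

lemma kruzhkov_doubled:
  assumes u: "kruzhkov R F u" and v: "kruzhkov R F v" and F: "continuous_on UNIV F"
    and \<theta>: "cutoff a b \<theta>" "0 < a" and \<Psi>: "cutoff c' c \<Psi>" and d: "cutoff 0 \<epsilon> d"
  shows "0 \<le> (LINT p|lborel. (\<bar>u (fst p) - v (snd p)\<bar> * (deriv \<theta> (fst (fst p)) * \<Psi> (snd (fst p)))
      + kflux F (u (fst p)) (v (snd p)) * (\<theta> (fst (fst p)) * deriv \<Psi> (snd (fst p))))
      * (d (fst (snd p) - fst (fst p)) * d (snd (snd p) - snd (fst p))))"
proof -
  define d' where "d' = deriv d"
  let ?U = "\<lambda>p. \<bar>u (fst p) - v (snd p)\<bar>" and ?Q = "\<lambda>p. kflux F (u (fst p)) (v (snd p))"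
  let ?K = "\<lambda>A C D E p. A (fst (fst p)) * C (snd (fst p)) *
    (D (fst (snd p) - fst (fst p)) * E (snd (snd p) - snd (fst p)) :: real)"
  obtain B where B: "B \<ge> 0" "\<And>a b. a \<in> {0..R} \<Longrightarrow> b \<in> {0..R} \<Longrightarrow> \<bar>a - b\<bar> \<le> B \<and> \<bar>kflux F a b\<bar> \<le> B"
    using flux_bounded[OF F] by blast
  have mf: "(\<lambda>p. u (fst p)) \<in> borel_measurable borel" "(\<lambda>p. v (snd p)) \<in> borel_measurable borel"
    using measurable_compose[OF _ kruzhkovD(1)[OF u], of fst borel] measurable_compose[OF _ kruzhkovD(1)[OF v], of snd borel]
      borel_measurable_continuous_onI[OF continuous_on_fst[OF continuous_on_id]] borel_measurable_continuous_onI[OF continuous_on_snd[OF continuous_on_id]]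
    by (auto simp: id_def)
  have U: "?U \<in> borel_measurable borel" "\<bar>?U p\<bar> \<le> B" for p
    using B(2)[OF kruzhkovD(2)[OF u] kruzhkovD(2)[OF v]]
    by (auto intro!: borel_measurable_abs borel_measurable_diff mf)
  have Q: "?Q \<in> borel_measurable borel" "\<bar>?Q p\<bar> \<le> B" for p
    using B(2)[OF kruzhkovD(2)[OF u] kruzhkovD(2)[OF v]] kflux_measurable[OF F mf] by auto
  note ki = mollifier_integrable[where a=a and b=b and c'=c' and c=c and \<epsilon>=\<epsilon>]
  note ff = cutoffD[OF \<theta>(1)] cutoffD[OF \<Psi>] cutoffD[OF d] cutoff_deriv_0[OF \<theta>(1)] cutoff_deriv_0[OF \<Psi>] cutoff_deriv_0[OF d]
  define T1 where "T1 p = ?U p * ?K (deriv \<theta>) \<Psi> d d p - ?U p * ?K \<theta> \<Psi> d' d p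
     + (?Q p * ?K \<theta> (deriv \<Psi>) d d p - ?Q p * ?K \<theta> \<Psi> d d' p)" for p
  define T2 where "T2 p = ?U p * ?K \<theta> \<Psi> d' d p + ?Q p * ?K \<theta> \<Psi> d d' p" for p
  have i1: "integrable lborel T1" and i2: "integrable lborel T2"
    unfolding T1_def T2_def d'_def
    by (intro Bochner_Integration.integrable_add Bochner_Integration.integrable_diff ki[OF U] ki[OF Q] ff; assumption)+
  have "0 \<le> (LINT z|lborel. T1 (z, w))" for w
  proof -
    let ?g = "\<lambda>t. \<theta> t * d (fst w - t)" and ?k = "\<lambda>x. \<Psi> x * d (snd w - x)"
    have sm: "smooth (\<lambda>t. d (s - t))" for s
      by (rule smooth_compose[OF cutoffD(1)[OF d] smooth_intros(4)[OF smooth_intros(1,7)]])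
    have dg: "deriv ?g t = deriv \<theta> t * d (fst w - t) - \<theta> t * d' (fst w - t)" for t
      unfolding d'_def
      by (rule DERIV_imp_deriv) (auto intro!: derivative_eq_intros cutoffD(4)[OF \<theta>(1)] DERIV_chain2[OF cutoffD(4)[OF d]] simp: algebra_simps)
    have dk: "deriv ?k t = deriv \<Psi> t * d (snd w - t) - \<Psi> t * d' (snd w - t)" for t
      unfolding d'_def
      by (rule DERIV_imp_deriv) (auto intro!: derivative_eq_intros cutoffD(4)[OF \<Psi>(1)] DERIV_chain2[OF cutoffD(4)[OF d]] simp: algebra_simps)
    have gk: "cutoff a b ?g" "cutoff c' c ?k"
      by (rule cutoff_mult[OF \<theta>(1) sm cutoffD(2)[OF d]], rule cutoff_mult[OF \<Psi> sm cutoffD(2)[OF d]])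
    have "0 \<le> (LINT z|lborel. \<bar>u z - v w\<bar> * (deriv ?g (fst z) * ?k (snd z))
            + kflux F (u z) (v w) * (?g (fst z) * deriv ?k (snd z)))"
      by (rule kruzhkov_lower[OF u kruzhkovD(2)[OF v] \<theta>(2) gk])
    also have "\<dots> = (LINT z|lborel. T1 (z, w))"
      by (intro Bochner_Integration.integral_cong) (auto simp: T1_def dg dk algebra_simps)
    finally show ?thesis .
  qed
  then have p1: "0 \<le> (LINT p|lborel. T1 p)"
    by (subst integral_lborel_prod(2)[OF i1]) (simp add: integral_nonneg_AE)
  \<comment> \<open>For first times in \<open>{a..b}\<close> the mollifier in the second time is
    supported in \<open>{fst z..fst z + \<epsilon>}\<close>, hence at positive times; for all other
    first times \<open>\<theta>\<close> vanishes.\<close>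
  have "0 \<le> (LINT w|lborel. T2 (z, w))" for z
  proof (cases "fst z \<in> {a..b}")
    case False
    then show ?thesis using ff(3)[of "fst z"] by (simp add: T2_def)
  next
    case True
    let ?g = "\<lambda>s. d (s - fst z)" and ?k = "\<lambda>y. d (y - snd z)"
    have cs: "cutoff s (s + \<epsilon>) (\<lambda>t. d (t - s))" for s
      using smooth_compose[OF cutoffD(1)[OF d] smooth_intros(4)[OF smooth_intros(7,1)], of s] cutoffD(2,3)[OF d]
      by (auto simp: cutoff_def)
    have dg: "deriv (\<lambda>t. d (t - s)) t = d' (t - s)" for s t
      using DERIV_imp_deriv[OF DERIV_chain2[OF cutoffD(4)[OF d] DERIV_diff[OF DERIV_ident DERIV_const], of s t]]
      by (simp add: d'_def)
    have "0 \<le> (LINT w|lborel. \<bar>v w - u z\<bar> * (deriv ?g (fst w) * ?k (snd w))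
            + kflux F (v w) (u z) * (?g (fst w) * deriv ?k (snd w)))"
      using True \<theta>(2) by (intro kruzhkov_lower[OF v kruzhkovD(2)[OF u] _ cs cs]) auto
    then have "0 \<le> (\<theta> (fst z) * \<Psi> (snd z)) * \<dots>"
      by (intro mult_nonneg_nonneg cutoffD(2)[OF \<theta>(1)] cutoffD(2)[OF \<Psi>])
    also have "\<dots> = (LINT w|lborel. (\<theta> (fst z) * \<Psi> (snd z)) * (\<bar>v w - u z\<bar> * (deriv ?g (fst w) * ?k (snd w))
            + kflux F (v w) (u z) * (?g (fst w) * deriv ?k (snd w))))"
      by simp
    also have "\<dots> = (LINT w|lborel. T2 (z, w))"
      by (intro Bochner_Integration.integral_cong)
        (auto simp: T2_def dg algebra_simps abs_minus_commute[of "v _"] kflux_commute[of F "v _"])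
    finally show ?thesis .
  qed
  then have p2: "0 \<le> (LINT p|lborel. T2 p)"
    by (subst integral_lborel_prod(1)[OF i2]) (simp add: integral_nonneg_AE)
  have "0 \<le> (LINT p|lborel. T1 p + T2 p)"
    using p1 p2 i1 i2 by simp
  also have "\<dots> = (LINT p|lborel. (?U p * (deriv \<theta> (fst (fst p)) * \<Psi> (snd (fst p)))
      + ?Q p * (\<theta> (fst (fst p)) * deriv \<Psi> (snd (fst p))))
      * (d (fst (snd p) - fst (fst p)) * d (snd (snd p) - snd (fst p))))"
    by (intro Bochner_Integration.integral_cong) (auto simp: T1_def T2_def algebra_simps)
  finally show ?thesis .
qed

section \<open>Mollification in time and space\<close>

definition mollifier_pair :: "(real \<Rightarrow> real) \<Rightarrow> (real \<times> real) \<times> (real \<times> real) \<Rightarrow> real" where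
  "mollifier_pair d p = d (fst (snd p) - fst (fst p)) * d (snd (snd p) - snd (fst p))"

lemma mollifierD:
  assumes "mollifier \<epsilon> d"
  shows "cutoff 0 \<epsilon> d" "(LINT s|lborel. d s) = 1" "0 \<le> mollifier_pair d p" "continuous_on UNIV (mollifier_pair d)"
    "mollifier_pair d p \<noteq> 0 \<Longrightarrow> fst (snd p) - fst (fst p) \<in> {0..\<epsilon>} \<and> snd (snd p) - snd (fst p) \<in> {0..\<epsilon>}"
proof -
  show d: "cutoff 0 \<epsilon> d" "(LINT s|lborel. d s) = 1" using assms by (auto simp: mollifier_def)
  show "0 \<le> mollifier_pair d p" using cutoffD(2)[OF d(1)] by (simp add: mollifier_pair_def)
  have ce: "continuous_on UNIV (\<lambda>x. d (l x))" if "continuous_on UNIV l"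
    for l :: "(real \<times> real) \<times> (real \<times> real) \<Rightarrow> real"
    using continuous_on_compose2[OF cutoffD(5)[OF d(1)] that] by simp
  show "continuous_on UNIV (mollifier_pair d)"
    unfolding mollifier_pair_def[abs_def] by (intro continuous_on_mult ce continuous_intros)
  show "fst (snd p) - fst (fst p) \<in> {0..\<epsilon>} \<and> snd (snd p) - snd (fst p) \<in> {0..\<epsilon>}" if "mollifier_pair d p \<noteq> 0"
    using that cutoffD(3)[OF d(1), of "fst (snd p) - fst (fst p)"] cutoffD(3)[OF d(1), of "snd (snd p) - snd (fst p)"]
    by (auto simp: mollifier_pair_def)
qed

lemma integral_mollifier_shift:
  assumes "mollifier \<epsilon> d"
  shows "(LINT s|lborel. d (s - t)) = 1" "(LINT s|lborel. d (t - s)) = 1"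
  using lborel_integral_real_affine[of 1 d "- t"] lborel_integral_real_affine[of "-1" d t] mollifierD(2)[OF assms]
  by (auto simp: algebra_simps)

lemma integral_mollifier_pair:
  assumes "mollifier \<epsilon> d"
  shows "(LINT w|lborel. mollifier_pair d (z, w)) = 1" "(LINT z|lborel. mollifier_pair d (z, w)) = 1"
proof -
  have c: "continuous_on UNIV (\<lambda>w. mollifier_pair d (z, w))" "continuous_on UNIV (\<lambda>z. mollifier_pair d (z, w))"
    by (rule continuous_on_compose2[OF mollifierD(4)[OF assms]], intro continuous_intros, simp)+
  have "integrable lborel (\<lambda>w. 1 * mollifier_pair d (z, w))"
  proof (rule integrable_bounded_times_continuous[where B=1, OF _ _ c(1)])
    show "compact ({fst z..fst z + \<epsilon>} \<times> {snd z..snd z + \<epsilon>})" by (intro compact_Times compact_Icc)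
    show "1 * mollifier_pair d (z, w) = 0" if "w \<notin> {fst z..fst z + \<epsilon>} \<times> {snd z..snd z + \<epsilon>}" for w
      using that mollifierD(5)[OF assms, of "(z, w)"] by (cases "mollifier_pair d (z, w) = 0"; cases w; auto)
  qed auto
  then have i: "integrable lborel (\<lambda>w. mollifier_pair d (z, w))" by simp
  show "(LINT w|lborel. mollifier_pair d (z, w)) = 1"
    by (subst integral_lborel_prod(1)[OF i]) (simp add: mollifier_pair_def integral_mollifier_shift[OF assms])
  have "integrable lborel (\<lambda>z. 1 * mollifier_pair d (z, w))"
  proof (rule integrable_bounded_times_continuous[where B=1, OF _ _ c(2)])
    show "compact ({fst w - \<epsilon>..fst w} \<times> {snd w - \<epsilon>..snd w})" by (intro compact_Times compact_Icc)
    show "1 * mollifier_pair d (z, w) = 0" if "z \<notin> {fst w - \<epsilon>..fst w} \<times> {snd w - \<epsilon>..snd w}" for z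
      using that mollifierD(5)[OF assms, of "(z, w)"] by (cases "mollifier_pair d (z, w) = 0"; cases z; auto)
  qed auto
  then have i: "integrable lborel (\<lambda>z. mollifier_pair d (z, w))" by simp
  show "(LINT z|lborel. mollifier_pair d (z, w)) = 1"
    by (subst integral_lborel_prod(1)[OF i]) (simp add: mollifier_pair_def integral_mollifier_shift[OF assms])
qed

text \<open>Measurability gives continuous functions converging to \<open>v\<close> almost
  everywhere. Truncating them to \<open>{0..R}\<close> does not move the limit and supplies the
  bound for dominated convergence on the compact set \<open>K\<close>.\<close>

lemma L1_approx_continuous:
  fixes v :: "real \<times> real \<Rightarrow> real"
  assumes v: "v \<in> borel_measurable borel" "\<And>z. v z \<in> {0..R}" and K: "compact K" and "e > 0"
  obtains g where "continuous_on UNIV g" "\<And>z. g z \<in> {0..R}"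
    "(LINT z|lborel. indicator K z * \<bar>v z - g z\<bar>) < e"
proof -
  have "v \<in> borel_measurable lebesgue" using v(1) by (simp add: measurable_completion)
  then have "v measurable_on UNIV" by (rule lebesgue_measurable_imp_measurable_on) simp
  then obtain N g where N: "negligible N" and g: "\<And>n. continuous_on UNIV (g n)"
    "\<And>x. x \<notin> N \<Longrightarrow> (\<lambda>n. g n x) \<longlonglongrightarrow> v x" for n :: nat
    unfolding measurable_on_def by auto
  have R: "0 \<le> R" using v(2)[of "(0,0)"] by auto
  define h where "h n z = max 0 (min R (g n z))" for n z
  have h: "continuous_on UNIV (h n)" "h n z \<in> {0..R}" for n z
    using g(1)[of n] R by (auto simp: h_def intro!: continuous_intros)
  have AEN: "AE x in lborel. x \<notin> N"
    using N AE_not_in[of N lebesgue] by (simp add: negligible_iff_null_sets AE_completion_iff)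
  have mh[measurable]: "h n \<in> borel_measurable borel" for n
    by (rule borel_measurable_continuous_onI[OF h(1)])
  have Km[measurable]: "K \<in> sets borel" using K by (simp add: borel_compact)
  have "(\<lambda>n. LINT z|lborel. indicator K z * \<bar>v z - h n z\<bar>) \<longlonglongrightarrow> (LINT z|(lborel :: (real \<times> real) measure). 0)"
  proof (rule integral_dominated_convergence)
    show "integrable lborel (\<lambda>z. indicator K z * R)"
      using borel_integrable_compact[OF K, of "\<lambda>z. R"] by simp
    show "AE x in lborel. (\<lambda>n. indicator K x * \<bar>v x - h n x\<bar>) \<longlonglongrightarrow> 0"
      using AEN
    proof eventually_elim
      case (elim x)
      have "(\<lambda>n. h n x) \<longlonglongrightarrow> max 0 (min R (v x))"
        unfolding h_def by (intro tendsto_intros g(2) elim)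
      then have "(\<lambda>n. h n x) \<longlonglongrightarrow> v x" using v(2)[of x] by simp
      then have "(\<lambda>n. indicator K x * \<bar>v x - h n x\<bar>) \<longlonglongrightarrow> indicator K x * \<bar>v x - v x\<bar>"
        by (intro tendsto_intros)
      then show ?case by simp
    qed
    show "AE x in lborel. norm (indicator K x * \<bar>v x - h n x\<bar>) \<le> indicator K x * R" for n
    proof (rule AE_I2)
      fix x
      have "\<bar>v x - h n x\<bar> \<le> R" using v(2)[of x] h(2)[of n x] by auto
      then show "norm (indicator K x * \<bar>v x - h n x\<bar>) \<le> indicator K x * R"
        by (simp add: indicator_def)
    qed
  qed (use v(1) in measurable)
  then have "(\<lambda>n. LINT z|lborel. indicator K z * \<bar>v z - h n z\<bar>) \<longlonglongrightarrow> 0" by simp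
  then have "\<forall>\<^sub>F n in sequentially. (LINT z|lborel. indicator K z * \<bar>v z - h n z\<bar>) < e"
    by (rule order_tendstoD(2)) (rule assms(4))
  then obtain n where "(LINT z|lborel. indicator K z * \<bar>v z - h n z\<bar>) < e"
    by (auto simp: eventually_sequentially)
  then show thesis using that[of "h n"] h by blast
qed

text \<open>This is continuity of translations in L1, in the averaged form that the doubling needs.
  A uniformly continuous \<open>g\<close> replaces \<open>v\<close> at both points, and since the
  mollifier integrates to \<open>1\<close> in either of its points, each replacement costs only an
  L1 distance.\<close>

lemma mollify_error:
  fixes v :: "real \<times> real \<Rightarrow> real"
  assumes v: "v \<in> borel_measurable borel" "\<And>z. v z \<in> {0..R}"
    and A: "continuous_on UNIV A" "\<And>t. 0 \<le> A t" "\<And>t. t \<notin> {a..b} \<Longrightarrow> A t = 0"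
    and C: "continuous_on UNIV C" "\<And>t. 0 \<le> C t" "\<And>t. t \<notin> {c'..c} \<Longrightarrow> C t = (0::real)"
    and "e > 0"
  obtains \<epsilon>0 where "\<epsilon>0 > 0" "\<And>\<epsilon> d. 0 < \<epsilon> \<Longrightarrow> \<epsilon> < \<epsilon>0 \<Longrightarrow> mollifier \<epsilon> d \<Longrightarrow>
    (LINT p|lborel. \<bar>v (snd p) - v (fst p)\<bar> * (A (fst (fst p)) * C (snd (fst p)) * mollifier_pair d p)) \<le> e"
proof -
  have R: "0 \<le> R" using v(2)[of "(0,0)"] by auto
  have "bounded (A ` {a..b})" "bounded (C ` {c'..c})"
    using A(1) C(1) by (auto intro!: compact_imp_bounded compact_continuous_image[OF _ compact_Icc] intro: continuous_on_subset)
  then obtain M N where M: "\<forall>x\<in>{a..b}. \<bar>A x\<bar> \<le> M" and N: "\<forall>x\<in>{c'..c}. \<bar>C x\<bar> \<le> N"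
    unfolding bounded_iff by (metis image_eqI real_norm_def)
  define B where "B = max 1 M * max 1 N"
  have B: "B > 0" "A t * C x \<le> B" for t x
  proof -
    show "B > 0" by (auto simp: B_def intro!: mult_pos_pos)
    have "A t \<le> max 1 M" "C x \<le> max 1 N"
      using bspec[OF M, of t] A(3)[of t] bspec[OF N, of x] C(3)[of x]
      by (cases "t \<in> {a..b}", auto simp: max_def)[1] (use bspec[OF N, of x] C(3)[of x] in \<open>cases "x \<in> {c'..c}", auto simp: max_def\<close>)
    then show "A t * C x \<le> B"
      unfolding B_def by (intro mult_mono) (auto simp: C(2))
  qed
  define J where "J = (LINT z|lborel. A (fst z) * C (snd z))"
  have J: "0 \<le> J" unfolding J_def using A(2) C(2) by (intro integral_nonneg_AE) auto
  \<comment> \<open>The two replacements of \<open>v\<close> by \<open>g\<close> cost at most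
    \<open>B * e1 = e / 4\<close> each, and the oscillation of \<open>g\<close> costs
    \<open>e2 * J \<le> e / 2\<close>; the \<open>1\<close> in \<open>J + 1\<close> guards against
    \<open>J = 0\<close>.\<close>
  define e1 where "e1 = e / (4 * B)"
  define e2 where "e2 = e / (2 * (J + 1))"
  have e12: "e1 > 0" "e2 > 0" using \<open>e > 0\<close> B(1) J by (auto simp: e1_def e2_def)
  have e12': "B * e1 + e2 * J + B * e1 \<le> e"
  proof -
    have "e2 * J \<le> e / 2" using J \<open>e > 0\<close> by (simp add: e2_def field_simps)
    moreover have "B * e1 = e / 4" using B(1) by (simp add: e1_def)
    ultimately show ?thesis by simp
  qed
  \<comment> \<open>The unit margin takes in the second point as long as
    \<open>\<epsilon> < 1\<close>.\<close>
  define K where "K = {a..b+1} \<times> {c'..c+1}"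
  have K: "compact K" unfolding K_def by (intro compact_Times compact_Icc)
  obtain g where g: "continuous_on UNIV g" "\<And>z. g z \<in> {0..R}"
    "(LINT z|lborel. indicator K z * \<bar>v z - g z\<bar>) < e1"
    using L1_approx_continuous[OF v K e12(1)] by blast
  have "uniformly_continuous_on K g"
    by (intro compact_uniformly_continuous K continuous_on_subset[OF g(1)]) auto
  then obtain \<delta> where \<delta>: "\<delta> > 0" "\<And>z w. z \<in> K \<Longrightarrow> w \<in> K \<Longrightarrow> dist w z < \<delta> \<Longrightarrow> dist (g w) (g z) < e2"
    using e12(2) unfolding uniformly_continuous_on_def by meson
  define f where "f z = indicator K z * \<bar>v z - g z\<bar>" for z
  have gm[measurable]: "g \<in> borel_measurable borel" by (rule borel_measurable_continuous_onI[OF g(1)])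
  have Km[measurable]: "K \<in> sets borel" using K by (simp add: borel_compact)
  have f: "f \<in> borel_measurable borel" "\<bar>f z\<bar> \<le> R" "0 \<le> f z" for z
  proof -
    show "f \<in> borel_measurable borel" unfolding f_def using v(1) by measurable
    have "\<bar>v z - g z\<bar> \<le> R" using v(2)[of z] g(2)[of z] by auto
    then show "\<bar>f z\<bar> \<le> R" "0 \<le> f z" using R by (auto simp: f_def indicator_def)
  qed
  show thesis
  \<comment> \<open>Both coordinates of the two points differ by at most \<open>\<epsilon>\<close>,
    so their distance is at most \<open>2 * \<epsilon> < \<delta>\<close>.\<close>
  proof (rule that[of "min 1 (\<delta> / 2)"])
    show "min 1 (\<delta> / 2) > 0" using \<delta>(1) by simp
    fix \<epsilon> d assume \<epsilon>: "0 < \<epsilon>" "\<epsilon> < min 1 (\<delta> / 2)" and d: "mollifier \<epsilon> d"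
    let ?k = "\<lambda>p. A (fst (fst p)) * C (snd (fst p)) * mollifier_pair d p"
    have ik: "integrable lborel (\<lambda>p. m p * ?k p)" if "m \<in> borel_measurable borel" "\<And>p. \<bar>m p\<bar> \<le> R + 1" for m
      unfolding mollifier_pair_def
      by (rule mollifier_integrable[OF that A(1) C(1) _ _ A(3) C(3), where \<epsilon>=\<epsilon>])
        (use cutoffD[OF mollifierD(1)[OF d]] in auto)
    have fst_m: "(\<lambda>p. h (fst p)) \<in> borel_measurable borel" if "h \<in> borel_measurable borel" for h :: "real \<times> real \<Rightarrow> real"
      using measurable_compose[OF borel_measurable_continuous_onI[OF continuous_on_fst[OF continuous_on_id]] that] by simp
    have snd_m: "(\<lambda>p. h (snd p)) \<in> borel_measurable borel" if "h \<in> borel_measurable borel" for h :: "real \<times> real \<Rightarrow> real"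
      using measurable_compose[OF borel_measurable_continuous_onI[OF continuous_on_snd[OF continuous_on_id]] that] by simp
    let ?S = "{a-1..b+2} \<times> {c'-1..c+2} :: (real \<times> real) set"
    have S: "compact (?S \<times> ?S)" by (intro compact_Times compact_Icc)
    have KS: "p \<in> ?S \<times> ?S" if "mollifier_pair d p \<noteq> 0" "fst p \<in> K \<or> snd p \<in> K" for p
      using mollifierD(5)[OF d that(1)] that(2) \<epsilon> unfolding K_def by (cases p) force
    have i1: "integrable lborel (\<lambda>p. f (snd p) * mollifier_pair d p)"
      by (rule integrable_bounded_times_continuous[OF snd_m[OF f(1)] f(2) mollifierD(4)[OF d] S])
        (use KS in \<open>auto simp: f_def indicator_def split: if_splits\<close>)
    have i3: "integrable lborel (\<lambda>p. f (fst p) * mollifier_pair d p)"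
      by (rule integrable_bounded_times_continuous[OF fst_m[OF f(1)] f(2) mollifierD(4)[OF d] S])
        (use KS in \<open>auto simp: f_def indicator_def split: if_splits\<close>)
    have i2: "integrable lborel ?k" using ik[of "\<lambda>_. 1"] R by simp
    have v0: "\<bar>v (snd p) - v (fst p)\<bar> \<le> R + 1" for p
      using v(2)[of "snd p"] v(2)[of "fst p"] by auto
    have i0: "integrable lborel (\<lambda>p. \<bar>v (snd p) - v (fst p)\<bar> * ?k p)"
      by (rule ik) (use v0 in \<open>auto intro!: borel_measurable_abs borel_measurable_diff fst_m snd_m v(1)\<close>)
    have pw: "\<bar>v (snd p) - v (fst p)\<bar> * ?k p \<le> B * (f (snd p) * mollifier_pair d p) + e2 * ?k p + B * (f (fst p) * mollifier_pair d p)" for p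
    proof (cases "?k p = 0")
      case True
      have "0 \<le> B * (f (snd p) * mollifier_pair d p)" "0 \<le> B * (f (fst p) * mollifier_pair d p)"
        using f(3) mollifierD(3)[OF d] B(1) by (auto intro!: mult_nonneg_nonneg simp del: split_paired_All)
      then show ?thesis unfolding True by simp
    next
      case False
      then have nz: "mollifier_pair d p \<noteq> 0" "A (fst (fst p)) \<noteq> 0" "C (snd (fst p)) \<noteq> 0" by auto
      then have z: "fst (fst p) \<in> {a..b}" "snd (fst p) \<in> {c'..c}" using A(3) C(3) by blast+
      note kd = mollifierD(5)[OF d nz(1)]
      have zK: "fst p \<in> K" "snd p \<in> K"
        using z kd \<epsilon> unfolding K_def by (cases p; force)+
      have "dist (snd p) (fst p) \<le> dist (fst (snd p)) (fst (fst p)) + dist (snd (snd p)) (snd (fst p))"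
        unfolding dist_prod_def by (rule sqrt_sum_squares_le_sum) auto
      also have "\<dots> < \<delta>" using kd \<epsilon> by (auto simp: dist_real_def)
      finally have "\<bar>g (snd p) - g (fst p)\<bar> \<le> e2" using \<delta>(2)[OF zK] by (simp add: dist_real_def)
      then have "\<bar>v (snd p) - v (fst p)\<bar> \<le> f (snd p) + e2 + f (fst p)"
        using zK by (simp add: f_def)
      then have "\<bar>v (snd p) - v (fst p)\<bar> * ?k p \<le> (f (snd p) + e2 + f (fst p)) * ?k p"
        using A(2) C(2) mollifierD(3)[OF d] by (intro mult_right_mono) auto
      also have "\<dots> = f (snd p) * ?k p + e2 * ?k p + f (fst p) * ?k p" by (simp add: algebra_simps)
      also have "\<dots> \<le> f (snd p) * (B * mollifier_pair d p) + e2 * ?k p + f (fst p) * (B * mollifier_pair d p)"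
        by (intro add_mono mult_left_mono mult_right_mono order_refl B(2) f(3) mollifierD(3)[OF d])
      finally show ?thesis by (simp add: algebra_simps)
    qed
    have "(LINT p|lborel. \<bar>v (snd p) - v (fst p)\<bar> * ?k p)
      \<le> (LINT p|lborel. B * (f (snd p) * mollifier_pair d p) + e2 * ?k p + B * (f (fst p) * mollifier_pair d p))"
      using pw i0 i1 i2 i3 by (intro integral_mono Bochner_Integration.integrable_add integrable_mult_right)
    also have "\<dots> = B * (LINT p|lborel. f (snd p) * mollifier_pair d p) + e2 * (LINT p|lborel. ?k p) + B * (LINT p|lborel. f (fst p) * mollifier_pair d p)"
      using i1 i2 i3 by simp
    also have "(LINT p|lborel. f (snd p) * mollifier_pair d p) = (LINT z|lborel. f z)"
      by (subst integral_lborel_prod(2)[OF i1]) (simp add: integral_mollifier_pair[OF d])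
    also have "(LINT p|lborel. f (fst p) * mollifier_pair d p) = (LINT z|lborel. f z)"
      by (subst integral_lborel_prod(1)[OF i3]) (simp add: integral_mollifier_pair[OF d])
    also have "(LINT p|lborel. ?k p) = J"
      by (subst integral_lborel_prod(1)[OF i2]) (simp add: integral_mollifier_pair[OF d] J_def)
    also have "B * (LINT z|lborel. f z) + e2 * J + B * (LINT z|lborel. f z) \<le> B * e1 + e2 * J + B * e1"
      using g(3) B(1) by (intro add_mono mult_left_mono order_refl) (auto simp: f_def)
    also have "\<dots> \<le> e" by (rule e12')
    finally show "(LINT p|lborel. \<bar>v (snd p) - v (fst p)\<bar> * ?k p) \<le> e" .
  qed
qed

subsection \<open>Contraction in \<open>L\<^sup>1\<close>\<close>

lemma fst_measurable: "h \<in> borel_measurable borel \<Longrightarrow> (\<lambda>p::'a::euclidean_space \<times> 'b::euclidean_space. h (fst p)) \<in> borel_measurable borel"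
  by (rule measurable_compose[OF borel_measurable_continuous_onI[OF continuous_on_fst[OF continuous_on_id]]])

lemma snd_measurable: "h \<in> borel_measurable borel \<Longrightarrow> (\<lambda>p::'a::euclidean_space \<times> 'b::euclidean_space. h (snd p)) \<in> borel_measurable borel"
  by (rule measurable_compose[OF borel_measurable_continuous_onI[OF continuous_on_snd[OF continuous_on_id]]])

lemma integrable_tensor:
  fixes m :: "real \<times> real \<Rightarrow> real"
  assumes m: "m \<in> borel_measurable borel" "\<And>p. \<bar>m p\<bar> \<le> B"
    and A: "continuous_on UNIV A" "\<And>t. t \<notin> {a..b} \<Longrightarrow> A t = 0"
    and C: "continuous_on UNIV C" "\<And>x. x \<notin> {c'..c} \<Longrightarrow> C x = (0::real)"
  shows "integrable lborel (\<lambda>z. m z * (A (fst z) * C (snd z)))"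
proof (rule integrable_bounded_times_continuous[OF m])
  have ce: "continuous_on UNIV (\<lambda>z. h (l z))" if "continuous_on UNIV h" "continuous_on UNIV l"
    for h :: "real \<Rightarrow> real" and l :: "real \<times> real \<Rightarrow> real"
    using continuous_on_compose2[OF that(1,2)] by simp
  show "continuous_on UNIV (\<lambda>z. A (fst z) * C (snd z))"
    by (intro continuous_on_mult ce[OF A(1)] ce[OF C(1)] continuous_intros)
  show "compact ({a..b} \<times> {c'..c})" by (intro compact_Times compact_Icc)
  show "m p * (A (fst p) * C (snd p)) = 0" if "p \<notin> {a..b} \<times> {c'..c}" for p
    using that A(2)[of "fst p"] C(2)[of "snd p"] by (cases p) auto
qed

lemma mult_le_of_abs_le:
  fixes X :: real
  assumes "\<bar>X\<bar> \<le> Z" "\<bar>Y\<bar> \<le> W"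
  shows "X * Y \<le> Z * W"
proof -
  have "\<bar>X\<bar> * \<bar>Y\<bar> \<le> Z * W" using assms by (intro mult_mono) auto
  then show ?thesis using abs_ge_self[of "X * Y"] unfolding abs_mult by linarith
qed

text \<open>Shrinking the mollifier in the doubled inequality merges the two points. Replacing
  \<open>v\<close> at the second point by \<open>v\<close> at the first changes the entropy by at
  most \<open>\<bar>v (snd p) - v (fst p)\<bar>\<close> and the flux by an affine function of this
  difference; the mollification error controls both.\<close>

lemma kruzhkov_kato:
  assumes u: "kruzhkov R F u" and v: "kruzhkov R F v" and F: "continuous_on UNIV F"
    and \<theta>: "cutoff a b \<theta>" "0 < a" and \<Psi>: "cutoff c' c \<Psi>"
  shows "0 \<le> (LINT z|lborel. \<bar>u z - v z\<bar> * (deriv \<theta> (fst z) * \<Psi> (snd z))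
      + kflux F (u z) (v z) * (\<theta> (fst z) * deriv \<Psi> (snd z)))" (is "0 \<le> ?I")
proof (rule field_le_epsilon)
  fix e :: real assume e: "e > 0"
  note um = kruzhkovD(1)[OF u] and ur = kruzhkovD(2)[OF u] and vm = kruzhkovD(1)[OF v] and vr = kruzhkovD(2)[OF v]
  note Ff = cutoffD[OF \<theta>(1)] cutoffD[OF \<Psi>] cutoff_deriv_0[OF \<theta>(1)] cutoff_deriv_0[OF \<Psi>]
  have cab: "continuous_on UNIV (\<lambda>t. \<bar>h t\<bar>)" if "continuous_on UNIV h" for h :: "real \<Rightarrow> real"
    by (intro continuous_on_rabs that)
  let ?a = "\<lambda>z. \<bar>deriv \<theta> (fst z)\<bar> * \<Psi> (snd z)" and ?b = "\<lambda>z. \<theta> (fst z) * \<bar>deriv \<Psi> (snd z)\<bar>"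
  define J where "J = (LINT z|lborel. ?b z)"
  have J: "J \<ge> 0" unfolding J_def by (intro integral_nonneg_AE) (auto intro!: Ff mult_nonneg_nonneg)
  \<comment> \<open>The order of the choices matters: \<open>e1\<close> pays for the constant part
    of the modulus, integrated against a weight of mass \<open>J\<close>. It determines
    \<open>C\<close>, on which \<open>e2\<close>, and through it the width of the mollifier,
    depend.\<close>
  define e1 where "e1 = e / (4 * (J + 1))"
  have e1: "e1 > 0" using e J by (simp add: e1_def)
  obtain C where C: "C \<ge> 0" "\<And>a b. a \<in> {0..R} \<Longrightarrow> b \<in> {0..R} \<Longrightarrow> \<bar>F a - F b\<bar> \<le> e1 + C * \<bar>a - b\<bar>"
    using continuous_modulus[OF continuous_on_subset[OF F subset_UNIV] e1] by blast
  define e2 where "e2 = e / (2 * (1 + 2 * C))"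
  have e2: "e2 > 0" using e C(1) by (simp add: e2_def)
  obtain \<epsilon>1 where \<epsilon>1: "\<epsilon>1 > 0" "\<And>\<epsilon> d. 0 < \<epsilon> \<Longrightarrow> \<epsilon> < \<epsilon>1 \<Longrightarrow> mollifier \<epsilon> d \<Longrightarrow>
    (LINT p|lborel. \<bar>v (snd p) - v (fst p)\<bar> * (?a (fst p) * mollifier_pair d p)) \<le> e2"
    by (rule mollify_error[OF vm vr cab[OF Ff(6)] _ _ Ff(13) Ff(10) Ff(11) e2, where a=a and b=b]) (use Ff in auto)
  obtain \<epsilon>2 where \<epsilon>2: "\<epsilon>2 > 0" "\<And>\<epsilon> d. 0 < \<epsilon> \<Longrightarrow> \<epsilon> < \<epsilon>2 \<Longrightarrow> mollifier \<epsilon> d \<Longrightarrow>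
    (LINT p|lborel. \<bar>v (snd p) - v (fst p)\<bar> * (?b (fst p) * mollifier_pair d p)) \<le> e2"
    by (rule mollify_error[OF vm vr Ff(5) Ff(2) Ff(3) cab[OF Ff(14)] _ _ e2, where c'=c' and c=c]) (use Ff in auto)
  define \<epsilon> where "\<epsilon> = min \<epsilon>1 \<epsilon>2 / 2"
  have \<epsilon>: "0 < \<epsilon>" "\<epsilon> < \<epsilon>1" "\<epsilon> < \<epsilon>2" using \<epsilon>1(1) \<epsilon>2(1) by (auto simp: \<epsilon>_def)
  define d where "d s = smooth_bump (s / \<epsilon>) / \<epsilon>" for s
  have d: "mollifier \<epsilon> d" unfolding d_def[abs_def] by (rule mollifier_bump[OF \<epsilon>(1)])
  note dc = cutoffD[OF mollifierD(1)[OF d]]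
  obtain B where B: "B \<ge> 0" "\<And>a b. a \<in> {0..R} \<Longrightarrow> b \<in> {0..R} \<Longrightarrow> \<bar>a - b\<bar> \<le> B \<and> \<bar>kflux F a b\<bar> \<le> B"
    using flux_bounded[OF F] by blast
  have ki: "integrable lborel (\<lambda>p. m p * (A (fst (fst p)) * D (snd (fst p)) * mollifier_pair d p))"
    if "m \<in> borel_measurable borel" "\<And>p. \<bar>m p\<bar> \<le> B + 1" "continuous_on UNIV A" "continuous_on UNIV D"
      "\<And>t. t \<notin> {a..b} \<Longrightarrow> A t = 0" "\<And>x. x \<notin> {c'..c} \<Longrightarrow> D x = 0" for m A D
    unfolding mollifier_pair_def by (rule mollifier_integrable[OF that(1-4) dc(5) dc(5) that(5,6) dc(3) dc(3)])
  have \<theta>': "continuous_on UNIV (\<lambda>t. \<bar>deriv \<theta> t\<bar>)" "\<And>t. t \<notin> {a..b} \<Longrightarrow> \<bar>deriv \<theta> t\<bar> = 0"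
    using Ff by (auto intro: cab)
  have \<Psi>': "continuous_on UNIV (\<lambda>t. \<bar>deriv \<Psi> t\<bar>)" "\<And>t. t \<notin> {c'..c} \<Longrightarrow> \<bar>deriv \<Psi> t\<bar> = 0"
    using Ff by (auto intro: cab)
  have bb: "\<bar>\<bar>u z - v w\<bar>\<bar> \<le> B + 1" "\<bar>kflux F (u z) (v w)\<bar> \<le> B + 1" "\<bar>\<bar>v z - v w\<bar>\<bar> \<le> B + 1" for z w
    using B(2)[OF ur[of z] vr[of w]] B(2)[OF vr[of z] vr[of w]] by auto
  let ?U = "\<lambda>p. \<bar>u (fst p) - v (snd p)\<bar>" and ?Q = "\<lambda>p. kflux F (u (fst p)) (v (snd p))"
  let ?Ud = "\<lambda>p :: (real \<times> real) \<times> (real \<times> real). \<bar>u (fst p) - v (fst p)\<bar>" and ?Qd = "\<lambda>p :: (real \<times> real) \<times> (real \<times> real). kflux F (u (fst p)) (v (fst p))"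
  let ?V = "\<lambda>p. \<bar>v (snd p) - v (fst p)\<bar>"
  have mU: "?U \<in> borel_measurable borel" and mUd: "?Ud \<in> borel_measurable borel" and mV: "?V \<in> borel_measurable borel"
    by (rule borel_measurable_abs[OF borel_measurable_diff[OF fst_measurable[OF um] snd_measurable[OF vm]]],
      rule borel_measurable_abs[OF borel_measurable_diff[OF fst_measurable[OF um] fst_measurable[OF vm]]],
      rule borel_measurable_abs[OF borel_measurable_diff[OF snd_measurable[OF vm] fst_measurable[OF vm]]])
  have mQ: "?Q \<in> borel_measurable borel" and mQd: "?Qd \<in> borel_measurable borel"
    by (rule kflux_measurable[OF F fst_measurable[OF um] snd_measurable[OF vm]],
      rule kflux_measurable[OF F fst_measurable[OF um] fst_measurable[OF vm]])
  let ?da = "\<lambda>p. deriv \<theta> (fst (fst p)) * \<Psi> (snd (fst p)) * mollifier_pair d p"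
  let ?db = "\<lambda>p. \<theta> (fst (fst p)) * deriv \<Psi> (snd (fst p)) * mollifier_pair d p"
  let ?ka = "\<lambda>p. \<bar>deriv \<theta> (fst (fst p))\<bar> * \<Psi> (snd (fst p)) * mollifier_pair d p"
  let ?kb = "\<lambda>p. \<theta> (fst (fst p)) * \<bar>deriv \<Psi> (snd (fst p))\<bar> * mollifier_pair d p"
  have i1a: "integrable lborel (\<lambda>p. ?U p * ?da p)"
    by (rule ki[OF mU bb(1) Ff(6,13,17,11)])
  have i1b: "integrable lborel (\<lambda>p. ?Q p * ?db p)"
    by (rule ki[OF mQ bb(2) Ff(5,14,3,18)])
  have i1c: "integrable lborel (\<lambda>p. ?Ud p * ?da p)"
    by (rule ki[OF mUd bb(1) Ff(6,13,17,11)])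
  have i1d: "integrable lborel (\<lambda>p. ?Qd p * ?db p)"
    by (rule ki[OF mQd bb(2) Ff(5,14,3,18)])
  note i1 = i1a i1b i1c i1d
  have i2a: "integrable lborel (\<lambda>p. ?V p * ?ka p)"
    by (rule ki[OF mV bb(3) \<theta>'(1) Ff(13) \<theta>'(2) Ff(11)])
  have i2b: "integrable lborel (\<lambda>p. ?V p * ?kb p)"
    by (rule ki[OF mV bb(3) Ff(5) \<Psi>'(1) Ff(3) \<Psi>'(2)])
  have i2c: "integrable lborel (\<lambda>p. 1 * ?kb p)"
    by (rule ki[OF _ _ Ff(5) \<Psi>'(1) Ff(3) \<Psi>'(2)]) (use B(1) in auto)
  note i2 = i2a i2b i2c
  have pw: "?U p * ?da p + ?Q p * ?db p \<le> (?Ud p * ?da p + ?Qd p * ?db p) + (?V p * ?ka p + 2 * e1 * (1 * ?kb p) + 2 * C * (?V p * ?kb p))" for p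
  proof -
    have k: "0 \<le> mollifier_pair d p" by (rule mollifierD(3)[OF d])
    have "(?U p - ?Ud p) * ?da p \<le> ?V p * ?ka p"
      using k Ff(10)[of "snd (fst p)"] by (intro mult_le_of_abs_le) (linarith, simp add: abs_mult)
    moreover have "(?Q p - ?Qd p) * ?db p \<le> (2 * e1 + 2 * C * ?V p) * ?kb p"
      using k Ff(2)[of "fst (fst p)"] by (intro mult_le_of_abs_le kflux_modulus[OF C(2,1) ur vr vr]) (simp_all add: abs_mult)
    ultimately show ?thesis by (simp add: algebra_simps)
  qed
  have "0 \<le> (LINT p|lborel. ?U p * ?da p + ?Q p * ?db p)"
    using kruzhkov_doubled[OF u v F \<theta> \<Psi> mollifierD(1)[OF d]] unfolding mollifier_pair_def by (simp add: algebra_simps)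
  also have "\<dots> \<le> (LINT p|lborel. (?Ud p * ?da p + ?Qd p * ?db p) + (?V p * ?ka p + 2 * e1 * (1 * ?kb p) + 2 * C * (?V p * ?kb p)))"
    by (intro integral_mono pw Bochner_Integration.integrable_add i1 i2a integrable_mult_right[OF i2c] integrable_mult_right[OF i2b])
  also have "\<dots> = (LINT p|lborel. ?Ud p * ?da p + ?Qd p * ?db p) +
     ((LINT p|lborel. ?V p * ?ka p) + 2 * e1 * (LINT p|lborel. 1 * ?kb p) + 2 * C * (LINT p|lborel. ?V p * ?kb p))"
    using i1 i2 by simp
  also have "(LINT p|lborel. 1 * ?kb p) = J"
    by (subst integral_lborel_prod(1)[OF i2(3)]) (simp add: integral_mollifier_pair[OF d] J_def)
  \<comment> \<open>After the replacement the second point occurs in the mollifier only, which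
    integrates to \<open>1\<close>.\<close>
  also have "(LINT p|lborel. ?Ud p * ?da p + ?Qd p * ?db p) = ?I"
  proof (subst integral_lborel_prod(1)[OF Bochner_Integration.integrable_add[OF i1(3,4)]], rule Bochner_Integration.integral_cong[OF refl])
    fix z
    have "(LINT w|lborel. ?Ud (z, w) * ?da (z, w) + ?Qd (z, w) * ?db (z, w)) =
      (LINT w|lborel. (\<bar>u z - v z\<bar> * (deriv \<theta> (fst z) * \<Psi> (snd z))
      + kflux F (u z) (v z) * (\<theta> (fst z) * deriv \<Psi> (snd z))) * mollifier_pair d (z, w))"
      by (simp add: algebra_simps)
    then show "(LINT w|lborel. ?Ud (z, w) * ?da (z, w) + ?Qd (z, w) * ?db (z, w)) =
      \<bar>u z - v z\<bar> * (deriv \<theta> (fst z) * \<Psi> (snd z)) + kflux F (u z) (v z) * (\<theta> (fst z) * deriv \<Psi> (snd z))"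
      by (simp add: integral_mollifier_pair[OF d])
  qed
  also have "(LINT p|lborel. ?V p * ?ka p) + 2 * e1 * J + 2 * C * (LINT p|lborel. ?V p * ?kb p) \<le> e2 + 2 * e1 * J + 2 * C * e2"
    using \<epsilon>1(2)[OF \<epsilon>(1,2) d] \<epsilon>2(2)[OF \<epsilon>(1,3) d] C(1) by (intro add_mono mult_left_mono order_refl) auto
  also have "e2 + 2 * e1 * J + 2 * C * e2 \<le> e"
  proof -
    have "e2 + 2 * C * e2 = (1 + 2 * C) * e2" by (simp add: algebra_simps)
    also have "\<dots> = e / 2" using C(1) unfolding e2_def by (simp add: field_simps)
    finally have "e2 + 2 * C * e2 = e / 2" .
    moreover have "2 * e1 * J \<le> e / 2" using e J unfolding e1_def by (simp add: field_simps)
    ultimately show ?thesis by linarith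
  qed
  finally show "0 \<le> ?I + e" by simp
qed

section \<open>Removal of the spatial cutoff\<close>

lemma strip_integrable:
  fixes w :: "real \<times> real \<Rightarrow> real"
  assumes \<theta>: "cutoff a b \<theta>" "0 < a" and w: "w \<in> borel_measurable borel"
    and int: "integrable lborel (\<lambda>z. indicator ({0..b} \<times> UNIV) z * w z)"
  shows "integrable lborel (\<lambda>z. w z * deriv \<theta> (fst z))"
proof -
  obtain B where B: "B > 0" "\<And>x. \<bar>deriv \<theta> x\<bar> \<le> B" using cutoff_bounded[OF \<theta>(1)] by metis
  show ?thesis
  proof (rule Bochner_Integration.integrable_bound[OF integrable_mult_right[OF int, of B]])
    show "(\<lambda>z. w z * deriv \<theta> (fst z)) \<in> borel_measurable lborel"
      using w fst_measurable[OF cutoffD(8)[OF \<theta>(1)]] by measurable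
    have "norm (w z * deriv \<theta> (fst z)) \<le> norm (B * (indicator ({0..b} \<times> UNIV) z * w z))" for z
    proof (cases "fst z \<in> {a..b}")
      case True
      then have "z \<in> {0..b} \<times> UNIV" using \<theta>(2) by (cases z) auto
      then show ?thesis using mult_left_mono[OF B(2)[of "fst z"], of "\<bar>w z\<bar>"] B(1)
        by (simp add: abs_mult mult.commute)
    qed (simp add: cutoff_deriv_0[OF \<theta>(1)])
    then show "AE z in lborel. norm (w z * deriv \<theta> (fst z)) \<le> norm (B * (indicator ({0..b} \<times> UNIV) z * w z))" by simp
  qed
qed

text \<open>The linear part of the modulus meets the integrable function
  \<open>\<bar>u z - v z\<bar>\<close> and, with a cutoff of slope of order \<open>1 / N n\<close>,
  tends to zero. The constant part meets the growing support of the cutoff, so it stays a bounded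
  multiple of \<open>e\<close> and is made small by choosing \<open>e\<close> beforehand.\<close>

lemma kruzhkov_time_monotone:
  assumes u: "kruzhkov R F u" and v: "kruzhkov R F v" and F: "continuous_on UNIV F"
    and \<theta>: "cutoff a b \<theta>" "0 < a" "a \<le> b"
    and int: "integrable lborel (\<lambda>z. indicator ({0..b} \<times> UNIV) z * \<bar>u z - v z\<bar>)"
  shows "0 \<le> (LINT z|lborel. \<bar>u z - v z\<bar> * deriv \<theta> (fst z))" (is "0 \<le> ?I")
proof (rule field_le_epsilon)
  fix e0 :: real assume e0: "e0 > 0"
  let ?X = "\<lambda>z. \<bar>u z - v z\<bar>"
  note um = kruzhkovD(1)[OF u] and ur = kruzhkovD(2)[OF u] and vm = kruzhkovD(1)[OF v] and vr = kruzhkovD(2)[OF v]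
  note Ff = cutoffD[OF \<theta>(1)]
  obtain M where M: "M > 0" "\<And>x. smooth_bump x \<le> M" using smooth_bump_bounded by blast
  obtain B where B: "B > 0" "\<And>x. \<theta> x \<le> B" using cutoff_bounded[OF \<theta>(1)] by metis
  \<comment> \<open>The factor \<open>8\<close> is the \<open>2\<close> of the slope bound
    \<open>2 * M / N n\<close> times the \<open>4\<close> of the length \<open>4 * N n\<close> of
    the support of the cutoff.\<close>
  define e where "e = e0 / (8 * B * M * (b - a) + 1)"
  have ee: "e > 0" "8 * e * B * M * (b - a) \<le> e0"
  proof -
    have p: "0 \<le> 8 * B * M * (b - a)" using B(1) M(1) \<theta>(3) by simp
    then show "e > 0" using e0 by (simp add: e_def)
    have "e * (8 * B * M * (b - a)) \<le> e * (8 * B * M * (b - a) + 1)"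
      using \<open>e > 0\<close> by (intro mult_left_mono) auto
    also have "\<dots> = e0" using p unfolding e_def by simp
    finally show "8 * e * B * M * (b - a) \<le> e0" by (simp add: algebra_simps)
  qed
  obtain C where C: "C \<ge> 0" "\<And>a b. a \<in> {0..R} \<Longrightarrow> b \<in> {0..R} \<Longrightarrow> \<bar>F a - F b\<bar> \<le> e + C * \<bar>a - b\<bar>"
    using continuous_modulus[OF continuous_on_subset[OF F subset_UNIV] ee(1)] by blast
  define Y where "Y = (LINT z|lborel. indicator ({0..b} \<times> UNIV) z * ?X z)"
  define N where "N n = real (Suc n)" for n
  have N: "N n > 0" for n by (simp add: N_def)
  \<comment> \<open>A plateau of height \<open>1\<close> on \<open>{- N n..N n}\<close>, descending
    to \<open>0\<close> at \<open>- (2 * N n)\<close> and \<open>2 * N n\<close>.\<close>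
  define \<Psi> where "\<Psi> n = (\<lambda>x. smooth_step (2 + x / N n) * smooth_step (2 - x / N n))" for n
  have \<Psi>: "cutoff (- (2 * N n)) (2 * N n) (\<Psi> n)" for n
    unfolding cutoff_def
  proof (intro conjI allI impI)
    show "smooth (\<Psi> n)" unfolding \<Psi>_def
      by (intro smooth_intros(6) smooth_compose[OF smooth_step] smooth_intros(3,4) smooth_intros(1) smooth_intros(5)[OF smooth_intros(7)])
    show "0 \<le> \<Psi> n x" for x by (simp add: \<Psi>_def smooth_step_range)
    show "\<Psi> n x = 0" if "x \<notin> {- (2 * N n)..2 * N n}" for x
    proof -
      have "2 + x / N n \<le> 0 \<or> 2 - x / N n \<le> 0" using that N[of n] by (auto simp: field_simps)
      then show ?thesis by (auto simp: \<Psi>_def smooth_step_0)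
    qed
  qed
  have \<Psi>1: "\<Psi> n x \<le> 1" for n x
    unfolding \<Psi>_def by (intro mult_le_one smooth_step_range)
  have \<Psi>lim: "(\<lambda>n. \<Psi> n x) \<longlonglongrightarrow> 1" for x
  proof (rule tendsto_eventually)
    obtain m where "real m > \<bar>x\<bar>" using reals_Archimedean2 by blast
    then have "x / N n \<le> 1 \<and> - 1 \<le> x / N n" if "n \<ge> m" for n using that by (auto simp: N_def field_simps)
    then have "2 + x / N n \<ge> 1 \<and> 2 - x / N n \<ge> 1" if "n \<ge> m" for n using that by fastforce
    then have "\<Psi> n x = 1" if "n \<ge> m" for n
      using that by (simp add: \<Psi>_def smooth_step_1)
    then show "\<forall>\<^sub>F n in sequentially. \<Psi> n x = 1" by (auto simp: eventually_sequentially)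
  qed
  have d\<Psi>: "\<bar>deriv (\<Psi> n) x\<bar> \<le> 2 * M / N n" for n x
  proof -
    have 1: "((\<lambda>x. smooth_step (2 + x / N n)) has_real_derivative smooth_bump (2 + x / N n) * (1 / N n)) (at x)"
      by (rule DERIV_chain2[OF smooth_step_has_deriv]) (use N[of n] in \<open>auto intro!: derivative_eq_intros\<close>)
    have 2: "((\<lambda>x. smooth_step (2 - x / N n)) has_real_derivative smooth_bump (2 - x / N n) * (- (1 / N n))) (at x)"
      by (rule DERIV_chain2[OF smooth_step_has_deriv]) (use N[of n] in \<open>auto intro!: derivative_eq_intros\<close>)
    note DERIV_mult[OF 1 2, folded \<Psi>_def]
    then have "deriv (\<Psi> n) x = (smooth_bump (2 + x / N n) * smooth_step (2 - x / N n)
       - smooth_step (2 + x / N n) * smooth_bump (2 - x / N n)) / N n"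
      by (subst DERIV_imp_deriv, assumption) (simp add: diff_divide_distrib)
    moreover have "\<bar>smooth_bump (2 + x / N n) * smooth_step (2 - x / N n)\<bar> \<le> M * 1"
      "\<bar>smooth_step (2 + x / N n) * smooth_bump (2 - x / N n)\<bar> \<le> 1 * M"
      unfolding abs_mult by (intro mult_mono; use smooth_step_range smooth_bump_nonneg M in \<open>simp add: less_imp_le\<close>)+
    ultimately show ?thesis using N[of n] by (simp add: field_simps abs_divide)
  qed
  have "?X \<in> borel_measurable borel" using um vm by measurable
  then have iX: "integrable lborel (\<lambda>z. ?X z * deriv \<theta> (fst z))"
    by (rule strip_integrable[OF \<theta>(1,2) _ int])
  have lim: "(\<lambda>n. LINT z|lborel. ?X z * (deriv \<theta> (fst z) * \<Psi> n (snd z))) \<longlonglongrightarrow> ?I"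
  proof (rule integral_dominated_convergence[where w="\<lambda>z. norm (?X z * deriv \<theta> (fst z))"])
    show "integrable lborel (\<lambda>z. norm (?X z * deriv \<theta> (fst z)))" using iX by (rule integrable_norm)
    show "AE z in lborel. (\<lambda>n. ?X z * (deriv \<theta> (fst z) * \<Psi> n (snd z))) \<longlonglongrightarrow> ?X z * deriv \<theta> (fst z)"
    proof (rule AE_I2)
      fix z
      have "(\<lambda>n. ?X z * (deriv \<theta> (fst z) * \<Psi> n (snd z))) \<longlonglongrightarrow> ?X z * (deriv \<theta> (fst z) * 1)"
        by (intro tendsto_intros \<Psi>lim)
      then show "(\<lambda>n. ?X z * (deriv \<theta> (fst z) * \<Psi> n (snd z))) \<longlonglongrightarrow> ?X z * deriv \<theta> (fst z)" by simp
    qed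
    show "AE z in lborel. norm (?X z * (deriv \<theta> (fst z) * \<Psi> n (snd z))) \<le> norm (?X z * deriv \<theta> (fst z))" for n
    proof (rule AE_I2)
      fix z
      have "\<bar>?X z * deriv \<theta> (fst z)\<bar> * \<Psi> n (snd z) \<le> \<bar>?X z * deriv \<theta> (fst z)\<bar> * 1"
        by (intro mult_left_mono \<Psi>1) auto
      then show "norm (?X z * (deriv \<theta> (fst z) * \<Psi> n (snd z))) \<le> norm (?X z * deriv \<theta> (fst z))"
        using cutoffD(2)[OF \<Psi>[of n], of "snd z"] by (simp add: abs_mult mult.assoc)
    qed
    show "(\<lambda>z. ?X z * deriv \<theta> (fst z)) \<in> borel_measurable lborel" using iX by (rule borel_measurable_integrable)
    show "(\<lambda>z. ?X z * (deriv \<theta> (fst z) * \<Psi> n (snd z))) \<in> borel_measurable lborel" for n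
      using um vm fst_measurable[OF Ff(8)] snd_measurable[OF cutoffD(7)[OF \<Psi>[of n]]]
      by measurable
  qed
  obtain BQ where BQ: "BQ \<ge> 0" "\<And>a b. a \<in> {0..R} \<Longrightarrow> b \<in> {0..R} \<Longrightarrow> \<bar>a - b\<bar> \<le> BQ \<and> \<bar>kflux F a b\<bar> \<le> BQ"
    using flux_bounded[OF F] by blast
  have bnd: "0 \<le> (LINT z|lborel. ?X z * (deriv \<theta> (fst z) * \<Psi> n (snd z))) + (8 * e * B * M * (b - a) + 2 * M * C * B * Y / N n)" for n
  proof -
    let ?i = "\<lambda>z. indicator ({a..b} \<times> {- (2 * N n)..2 * N n}) z :: real"
    let ?j = "\<lambda>z. indicator ({0..b} \<times> UNIV) z * ?X z :: real"
    have i1: "integrable lborel (\<lambda>z. ?X z * (deriv \<theta> (fst z) * \<Psi> n (snd z)))"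
      by (rule integrable_tensor[OF _ _ Ff(6) cutoff_deriv_0[OF \<theta>(1)] cutoffD(5)[OF \<Psi>[of n]] cutoffD(3)[OF \<Psi>[of n]], of _ BQ])
        (use BQ(2)[OF ur vr] in \<open>auto intro!: borel_measurable_abs borel_measurable_diff um vm\<close>)
    have i2: "integrable lborel (\<lambda>z. kflux F (u z) (v z) * (\<theta> (fst z) * deriv (\<Psi> n) (snd z)))"
      by (rule integrable_tensor[OF _ _ Ff(5) Ff(3) cutoffD(6)[OF \<Psi>[of n]] cutoff_deriv_0[OF \<Psi>[of n]], of _ BQ])
        (use BQ(2)[OF ur vr] in \<open>auto intro!: kflux_measurable[OF F] um vm\<close>)
    have em: "emeasure lborel ({a..b} \<times> {- (2 * N n)..2 * N n}) = ennreal ((b - a) * (4 * N n))"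
      using \<theta>(3) N[of n] by (subst lborel_prod[symmetric], subst lborel.emeasure_pair_measure_Times)
        (auto simp: ennreal_mult)
    have meas: "{a..b} \<times> {- (2 * N n)..2 * N n} \<in> sets borel"
      by (intro borel_closed closed_Times) auto
    have i3: "integrable lborel ?i"
      using em meas by (intro integrable_real_indicator) auto
    have m3: "(LINT z|lborel. ?i z) = (b - a) * (4 * N n)"
      using em \<theta>(3) N[of n] by (simp add: measure_def)
    have "0 \<le> (LINT z|lborel. ?X z * (deriv \<theta> (fst z) * \<Psi> n (snd z))
      + kflux F (u z) (v z) * (\<theta> (fst z) * deriv (\<Psi> n) (snd z)))"
      by (rule kruzhkov_kato[OF u v F \<theta>(1,2) \<Psi>])
    also have "\<dots> = (LINT z|lborel. ?X z * (deriv \<theta> (fst z) * \<Psi> n (snd z)))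
      + (LINT z|lborel. kflux F (u z) (v z) * (\<theta> (fst z) * deriv (\<Psi> n) (snd z)))"
      using i1 i2 by simp
    also have "(LINT z|lborel. kflux F (u z) (v z) * (\<theta> (fst z) * deriv (\<Psi> n) (snd z)))
      \<le> (LINT z|lborel. (2 * M / N n * B) * (e * ?i z + C * ?j z))"
    proof (rule integral_mono[OF i2])
      show "integrable lborel (\<lambda>z. (2 * M / N n * B) * (e * ?i z + C * ?j z))"
        using i3 int by (intro integrable_mult_right Bochner_Integration.integrable_add)
      fix z :: "real \<times> real"
      obtain t x where z: "z = (t, x)" by fastforce
      show "kflux F (u z) (v z) * (\<theta> (fst z) * deriv (\<Psi> n) (snd z)) \<le> (2 * M / N n * B) * (e * ?i z + C * ?j z)"
      proof (cases "t \<in> {a..b} \<and> x \<in> {- (2 * N n)..2 * N n}")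
        case False
        then have *: "\<theta> t * deriv (\<Psi> n) x = 0" using Ff(3)[of t] cutoff_deriv_0[OF \<Psi>[of n], of x] by auto
        have "0 \<le> (2 * M / N n * B) * (e * ?i z + C * ?j z)"
          using M(1) N[of n] B(1) C(1) ee(1) by (intro mult_nonneg_nonneg add_nonneg_nonneg) auto
        then show ?thesis unfolding z fst_conv snd_conv * by simp
      next
        case True
        have "\<bar>kflux F (u z) (v z)\<bar> = \<bar>F (u z) - F (v z)\<bar>" by (auto simp: kflux_def max_def min_def)
        also have "\<dots> \<le> e + C * ?X z" by (rule C(2)[OF ur vr])
        finally have q: "\<bar>kflux F (u z) (v z)\<bar> \<le> e + C * ?X z" .
        have "\<bar>\<theta> t * deriv (\<Psi> n) x\<bar> \<le> B * (2 * M / N n)"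
          unfolding abs_mult using B Ff(2)[of t] d\<Psi> by (intro mult_mono) auto
        from mult_le_of_abs_le[OF q this]
        have "kflux F (u z) (v z) * (\<theta> t * deriv (\<Psi> n) x) \<le> (e + C * ?X z) * (B * (2 * M / N n))" .
        moreover have ij: "?i z = 1" "indicator ({0..b} \<times> UNIV) z = (1::real)" using True \<theta>(2) by (auto simp: z)
        ultimately show ?thesis unfolding ij by (simp add: z mult.commute)
      qed
    qed
    also have "\<dots> = (2 * M / N n * B) * (e * ((b - a) * (4 * N n)) + C * Y)"
      using i3 int m3 by (simp add: Y_def)
    also have "\<dots> = 8 * e * B * M * (b - a) + 2 * M * C * B * Y / N n"
      using N[of n] by (simp add: field_simps)
    finally show ?thesis by simp
  qed
  have "(\<lambda>n. inverse (real (Suc n))) \<longlonglongrightarrow> 0" by (rule LIMSEQ_inverse_real_of_nat)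
  then have "(\<lambda>n. 2 * M * C * B * Y / N n) \<longlonglongrightarrow> 2 * M * C * B * Y * 0"
    unfolding N_def divide_inverse by (intro tendsto_intros)
  from tendsto_add[OF lim tendsto_add[OF tendsto_const this]]
  have "0 \<le> ?I + (8 * e * B * M * (b - a) + 2 * M * C * B * Y * 0)"
    by (rule LIMSEQ_le_const) (use bnd in auto)
  then show "0 \<le> ?I + e0" using ee(2) by simp
qed

text \<open>A non-integrable function has Bochner integral \<open>0\<close> by convention, so the
  value \<open>1\<close> of the integral already proves integrability.\<close>

lemma mollifier_integrable_shift:
  assumes "mollifier \<epsilon> d"
  shows "integrable lborel (\<lambda>s. d (s - t))"
  using integral_mollifier_shift(1)[OF assms, of t] not_integrable_integral_eq[of lborel "\<lambda>s. d (s - t)"] by fastforce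

text \<open>The time cutoff approximates the indicator of \<open>{a..b}\<close>, and its derivative
  is a mollifier just after \<open>a\<close> minus one just after \<open>b\<close>. The inequality
  thus compares two averages of the spatial norm; the continuous function \<open>m\<close>, which
  agrees with this norm at almost every time, turns averages into values.\<close>

lemma kruzhkov_contraction:
  assumes u: "kruzhkov R F u" and v: "kruzhkov R F v" and F: "continuous_on UNIV F"
    and int: "\<And>T. integrable lborel (\<lambda>z. indicator ({0..T} \<times> UNIV) z * \<bar>u z - v z\<bar>)"
    and m: "continuous_on {0<..} m" "AE t in lborel. 0 < t \<longrightarrow> (LINT x|lborel. \<bar>u (t, x) - v (t, x)\<bar>) = m t"
    and ab: "0 < a" "a < b"
  shows "m b \<le> m a"
proof (rule field_le_epsilon)
  fix e :: real assume e: "e > 0"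
  \<comment> \<open>Only times after \<open>s\<close> are considered, because the mollifiers are
    one-sided.\<close>
  have nb: "\<exists>d>0. \<forall>t\<in>{s..s + d}. \<bar>m t - m s\<bar> < e / 2" if "s > 0" for s
  proof -
    have "isCont m s" using m(1) that by (simp add: continuous_on_eq_continuous_at)
    then obtain d where d: "d > 0" "\<And>t. dist t s < d \<Longrightarrow> dist (m t) (m s) < e / 2"
      using e unfolding continuous_at_eps_delta by (metis half_gt_zero)
    show ?thesis
      by (rule exI[of _ "d / 2"]) (use d in \<open>auto simp: dist_real_def\<close>)
  qed
  obtain d1 d2 where d1: "d1 > 0" "\<And>t. t \<in> {a..a + d1} \<Longrightarrow> \<bar>m t - m a\<bar> < e / 2"
    and d2: "d2 > 0" "\<And>t. t \<in> {b..b + d2} \<Longrightarrow> \<bar>m t - m b\<bar> < e / 2"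
    using nb[of a] nb[of b] ab by fastforce
  define \<epsilon> where "\<epsilon> = min d1 d2"
  have \<epsilon>: "\<epsilon> > 0" "\<epsilon> \<le> d1" "\<epsilon> \<le> d2" using d1(1) d2(1) by (auto simp: \<epsilon>_def)
  define d where "d = (\<lambda>s. smooth_bump (s / \<epsilon>) / \<epsilon>)"
  have d: "mollifier \<epsilon> d" unfolding d_def by (rule mollifier_bump[OF \<epsilon>(1)])
  note dc = cutoffD[OF mollifierD(1)[OF d]]
  define \<theta> where "\<theta> = (\<lambda>t. smooth_step ((t - a) / \<epsilon>) - smooth_step ((t - b) / \<epsilon>))"
  have \<theta>: "cutoff a (b + \<epsilon>) \<theta>"
    unfolding cutoff_def
  proof (intro conjI allI impI)
    show "smooth \<theta>" unfolding \<theta>_def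
      by (intro smooth_intros(4) smooth_compose[OF smooth_step] smooth_intros(5)[OF smooth_intros(4)[OF smooth_intros(7,1)]])
    show "0 \<le> \<theta> t" for t
    proof -
      have "(t - b) / \<epsilon> \<le> (t - a) / \<epsilon>" using ab \<epsilon>(1) by (simp add: divide_right_mono)
      then show ?thesis using smooth_step_mono by (simp add: \<theta>_def)
    qed
    show "\<theta> t = 0" if "t \<notin> {a..b + \<epsilon>}" for t
    proof (cases "t < a")
      case True
      then have "(t - a) / \<epsilon> \<le> 0" "(t - b) / \<epsilon> \<le> 0" using ab \<epsilon>(1) by (auto simp: divide_le_0_iff)
      then show ?thesis by (simp add: \<theta>_def smooth_step_0)
    next
      case False
      then have "(t - a) / \<epsilon> \<ge> 1" "(t - b) / \<epsilon> \<ge> 1" using that ab \<epsilon>(1) by (auto simp: field_simps)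
      then show ?thesis by (simp add: \<theta>_def smooth_step_1)
    qed
  qed
  have d\<theta>: "deriv \<theta> t = d (t - a) - d (t - b)" for t
  proof -
    have 1: "((\<lambda>t. smooth_step ((t - s) / \<epsilon>)) has_real_derivative smooth_bump ((t - s) / \<epsilon>) * (1 / \<epsilon>)) (at t)" for s
      by (rule DERIV_chain2[OF smooth_step_has_deriv]) (use \<epsilon>(1) in \<open>auto intro!: derivative_eq_intros\<close>)
    from DERIV_diff[OF 1[of a] 1[of b]] show ?thesis
      unfolding \<theta>_def by (subst DERIV_imp_deriv, assumption) (simp add: d_def)
  qed
  have w: "(\<lambda>z. \<bar>u z - v z\<bar>) \<in> borel_measurable borel"
    using kruzhkovD(1)[OF u] kruzhkovD(1)[OF v] by measurable
  have i: "integrable lborel (\<lambda>z. \<bar>u z - v z\<bar> * deriv \<theta> (fst z))"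
    by (rule strip_integrable[OF \<theta> ab(1) w int])
  have "0 \<le> (LINT z|lborel. \<bar>u z - v z\<bar> * deriv \<theta> (fst z))"
    using ab \<epsilon>(1) by (intro kruzhkov_time_monotone[OF u v F \<theta> ab(1) _ int]) auto
  also have "\<dots> = (LINT t|lborel. LINT x|lborel. \<bar>u (t, x) - v (t, x)\<bar> * deriv \<theta> t)"
    by (subst integral_lborel_prod(1)[OF i]) simp
  also have "\<dots> \<le> (LINT t|lborel. d (t - a) * (m a + e / 2) - d (t - b) * (m b - e / 2))"
  proof (rule integral_mono_AE)
    show "integrable lborel (\<lambda>t. LINT x|lborel. \<bar>u (t, x) - v (t, x)\<bar> * deriv \<theta> t)"
      using integral_lborel_prod(4)[OF i] by simp
    show "integrable lborel (\<lambda>t. d (t - a) * (m a + e / 2) - d (t - b) * (m b - e / 2))"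
      by (intro Bochner_Integration.integrable_diff integrable_mult_left mollifier_integrable_shift[OF d])
    show "AE t in lborel. (LINT x|lborel. \<bar>u (t, x) - v (t, x)\<bar> * deriv \<theta> t) \<le> d (t - a) * (m a + e / 2) - d (t - b) * (m b - e / 2)"
      using m(2)
    proof eventually_elim
      case (elim t)
      show ?case
      proof (cases "t > 0")
        case False
        then have "d (t - a) = 0" "d (t - b) = 0" using ab by (auto intro!: dc(3))
        then show ?thesis by (simp add: d\<theta>)
      next
        case True
        then have "(LINT x|lborel. \<bar>u (t, x) - v (t, x)\<bar> * deriv \<theta> t) = m t * (d (t - a) - d (t - b))"
          using elim by (simp add: d\<theta>)
        also have "\<dots> \<le> d (t - a) * (m a + e / 2) - d (t - b) * (m b - e / 2)"
        proof -
          have "d (t - a) * m t \<le> d (t - a) * (m a + e / 2)"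
          proof (cases "t - a \<in> {0..\<epsilon>}")
            case True
            then have "\<bar>m t - m a\<bar> < e / 2" using \<epsilon> by (intro d1(2)) auto
            then have "m t \<le> m a + e / 2" by linarith
            then show ?thesis by (intro mult_left_mono dc(2))
          qed (simp add: dc(3))
          moreover have "d (t - b) * (m b - e / 2) \<le> d (t - b) * m t"
          proof (cases "t - b \<in> {0..\<epsilon>}")
            case True
            then have "\<bar>m t - m b\<bar> < e / 2" using \<epsilon> by (intro d2(2)) auto
            then have "m b - e / 2 \<le> m t" by linarith
            then show ?thesis by (intro mult_left_mono dc(2))
          qed (simp add: dc(3))
          ultimately show ?thesis by (simp add: algebra_simps)
        qed
        finally show ?thesis .
      qed
    qed
  qed
  also have "\<dots> = m a - m b + e"
    using mollifier_integrable_shift[OF d] integral_mollifier_shift(1)[OF d] by simp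
  finally show "m b \<le> m a + e" by simp
qed

subsection \<open>One-sided parts along a Lipschitz curve\<close>

text \<open>\<open>\<zeta>\<close> is a staircase with step length \<open>h\<close> whose jumps are smoothed; at any time at
  most one step is active, so its slope is bounded independently of \<open>h\<close>.\<close>

lemma smooth_lipschitz_approx:
  fixes \<xi> :: "real \<Rightarrow> real"
  assumes \<xi>: "\<And>s t. \<bar>\<xi> s - \<xi> t\<bar> \<le> L * \<bar>s - t\<bar>" and M: "\<And>x. smooth_bump x \<le> M" and "\<eta> > 0"
  obtains \<zeta> where "smooth \<zeta>" "\<And>t. t \<in> {0..T} \<Longrightarrow> \<bar>\<zeta> t - \<xi> t\<bar> < \<eta>" "\<And>t. \<bar>deriv \<zeta> t\<bar> \<le> L * M"
proof -
  have L: "0 \<le> L" using \<xi>[of 0 1] by auto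
  \<comment> \<open>Within one step the curve and the staircase each deviate by at most
    \<open>L * h\<close> from their common value at its start; the \<open>1\<close> in the
    denominator covers \<open>L = 0\<close>.\<close>
  define h where "h = \<eta> / (2 * L + 1)"
  have h: "h > 0" "2 * L * h < \<eta>"
    using \<open>\<eta> > 0\<close> L by (auto simp: h_def field_simps)
  obtain n :: nat where n: "T / h < real n" using reals_Archimedean2 by blast
  define D where "D j = \<xi> (real (Suc j) * h) - \<xi> (real j * h)" for j
  have D: "\<bar>D j\<bar> \<le> L * h" for j
    using \<xi>[of "real (Suc j) * h" "real j * h"] h(1) by (simp add: D_def algebra_simps)
  define \<zeta> where "\<zeta> = (\<lambda>t. \<xi> 0 + (\<Sum>j<n. D j * smooth_step (t / h - real j)))"
  show thesis
  proof (rule that[of \<zeta>])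
    show "smooth \<zeta>" unfolding \<zeta>_def
      by (intro smooth_intros(3,6) smooth_sum smooth_compose[OF smooth_step] smooth_intros(1) smooth_intros(4) smooth_intros(5)[OF smooth_intros(7)])
    show "\<bar>\<zeta> t - \<xi> t\<bar> < \<eta>" if t: "t \<in> {0..T}" for t
    proof -
      \<comment> \<open>The index of the step in progress at time \<open>t\<close>: earlier steps
        are complete and later ones have not begun.\<close>
      define k where "k = nat \<lfloor>t / h\<rfloor>"
      have "0 \<le> t / h" using t h(1) by auto
      then have k: "real k \<le> t / h" "t / h < real k + 1" unfolding k_def by linarith+
      have "t / h \<le> T / h" using t h(1) by (simp add: divide_right_mono)
      then have "k < n" using k(1) n by linarith
      have "(\<Sum>j<n. D j * smooth_step (t / h - real j)) = (\<Sum>j<Suc k. D j * smooth_step (t / h - real j))"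
      proof (rule sum.mono_neutral_right)
        show "\<forall>j\<in>{..<n} - {..<Suc k}. D j * smooth_step (t / h - real j) = 0"
        proof
          fix j assume "j \<in> {..<n} - {..<Suc k}"
          then have "real k + 1 \<le> real j" by auto
          then have "t / h - real j \<le> 0" using k(2) by linarith
          then show "D j * smooth_step (t / h - real j) = 0" by (simp add: smooth_step_0)
        qed
      qed (use \<open>k < n\<close> in auto)
      also have "\<dots> = (\<Sum>j<k. D j * smooth_step (t / h - real j)) + D k * smooth_step (t / h - real k)" by simp
      also have "(\<Sum>j<k. D j * smooth_step (t / h - real j)) = (\<Sum>j<k. D j)"
      proof (rule sum.cong[OF refl])
        fix j assume "j \<in> {..<k}"
        then have "real j + 1 \<le> real k" by auto
        then have "t / h - real j \<ge> 1" using k(1) by linarith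
        then show "D j * smooth_step (t / h - real j) = D j" by (simp add: smooth_step_1)
      qed
      also have "(\<Sum>j<k. D j) = \<xi> (real k * h) - \<xi> 0"
        unfolding D_def using sum_lessThan_telescope[of "\<lambda>j. \<xi> (real j * h)" k] by simp
      finally have z: "\<zeta> t = \<xi> (real k * h) + D k * smooth_step (t / h - real k)" by (simp add: \<zeta>_def)
      have "\<bar>D k * smooth_step (t / h - real k)\<bar> \<le> (L * h) * 1"
        unfolding abs_mult using D[of k] smooth_step_range[of "t / h - real k"] by (intro mult_mono) auto
      moreover have "\<bar>\<xi> (real k * h) - \<xi> t\<bar> \<le> L * h"
      proof -
        have "\<bar>real k * h - t\<bar> \<le> h" using k h(1) by (auto simp: field_simps abs_le_iff)
        then show ?thesis using \<xi>[of "real k * h" t] mult_left_mono[OF _ L] by (meson order_trans)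
      qed
      ultimately show ?thesis unfolding z using h(2) by linarith
    qed
    show "\<bar>deriv \<zeta> t\<bar> \<le> L * M" for t
    proof -
      have 1: "((\<lambda>t. D j * smooth_step (t / h - real j)) has_real_derivative D j * (smooth_bump (t / h - real j) * (1 / h))) (at t)" for j
        by (intro DERIV_cmult DERIV_chain2[OF smooth_step_has_deriv]) (use h(1) in \<open>auto intro!: derivative_eq_intros\<close>)
      have "(\<zeta> has_real_derivative 0 + (\<Sum>j<n. D j * (smooth_bump (t / h - real j) * (1 / h)))) (at t)"
        unfolding \<zeta>_def by (intro DERIV_add DERIV_const DERIV_sum 1)
      then have "\<bar>deriv \<zeta> t\<bar> = \<bar>\<Sum>j<n. D j * (smooth_bump (t / h - real j) * (1 / h))\<bar>"
        by (subst DERIV_imp_deriv, assumption) simp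
      \<comment> \<open>A jump is at most \<open>L * h\<close> and the slope of a rescaled step at
        most \<open>M / h\<close>, so \<open>h\<close> cancels.\<close>
      also have "\<dots> \<le> (\<Sum>j<n. if j = nat \<lfloor>t / h\<rfloor> then L * M else 0)"
      proof (rule order_trans[OF sum_abs sum_mono])
        fix j
        show "\<bar>D j * (smooth_bump (t / h - real j) * (1 / h))\<bar> \<le> (if j = nat \<lfloor>t / h\<rfloor> then L * M else 0)"
        proof (cases "j = nat \<lfloor>t / h\<rfloor>")
          case True
          have "\<bar>D j * (smooth_bump (t / h - real j) * (1 / h))\<bar> \<le> (L * h) * (M * (1 / h))"
            unfolding abs_mult using D[of j] M[of "t / h - real j"] smooth_bump_nonneg[of "t / h - real j"] h(1) L
            by (intro mult_mono) auto
          then show ?thesis using True h(1) by simp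
        next
          case False
          then have "t / h - real j \<le> 0 \<or> t / h - real j \<ge> 1" by linarith
          then show ?thesis using False by (simp add: smooth_bump_0)
        qed
      qed
      also have "\<dots> \<le> L * M"
        using L M[of 0] smooth_bump_nonneg[of 0] by (simp add: sum.delta)
      finally show ?thesis .
    qed
  qed
qed

lemma integral_deriv_cutoff:
  fixes h h' :: "real \<Rightarrow> real"
  assumes h: "\<And>t. (h has_real_derivative h' t) (at t)" "continuous_on UNIV h'" "\<And>t. t \<notin> {a..b} \<Longrightarrow> h t = 0"
  shows "(LINT t|lborel. h' t) = 0"
proof -
  \<comment> \<open>The unit margin makes \<open>h\<close> vanish at both ends, and
    \<open>min\<close> and \<open>max\<close> keep the interval nonempty even when
    \<open>a > b\<close>.\<close>
  define A B where "A = min a b - 1" and "B = max a b + 1"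
  have AB: "A \<le> B" "h A = 0" "h B = 0" unfolding A_def B_def by (auto intro!: h(3))
  have 0: "h' t = 0" if "t \<notin> {A..B}" for t
  proof -
    have "\<forall>\<^sub>F y in nhds t. h y = 0"
      using eventually_nhds_in_open[of "- {A..B}" t] that
      by (auto elim!: eventually_mono intro!: h(3) simp: A_def B_def open_Compl)
    then have "(h has_real_derivative 0) (at t)"
      by (subst DERIV_cong_ev[OF refl _ refl]) auto
    then show ?thesis using h(1)[of t] DERIV_unique by blast
  qed
  have "has_bochner_integral lborel (\<lambda>x. indicator {A..B} x *\<^sub>R h' x) (h B - h A)"
    using has_bochner_integral_FTC_Icc[of A B h h'] AB(1) h(1) continuous_on_subset[OF h(2), of "{A..B}"]
    by (metis has_field_derivative_at_within has_real_derivative_iff_has_vector_derivative top_greatest)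
  moreover have "(\<lambda>x. indicator {A..B} x *\<^sub>R h' x) = h'"
    using 0 by (auto simp: fun_eq_iff indicator_def)
  ultimately show ?thesis using AB by (simp add: has_bochner_integral_iff)
qed

text \<open>In the coordinate \<open>y = \<sigma> * (x - \<xi> t)\<close> the strip is a rectangle.
  Integrating in \<open>t\<close> first, the trace hypothesis bounds almost every slice with
  \<open>0 < y < \<delta>\<close>, and integration in \<open>y\<close> produces the factor
  \<open>h\<close>, which later compensates the slope of the cutoff. The constant \<open>A\<close>
  is there for the constant part of the modulus of the flux.\<close>

lemma strip_estimate:
  fixes r :: "real \<times> real \<Rightarrow> real"
  assumes r: "r \<in> borel_measurable borel" "\<And>z. r z \<in> {0..R}"
    and \<xi>: "continuous_on UNIV \<xi>" "\<And>t. \<bar>\<xi> t\<bar> \<le> 1" and \<sigma>: "\<sigma> = 1 \<or> \<sigma> = -1"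
    and "0 \<le> T" and h: "0 < h" "h \<le> 3" "h \<le> \<delta>" and AB: "0 \<le> A" "0 \<le> B"
    and sep: "AE y in lborel. 0 < y \<and> y < \<delta> \<longrightarrow> (LINT t|lborel. indicator {0..T} t * r (t, \<xi> t + \<sigma> * y)) < e"
  defines "S \<equiv> \<lambda>z. indicator {0..T} (fst z) * indicator {0<..<h} (\<sigma> * (snd z - \<xi> (fst z)))"
  shows "integrable lborel (\<lambda>z. S z * (A + B * r z))"
    and "(LINT z|lborel. S z * (A + B * r z)) \<le> h * (A * T + B * e)"
proof -
  have R: "0 \<le> R" using r(2)[of "(0,0)"] by auto
  have mxi[measurable]: "\<xi> \<in> borel_measurable borel" by (rule borel_measurable_continuous_onI[OF \<xi>(1)])
  have mf[measurable]: "(fst :: real \<times> real \<Rightarrow> real) \<in> borel_measurable borel" "(snd :: real \<times> real \<Rightarrow> real) \<in> borel_measurable borel"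
    by (intro borel_measurable_continuous_onI continuous_intros)+
  note mr[measurable] = r(1)
  have bd: "\<bar>i * j * (A + B * r z)\<bar> \<le> A + B * R" if "i \<in> {0,1}" "j \<in> {0,1}" for i j z
  proof -
    have "\<bar>i * j\<bar> * \<bar>A + B * r z\<bar> \<le> 1 * (A + B * R)"
      using r(2)[of z] AB that by (intro mult_mono) (auto intro!: mult_left_mono)
    then show ?thesis by (simp add: abs_mult)
  qed
  have ind: "indicator X y \<in> {0, 1 :: real}" for X :: "real set" and y by (simp add: indicator_def)
  \<comment> \<open>The bound \<open>4\<close> is \<open>1\<close> for the curve plus
    \<open>3\<close> for the largest width of the strip.\<close>
  have C: "compact ({0..T} \<times> {-4..4::real})" by (intro compact_Times compact_Icc)
  have "integrable lborel (\<lambda>z. (S z * (A + B * r z)) * 1)"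
  proof (rule integrable_bounded_times_continuous[OF _ _ continuous_on_const C])
    show "(\<lambda>z. S z * (A + B * r z)) \<in> borel_measurable borel"
      unfolding S_def by measurable
    show "\<bar>S z * (A + B * r z)\<bar> \<le> A + B * R" for z
      unfolding S_def by (rule bd[OF ind ind])
    show "S z * (A + B * r z) * 1 = 0" if z: "z \<notin> {0..T} \<times> {-4..4}" for z
    proof -
      obtain t x where tx: "z = (t, x)" by fastforce
      have "\<bar>x\<bar> \<le> 4" if "0 < \<sigma> * (x - \<xi> t)" "\<sigma> * (x - \<xi> t) < h"
        using \<sigma> that \<xi>(2)[of t] h(2) by auto
      then show ?thesis using z unfolding S_def tx by (auto simp: indicator_def abs_le_iff)
    qed
  qed
  then show i: "integrable lborel (\<lambda>z. S z * (A + B * r z))" by simp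
  \<comment> \<open>The integrand over the strip in the straightened coordinates.\<close>
  define G where "G z = indicator {0..T} (fst z) * indicator {0<..<h} (snd z) * (A + B * r (fst z, \<xi> (fst z) + \<sigma> * snd z))" for z
  have mG: "G \<in> borel_measurable borel"
  proof -
    have "(\<lambda>z::real \<times> real. (fst z, \<xi> (fst z) + \<sigma> * snd z)) \<in> borel \<rightarrow>\<^sub>M borel"
      by (intro borel_measurable_continuous_onI continuous_intros continuous_on_compose2[OF \<xi>(1)]) auto
    from measurable_compose[OF this r(1)]
    have [measurable]: "(\<lambda>z. r (fst z, \<xi> (fst z) + \<sigma> * snd z)) \<in> borel_measurable borel" .
    show ?thesis unfolding G_def by measurable
  qed
  have "integrable lborel (\<lambda>z. G z * 1)"
  proof (rule integrable_bounded_times_continuous[OF mG _ continuous_on_const C])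
    show "\<bar>G z\<bar> \<le> A + B * R" for z
      unfolding G_def by (rule bd[OF ind ind])
    show "G z * 1 = 0" if z: "z \<notin> {0..T} \<times> {-4..4}" for z
      using z h(2) by (cases z) (auto simp: G_def indicator_def)
  qed
  then have iG: "integrable lborel G" by simp
  have "(LINT z|lborel. S z * (A + B * r z)) = (LINT t|lborel. LINT x|lborel. S (t, x) * (A + B * r (t, x)))"
    by (rule integral_lborel_prod(1)[OF i])
  also have "\<dots> = (LINT t|lborel. LINT y|lborel. G (t, y))"
  proof (rule Bochner_Integration.integral_cong[OF refl])
    fix t
    have "(LINT x|lborel. S (t, x) * (A + B * r (t, x))) = \<bar>\<sigma>\<bar> *\<^sub>R (LINT y|lborel. S (t, \<xi> t + \<sigma> * y) * (A + B * r (t, \<xi> t + \<sigma> * y)))"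
      by (rule lborel_integral_real_affine) (use \<sigma> in auto)
    also have "\<dots> = (LINT y|lborel. G (t, y))"
      using \<sigma> by (auto simp: S_def G_def)
    finally show "(LINT x|lborel. S (t, x) * (A + B * r (t, x))) = (LINT y|lborel. G (t, y))" .
  qed
  also have "\<dots> = (LINT y|lborel. LINT t|lborel. G (t, y))"
    using integral_lborel_prod(1,2)[OF iG] by simp
  also have "\<dots> \<le> (LINT y|lborel. indicator {0<..<h} y * (A * T + B * e))"
  proof (rule integral_mono_AE)
    show "integrable lborel (\<lambda>y. LINT t|lborel. G (t, y))" by (rule integral_lborel_prod(5)[OF iG])
    show "integrable lborel (\<lambda>y. indicator {0<..<h} y * (A * T + B * e))"
      by (intro integrable_mult_left integrable_real_indicator) (use h(1) in auto)
    show "AE y in lborel. (LINT t|lborel. G (t, y)) \<le> indicator {0<..<h} y * (A * T + B * e)"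
      using sep
    proof eventually_elim
      case (elim y)
      show ?case
      proof (cases "y \<in> {0<..<h}")
        case False
        then show ?thesis by (simp add: G_def)
      next
        case True
        have "(\<lambda>t. (t, \<xi> t + \<sigma> * y)) \<in> borel \<rightarrow>\<^sub>M borel"
          by (intro borel_measurable_continuous_onI continuous_intros \<xi>(1))
        from measurable_compose[OF this r(1)] have m: "(\<lambda>t. r (t, \<xi> t + \<sigma> * y)) \<in> borel_measurable borel" .
        have "integrable lborel (\<lambda>t. (indicator {0..T} t * r (t, \<xi> t + \<sigma> * y)) * 1)"
          by (rule integrable_bounded_times_continuous[of _ R, OF _ _ continuous_on_const compact_Icc[of 0 T]])
            (use m R r(2) in \<open>auto simp: indicator_def\<close>)
        then have i1: "integrable lborel (\<lambda>t. indicator {0..T} t * r (t, \<xi> t + \<sigma> * y))" by simp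
        have i2: "integrable lborel (indicator {0..T} :: real \<Rightarrow> real)"
          by (intro integrable_real_indicator) (auto simp: emeasure_lborel_Icc_eq)
        have "(LINT t|lborel. G (t, y)) = (LINT t|lborel. indicator {0..T} t * A + B * (indicator {0..T} t * r (t, \<xi> t + \<sigma> * y)))"
          using True by (intro Bochner_Integration.integral_cong) (auto simp: G_def algebra_simps)
        also have "\<dots> = A * T + B * (LINT t|lborel. indicator {0..T} t * r (t, \<xi> t + \<sigma> * y))"
          using i1 i2 \<open>0 \<le> T\<close> by simp
        also have "\<dots> \<le> A * T + B * e"
          using elim True h(3) AB(2) by (intro add_left_mono mult_left_mono) auto
        finally show ?thesis using True by simp
      qed
    qed
  qed
  also have "\<dots> = h * (A * T + B * e)" using h(1) by simp
  finally show "(LINT z|lborel. S z * (A + B * r z)) \<le> h * (A * T + B * e)" .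
qed

text \<open>The test function is cut off at distance \<open>\<eta>\<close> from the curve. After subtracting the identity
  satisfied by the constant state \<open>0\<close>, both the entropy and its flux vanish where \<open>r = 0\<close>, so that
  the cutoff error over a strip of width \<open>O(\<eta>)\<close>, of size \<open>O(1 / \<eta>)\<close> times the mass of \<open>r\<close> there,
  tends to zero by the vanishing traces.\<close>

lemma one_sided_kruzhkov:
  fixes r :: "real \<times> real \<Rightarrow> real" and f \<xi> :: "real \<Rightarrow> real"
  assumes r: "r \<in> borel_measurable borel" "\<And>z. r z \<in> {0..R}"
    and f: "continuous_on UNIV f" "f 0 = 0" and \<sigma>: "\<sigma> = 1 \<or> \<sigma> = -1"
    and \<xi>: "\<And>s t. \<bar>\<xi> s - \<xi> t\<bar> \<le> L * \<bar>s - t\<bar>" "\<And>t. \<bar>\<xi> t\<bar> \<le> 1"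
    and ent: "\<And>\<kappa> \<Phi>. \<kappa> \<in> {0..R} \<Longrightarrow> \<Phi> \<in> test_functions ({0<..} \<times> UNIV) \<Longrightarrow> (\<And>z. 0 \<le> \<Phi> z) \<Longrightarrow>
      (\<And>t. 0 < t \<Longrightarrow> \<Phi> (t, \<xi> t) = 0) \<Longrightarrow>
      0 \<le> (LINT z|lborel. \<bar>r z - \<kappa>\<bar> * deriv (\<lambda>s. \<Phi> (s, snd z)) (fst z)
        + sgn (snd z - \<xi> (fst z)) * kflux f (r z) \<kappa> * deriv (\<lambda>y. \<Phi> (fst z, y)) (snd z))"
    and sep: "\<And>T e. 0 < T \<Longrightarrow> 0 < e \<Longrightarrow> \<exists>\<delta>>0. AE y in lborel. 0 < y \<and> y < \<delta> \<longrightarrow>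
      (LINT t|lborel. indicator {0..T} t * r (t, \<xi> t + \<sigma> * y)) < e"
  shows "kruzhkov R (\<lambda>s. \<sigma> * f s) (\<lambda>z. if 0 < \<sigma> * (snd z - \<xi> (fst z)) then r z else 0)"
proof -
  define F where "F s = \<sigma> * f s" for s
  define u where "u z = (if 0 < \<sigma> * (snd z - \<xi> (fst z)) then r z else 0)" for z
  have R: "0 \<le> R" using r(2)[of "(0,0)"] by auto
  have L: "0 \<le> L" using \<xi>(1)[of 0 1] by auto
  have c\<xi>: "continuous_on UNIV \<xi>"
  proof -
    have "L-lipschitz_on UNIV \<xi>" using \<xi>(1) L by (auto simp: lipschitz_on_def dist_real_def)
    then show ?thesis by (rule lipschitz_on_continuous_on)
  qed
  have mxi[measurable]: "\<xi> \<in> borel_measurable borel" by (rule borel_measurable_continuous_onI[OF c\<xi>])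
  have mf[measurable]: "(fst :: real \<times> real \<Rightarrow> real) \<in> borel_measurable borel" "(snd :: real \<times> real \<Rightarrow> real) \<in> borel_measurable borel"
    by (intro borel_measurable_continuous_onI continuous_intros)+
  note mr[measurable] = r(1)
  have cF: "continuous_on UNIV F" unfolding F_def by (intro continuous_intros f(1))
  have F0: "F 0 = 0" by (simp add: F_def f(2))
  have mu[measurable]: "u \<in> borel_measurable borel" unfolding u_def by measurable
  have u: "u z \<in> {0..R}" for z using r(2)[of z] R by (auto simp: u_def)
  have kF: "kflux F x y = \<sigma> * kflux f x y" for x y by (simp add: kflux_def F_def algebra_simps)
  obtain M where M: "M > 0" "\<And>x. smooth_bump x \<le> M" using smooth_bump_bounded by metis
  have Mabs: "\<bar>smooth_bump x\<bar> \<le> M" for x using M(2) smooth_bump_nonneg by (simp add: abs_le_iff order_trans[of _ 0])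
  have mH[measurable]: "smooth_step \<in> borel_measurable borel" "smooth_bump \<in> borel_measurable borel"
    by (intro borel_measurable_continuous_onI smooth_continuous smooth_step smooth_bump)+
  obtain BQ where BQ: "BQ \<ge> 0" "\<And>a b. a \<in> {0..R} \<Longrightarrow> b \<in> {0..R} \<Longrightarrow> \<bar>a - b\<bar> \<le> BQ \<and> \<bar>kflux F a b\<bar> \<le> BQ"
    using flux_bounded[OF cF] by blast
  have "0 \<le> (LINT z|lborel. \<bar>u z - \<kappa>\<bar> * (deriv g (fst z) * k (snd z)) + kflux F (u z) \<kappa> * (g (fst z) * deriv k (snd z)))"
    if \<kappa>: "\<kappa> \<in> {0..R}" and "0 < a" and g: "cutoff a b g" and k: "cutoff (- c) c k" for \<kappa> a b c g k
  proof -
    note gD = cutoffD[OF g] and kD = cutoffD[OF k]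
    have mg[measurable]: "g \<in> borel_measurable borel" "deriv g \<in> borel_measurable borel" "k \<in> borel_measurable borel" "deriv k \<in> borel_measurable borel"
      by (rule gD kD)+
    note tens = integrable_tensor[where a=a and b=b and c'="- c" and c=c]
    \<comment> \<open>Entropy and entropy flux, with their values \<open>\<kappa>\<close> and
      \<open>F \<kappa>\<close> at the state \<open>0\<close> subtracted. Both vanish at
      \<open>0\<close>, so the region where \<open>u\<close> is extended by zero contributes nothing
      to \<open>G\<close>.\<close>
    define E where "E x = \<bar>x - \<kappa>\<bar> - \<kappa>" for x
    define q where "q x = kflux F x \<kappa> - F \<kappa>" for x
    have Eb: "\<bar>E x\<bar> \<le> x" if "x \<in> {0..R}" for x using that \<kappa> unfolding E_def by auto
    have E0: "E 0 = 0" and q0: "q 0 = 0" using \<kappa> F0 by (auto simp: E_def q_def kflux_def)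
    have qb: "\<bar>q x\<bar> \<le> 2 * BQ" if "x \<in> {0..R}" for x
    proof -
      have "\<bar>kflux F \<kappa> 0\<bar> \<le> BQ" using BQ(2)[OF \<kappa>, of 0] R by simp
      then have "\<bar>F \<kappa>\<bar> \<le> BQ" using \<kappa> F0 by (simp add: kflux_def)
      then show ?thesis using BQ(2)[OF that \<kappa>] unfolding q_def by linarith
    qed
    have mE[measurable]: "E \<in> borel_measurable borel" unfolding E_def by measurable
    have mq[measurable]: "q \<in> borel_measurable borel"
      unfolding q_def[abs_def] by (intro borel_measurable_diff kflux_measurable[OF cF]) auto
    define G where "G z = E (u z) * (deriv g (fst z) * k (snd z)) + q (u z) * (g (fst z) * deriv k (snd z))" for z
    have iG: "integrable lborel G"
      unfolding G_def
    proof (rule Bochner_Integration.integrable_add)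
      show "integrable lborel (\<lambda>z. E (u z) * (deriv g (fst z) * k (snd z)))"
        by (rule tens[of _ R, OF _ _ gD(6) cutoff_deriv_0[OF g] kD(5,3)])
          (use order_trans[OF Eb[OF u]] u in auto)
      show "integrable lborel (\<lambda>z. q (u z) * (g (fst z) * deriv k (snd z)))"
        by (rule tens[of _ "2 * BQ", OF _ _ gD(5,3) kD(6) cutoff_deriv_0[OF k]])
          (use qb[OF u] in auto)
    qed
    \<comment> \<open>Consequently \<open>G\<close> and the entropy integrand of \<open>u\<close>
      have the same integral.\<close>
    have zero: "integrable lborel (\<lambda>z. deriv g (fst z) * k (snd z))" "(LINT z|lborel. deriv g (fst z) * k (snd z)) = 0"
      "integrable lborel (\<lambda>z. g (fst z) * deriv k (snd z))" "(LINT z|lborel. g (fst z) * deriv k (snd z)) = 0"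
    proof -
      show i1: "integrable lborel (\<lambda>z. deriv g (fst z) * k (snd z))"
        using tens[of "\<lambda>_. 1" 1, OF _ _ gD(6) cutoff_deriv_0[OF g] kD(5,3)] by simp
      show i2: "integrable lborel (\<lambda>z. g (fst z) * deriv k (snd z))"
        using tens[of "\<lambda>_. 1" 1, OF _ _ gD(5,3) kD(6) cutoff_deriv_0[OF k]] by simp
      have "(LINT t|lborel. deriv g t) = 0" by (rule integral_deriv_cutoff[OF gD(4,6,3)])
      moreover have "(LINT x|lborel. deriv k x) = 0" by (rule integral_deriv_cutoff[OF kD(4,6,3)])
      ultimately show "(LINT z|lborel. deriv g (fst z) * k (snd z)) = 0" "(LINT z|lborel. g (fst z) * deriv k (snd z)) = 0"
        using integral_lborel_prod(2)[OF i1] integral_lborel_prod(1)[OF i2] by simp_all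
    qed
    have main: "0 \<le> (LINT z|lborel. G z)"
    proof (rule field_le_epsilon)
      fix e :: real assume e: "e > 0"
      define T where "T = max b 1"
      have T: "T > 0" "b \<le> T" by (auto simp: T_def)
      obtain Mg Mk where Mg: "Mg > 0" "\<And>x. g x \<le> Mg" and Mk: "Mk > 0" "\<And>x. k x \<le> Mk"
        using cutoff_bounded[OF g] cutoff_bounded[OF k] by metis
      define Bk where "Bk = Mg * Mk"
      have Bk: "Bk > 0" "g t * k x \<le> Bk" for t x
      proof -
        show "Bk > 0" using Mg(1) Mk(1) by (simp add: Bk_def)
        show "g t * k x \<le> Bk" unfolding Bk_def using Mg Mk kD(2) by (intro mult_mono) (auto simp: less_imp_le)
      qed
      \<comment> \<open>In the cutoff error the prefactor \<open>Bk * M / \<eta> n\<close> meets the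
        strip width \<open>3 * \<eta> n\<close>, which leaves
        \<open>Bk * M * 3 * (2 * e1 * T + N * e2)\<close>; \<open>e1\<close> and \<open>e2\<close>
        are chosen so that either summand is at most \<open>e / 2\<close>.\<close>
      define e1 where "e1 = e / (12 * Bk * M * T)"
      have e1: "e1 > 0" "Bk * M * 3 * (2 * e1 * T) = e / 2" using e Bk(1) M(1) T(1) by (auto simp: e1_def)
      obtain C where C: "C \<ge> 0" "\<And>a b. a \<in> {0..R} \<Longrightarrow> b \<in> {0..R} \<Longrightarrow> \<bar>F a - F b\<bar> \<le> e1 + C * \<bar>a - b\<bar>"
        using continuous_modulus[OF continuous_on_subset[OF cF subset_UNIV] e1(1)] by blast
      have qC: "\<bar>q x\<bar> \<le> 2 * e1 + 2 * C * x" if "x \<in> {0..R}" for x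
      proof -
        have "kflux F \<kappa> 0 = F \<kappa>" using \<kappa> F0 by (simp add: kflux_def)
        moreover have "\<bar>kflux F \<kappa> x - kflux F \<kappa> 0\<bar> \<le> 2 * e1 + 2 * C * \<bar>x - 0\<bar>"
          by (rule kflux_modulus[OF C(2,1) \<kappa> that]) (use R in auto)
        ultimately show ?thesis using that unfolding q_def by (simp add: kflux_commute[of F x])
      qed
      \<comment> \<open>The coefficient of \<open>r\<close> in the cutoff error:
        \<open>2 * C\<close> comes from the flux, \<open>L * M\<close> from the time derivative,
        where the slope of the approximating curve multiplies
        \<open>\<bar>E (r z)\<bar> \<le> r z\<close>.\<close>
      define N where "N = 2 * C + L * M"
      have N: "N \<ge> 0" using C(1) L M(1) by (simp add: N_def)
      define e2 where "e2 = e / (6 * Bk * M * (N + 1))"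
      have e2: "e2 > 0" "Bk * M * 3 * (N * e2) \<le> e / 2"
      proof -
        show "e2 > 0" using e Bk(1) M(1) N by (simp add: e2_def)
        have "Bk * M * 3 * (N * (e / (6 * Bk * M * X))) = (e / 2) * (N / X)" if "X > 0" for X
          using Bk(1) M(1) that by (simp add: field_simps)
        from this[of "N + 1"] have "Bk * M * 3 * (N * e2) = (e / 2) * (N / (N + 1))" using N by (simp add: e2_def)
        also have "\<dots> \<le> (e / 2) * 1" using N e by (intro mult_left_mono) auto
        finally show "Bk * M * 3 * (N * e2) \<le> e / 2" by simp
      qed
      obtain \<delta> where \<delta>: "\<delta> > 0" "AE y in lborel. 0 < y \<and> y < \<delta> \<longrightarrow>
        (LINT t|lborel. indicator {0..T} t * r (t, \<xi> t + \<sigma> * y)) < e2"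
        using sep[OF T(1) e2(1)] by blast
      \<comment> \<open>The minimum ensures the two bounds that \<open>strip_estimate\<close> asks
        of the width \<open>3 * \<eta> n\<close>.\<close>
      define \<eta> where "\<eta> n = min 1 (\<delta> / 3) / real (Suc n)" for n
      have \<eta>: "\<eta> n > 0" "3 * \<eta> n \<le> 3" "3 * \<eta> n \<le> \<delta>" for n
      proof -
        have p: "min 1 (\<delta> / 3) > 0" using \<delta>(1) by simp
        then show "\<eta> n > 0" unfolding \<eta>_def by (simp del: of_nat_Suc)
        have "\<eta> n \<le> min 1 (\<delta> / 3) / 1" unfolding \<eta>_def using p by (intro divide_left_mono) auto
        then show "3 * \<eta> n \<le> 3" "3 * \<eta> n \<le> \<delta>" by auto
      qed
      have "\<forall>n. \<exists>z. smooth z \<and> (\<forall>t\<in>{0..T}. \<bar>z t - \<xi> t\<bar> < \<eta> n) \<and> (\<forall>t. \<bar>deriv z t\<bar> \<le> L * M)"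
        using smooth_lipschitz_approx[OF \<xi>(1) M(2) \<eta>(1)] by metis
      then obtain \<zeta> where \<zeta>: "\<And>n. smooth (\<zeta> n)" "\<And>n t. t \<in> {0..T} \<Longrightarrow> \<bar>\<zeta> n t - \<xi> t\<bar> < \<eta> n" "\<And>n t. \<bar>deriv (\<zeta> n) t\<bar> \<le> L * M"
        by metis
      \<comment> \<open>On the side selected by \<open>\<sigma>\<close>,
        \<open>smooth_step (P n z)\<close> is \<open>0\<close> up to distance
        \<open>\<eta> n\<close> from the smooth curve \<open>\<zeta> n\<close> and \<open>1\<close>
        from distance \<open>2 * \<eta> n\<close> on. For times in \<open>{0..T}\<close> the curve
        \<open>\<zeta> n\<close> is within \<open>\<eta> n\<close> of \<open>\<xi>\<close>, so the
        transition takes place at distances between \<open>0\<close> and \<open>3 * \<eta> n\<close>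
        from \<open>\<xi>\<close> itself.\<close>
      define P where "P n z = \<sigma> * (snd z - \<zeta> n (fst z)) / \<eta> n - 1" for n z
      have mz[measurable]: "\<zeta> n \<in> borel_measurable borel" "deriv (\<zeta> n) \<in> borel_measurable borel" for n
        by (intro borel_measurable_continuous_onI smooth_continuous smooth_deriv \<zeta>(1))+
      have mP[measurable]: "P n \<in> borel_measurable borel" for n
        unfolding P_def[abs_def] by measurable
      have pos: "\<eta> n < \<sigma> * (x - \<zeta> n t) \<and> 0 < \<sigma> * (x - \<xi> t)" if "t \<in> {0..T}" "P n (t, x) > 0" for n t x
      proof -
        have "\<eta> n < \<sigma> * (x - \<zeta> n t)" using that(2) \<eta>(1)[of n] by (simp add: P_def field_simps)
        then show ?thesis using \<zeta>(2)[OF that(1), of n] \<sigma> by auto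
      qed
      have bound: "0 \<le> (LINT z|lborel. G z * smooth_step (P n z)) + e" for n
      proof -
        define \<Phi> where "\<Phi> z = g (fst z) * k (snd z) * smooth_step (P n z)" for z
        have ab: "t \<in> {0..T}" if "t \<in> {a..b}" for t using that \<open>0 < a\<close> T(2) by auto
        have sP: "smooth (\<lambda>z. P n z)" unfolding P_def
          by (intro smooth_intros(4,5,6) smooth_intros(1) smooth_intros(2)[OF bounded_linear_snd] smooth_compose[OF \<zeta>(1)] smooth_intros(2)[OF bounded_linear_fst])
        have test: "\<Phi> \<in> test_functions ({0<..} \<times> UNIV)"
          unfolding test_functions_def
        proof (intro CollectI conjI)
          have "smooth \<Phi>" unfolding \<Phi>_def
            by (intro smooth_intros(6) smooth_compose[OF gD(1)] smooth_compose[OF kD(1)] smooth_compose[OF smooth_step] sP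
              smooth_intros(2)[OF bounded_linear_snd] smooth_intros(2)[OF bounded_linear_fst])
          then show "\<forall>k. C_order k \<Phi>" by (simp add: smooth_def)
          show "\<exists>K. compact K \<and> K \<subseteq> {0<..} \<times> UNIV \<and> (\<forall>x. x \<notin> K \<longrightarrow> \<Phi> x = 0)"
          proof (intro exI[of _ "{a..b} \<times> {- c..c}"] conjI allI impI)
            show "compact ({a..b} \<times> {- c..c})" by (intro compact_Times compact_Icc)
            show "\<Phi> z = 0" if "z \<notin> {a..b} \<times> {- c..c}" for z
              using that gD(3)[of "fst z"] kD(3)[of "snd z"] by (cases z) (auto simp: \<Phi>_def)
          qed (use \<open>0 < a\<close> in auto)
        qed
        have \<Phi>0: "0 \<le> \<Phi> z" for z using gD(2) kD(2) smooth_step_range by (simp add: \<Phi>_def)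
        have \<Phi>\<xi>: "\<Phi> (t, \<xi> t) = 0" for t
        proof (cases "t \<in> {a..b}")
          case True
          have "P n (t, \<xi> t) \<le> 0" using pos[OF ab[OF True], of n "\<xi> t"] by fastforce
          then show ?thesis by (simp add: \<Phi>_def smooth_step_0)
        qed (simp add: \<Phi>_def gD(3))
        define Z1 where "Z1 z = deriv (\<lambda>s. \<Phi> (s, snd z)) (fst z)" for z
        define Z2 where "Z2 z = deriv (\<lambda>y. \<Phi> (fst z, y)) (snd z)" for z
        let ?H = "\<lambda>z. smooth_step (P n z)" and ?b = "\<lambda>z. smooth_bump (P n z)"
        let ?gk = "\<lambda>z. g (fst z) * k (snd z)"
        have Z1: "Z1 z = ?H z * (deriv g (fst z) * k (snd z)) + (- \<sigma> * deriv (\<zeta> n) (fst z) / \<eta> n * ?b z) * ?gk z" for z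
        proof -
          have "((\<lambda>s. P n (s, snd z)) has_real_derivative - \<sigma> * deriv (\<zeta> n) (fst z) / \<eta> n) (at (fst z))"
            unfolding P_def using \<eta>(1)[of n]
            by (auto intro!: derivative_eq_intros smooth_has_deriv[OF \<zeta>(1)] simp: field_simps)
          from DERIV_mult[OF DERIV_cmult_right[OF gD(4)[of "fst z"], of "k (snd z)"] DERIV_chain2[OF smooth_step_has_deriv this]]
          show ?thesis unfolding Z1_def \<Phi>_def fst_conv snd_conv
            by (subst DERIV_imp_deriv, assumption) (simp add: algebra_simps)
        qed
        have Z2: "Z2 z = ?H z * (g (fst z) * deriv k (snd z)) + (\<sigma> / \<eta> n * ?b z) * ?gk z" for z
        proof -
          have "((\<lambda>y. P n (fst z, y)) has_real_derivative \<sigma> / \<eta> n) (at (snd z))"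
            unfolding P_def using \<eta>(1)[of n]
            by (auto intro!: derivative_eq_intros simp: field_simps)
          from DERIV_mult[OF DERIV_cmult[OF kD(4)[of "snd z"], of "g (fst z)"] DERIV_chain2[OF smooth_step_has_deriv this]]
          show ?thesis unfolding Z2_def \<Phi>_def fst_conv snd_conv
            by (subst DERIV_imp_deriv, assumption) (simp add: algebra_simps)
        qed
        have Hb: "\<bar>?H z\<bar> \<le> 1" for z using smooth_step_range[of "P n z"] by auto
        have s1: "\<bar>\<sigma>\<bar> = 1" using \<sigma> by auto
        have b1: "\<bar>- \<sigma> * deriv (\<zeta> n) t / \<eta> n * ?b z\<bar> \<le> L * M / \<eta> n * M" for t z
        proof -
          have "\<bar>- \<sigma> * deriv (\<zeta> n) t / \<eta> n * ?b z\<bar> = \<bar>deriv (\<zeta> n) t\<bar> / \<eta> n * \<bar>?b z\<bar>"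
            using s1 \<eta>(1)[of n] by (simp add: abs_mult)
          also have "\<dots> \<le> L * M / \<eta> n * M"
            using \<eta>(1)[of n] L M(1) by (intro mult_mono divide_right_mono \<zeta>(3) Mabs) auto
          finally show ?thesis .
        qed
        have b2: "\<bar>\<sigma> / \<eta> n * ?b z\<bar> \<le> 1 / \<eta> n * M" for z
          unfolding abs_mult abs_divide using s1 Mabs \<eta>(1)[of n]
          by (intro mult_mono) auto
        have iZ1: "integrable lborel Z1"
          unfolding Z1
        proof (rule Bochner_Integration.integrable_add)
          show "integrable lborel (\<lambda>z. ?H z * (deriv g (fst z) * k (snd z)))"
            by (rule tens[OF _ Hb gD(6) cutoff_deriv_0[OF g] kD(5,3)]) measurable
          show "integrable lborel (\<lambda>z. (- \<sigma> * deriv (\<zeta> n) (fst z) / \<eta> n * ?b z) * ?gk z)"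
            by (rule tens[OF _ b1 gD(5,3) kD(5,3)]) measurable
        qed
        have iZ2: "integrable lborel Z2"
          unfolding Z2
        proof (rule Bochner_Integration.integrable_add)
          show "integrable lborel (\<lambda>z. ?H z * (g (fst z) * deriv k (snd z)))"
            by (rule tens[OF _ Hb gD(5,3) kD(6) cutoff_deriv_0[OF k]]) measurable
          show "integrable lborel (\<lambda>z. (\<sigma> / \<eta> n * ?b z) * ?gk z)"
            by (rule tens[OF _ b2 gD(5,3) kD(5,3)]) measurable
        qed
        have sPt: "smooth (\<lambda>s. P n (s, x))" "smooth (\<lambda>y. P n (t, y))" for x t
          unfolding P_def fst_conv snd_conv
          by (intro smooth_intros(4,5,6) smooth_intros(1,7) \<zeta>(1))+
        have s\<Phi>: "smooth (\<lambda>s. \<Phi> (s, x))" "smooth (\<lambda>y. \<Phi> (t, y))" for x t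
          unfolding \<Phi>_def fst_conv snd_conv
          by (intro smooth_intros(6) smooth_intros(1) gD(1) kD(1) smooth_compose[OF smooth_step] sPt)+
        \<comment> \<open>With its spatial counterpart \<open>Z20\<close>, this is the identity of
          the constant state \<open>0\<close>, which permits passing from the entropy and its flux
          to \<open>E\<close> and \<open>q\<close>.\<close>
        have Z10: "(LINT z|lborel. Z1 z) = 0"
        proof (subst integral_lborel_prod(2)[OF iZ1])
          have "(LINT t|lborel. Z1 (t, x)) = 0" for x
            unfolding Z1_def fst_conv snd_conv
            by (rule integral_deriv_cutoff[OF smooth_has_deriv[OF s\<Phi>(1)] smooth_continuous[OF smooth_deriv[OF s\<Phi>(1)]], of a b])
              (simp add: \<Phi>_def gD(3))
          then show "(LINT x|lborel. LINT t|lborel. Z1 (t, x)) = 0" by simp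
        qed
        have Z20: "(LINT z|lborel. Z2 z) = 0"
        proof (subst integral_lborel_prod(1)[OF iZ2])
          have "(LINT y|lborel. Z2 (t, y)) = 0" for t
            unfolding Z2_def fst_conv snd_conv
            by (rule integral_deriv_cutoff[OF smooth_has_deriv[OF s\<Phi>(2)] smooth_continuous[OF smooth_deriv[OF s\<Phi>(2)]], of "- c" c])
              (simp add: \<Phi>_def kD(3))
          then show "(LINT t|lborel. LINT y|lborel. Z2 (t, y)) = 0" by simp
        qed
        \<comment> \<open>The cutoff error: the terms in which a derivative falls on the step across
          the curve.\<close>
        define T3 where "T3 z = (\<sigma> * (q (r z) - deriv (\<zeta> n) (fst z) * E (r z)) / \<eta> n * ?b z) * ?gk z" for z
        have E3: "\<bar>\<sigma> * (q (r z) - deriv (\<zeta> n) t * E (r z)) / \<eta> n * ?b z\<bar> \<le> (\<bar>q (r z)\<bar> + (L * M) * r z) / \<eta> n * M" for t z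
        proof -
          have "\<bar>deriv (\<zeta> n) t * E (r z)\<bar> \<le> (L * M) * r z"
            unfolding abs_mult using \<zeta>(3) Eb[OF r(2)] L M(1) by (intro mult_mono) auto
          moreover have "\<bar>\<sigma> * (q (r z) - deriv (\<zeta> n) t * E (r z))\<bar> = \<bar>q (r z) - deriv (\<zeta> n) t * E (r z)\<bar>"
            by (simp add: abs_mult s1)
          ultimately have "\<bar>\<sigma> * (q (r z) - deriv (\<zeta> n) t * E (r z))\<bar> \<le> \<bar>q (r z)\<bar> + (L * M) * r z"
            by linarith
          moreover have "0 \<le> \<bar>q (r z)\<bar> + (L * M) * r z" using calculation by linarith
          ultimately show ?thesis unfolding abs_mult abs_divide
            using Mabs \<eta>(1)[of n] s1 by (intro mult_mono divide_mono) auto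
        qed
        have iT3: "integrable lborel T3"
          unfolding T3_def
        proof (rule tens[OF _ _ gD(5,3) kD(5,3)])
          show "(\<lambda>z. \<sigma> * (q (r z) - deriv (\<zeta> n) (fst z) * E (r z)) / \<eta> n * ?b z) \<in> borel_measurable borel"
            by measurable
          show "\<bar>\<sigma> * (q (r z) - deriv (\<zeta> n) (fst z) * E (r z)) / \<eta> n * ?b z\<bar> \<le> (2 * BQ + (L * M) * R) / \<eta> n * M" for z
            by (rule order_trans[OF E3]) (use qb[OF r(2), of z] r(2)[of z] L M(1) \<eta>(1)[of n] in
              \<open>intro mult_right_mono divide_right_mono add_mono mult_left_mono; auto\<close>)
        qed
        have iGH: "integrable lborel (\<lambda>z. G z * ?H z)"
        proof (rule Bochner_Integration.integrable_bound[OF iG])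
          show "(\<lambda>z. G z * ?H z) \<in> borel_measurable lborel"
            using borel_measurable_integrable[OF iG] by measurable
          have "norm (G z * ?H z) \<le> norm (G z)" for z
            using mult_left_mono[OF Hb[of z], of "\<bar>G z\<bar>"] by (simp add: abs_mult)
          then show "AE z in lborel. norm (G z * ?H z) \<le> norm (G z)" by simp
        qed
        \<comment> \<open>Where \<open>t \<in> {a..b}\<close> and \<open>P n z > 0\<close>, the
          point lies on the side selected by \<open>\<sigma>\<close>, so the sign equals
          \<open>\<sigma>\<close> and \<open>u z = r z\<close>. Elsewhere every term vanishes, since
          \<open>g\<close> and its derivative or the step and its derivative do.\<close>
        have pw: "\<bar>r z - \<kappa>\<bar> * Z1 z + sgn (snd z - \<xi> (fst z)) * kflux f (r z) \<kappa> * Z2 z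
          = (G z * ?H z + T3 z) + (\<kappa> * Z1 z + F \<kappa> * Z2 z)" for z
        proof -
          obtain t x where z: "z = (t, x)" by fastforce
          have rE: "\<bar>r z - \<kappa>\<bar> = E (r z) + \<kappa>" by (simp add: E_def)
          show ?thesis
          proof (cases "t \<in> {a..b} \<and> P n z > 0")
            case True
            then have p: "0 < \<sigma> * (x - \<xi> t)" using pos ab z by blast
            then have sg: "sgn (x - \<xi> t) = \<sigma>" using \<sigma> by auto
            have kq: "\<sigma> * kflux f (r z) \<kappa> = q (r z) + F \<kappa>" by (simp add: q_def kF)
            have ur: "u z = r z" using p by (simp add: u_def z)
            have "sgn (snd z - \<xi> (fst z)) * kflux f (r z) \<kappa> = q (r z) + F \<kappa>" using sg kq by (simp add: z)
            then show ?thesis unfolding rE Z1 Z2 G_def T3_def ur by (simp add: algebra_simps add_divide_distrib diff_divide_distrib)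
          next
            case False
            then consider "t \<notin> {a..b}" | "P n z \<le> 0" by fastforce
            then show ?thesis
            proof cases
              case 1
              then have "g t = 0" "deriv g t = 0" using gD(3) cutoff_deriv_0[OF g] by blast+
              then show ?thesis unfolding Z1 Z2 G_def T3_def by (simp add: z)
            next
              case 2
              then have "?H z = 0" "?b z = 0" by (auto simp: smooth_step_0 smooth_bump_0)
              then show ?thesis unfolding Z1 Z2 G_def T3_def by simp
            qed
          qed
        qed
        let ?S = "\<lambda>z. indicator {0..T} (fst z) * indicator {0<..<3 * \<eta> n} (\<sigma> * (snd z - \<xi> (fst z))) :: real"
        have strip: "integrable lborel (\<lambda>z. ?S z * (2 * e1 + N * r z))"
          "(LINT z|lborel. ?S z * (2 * e1 + N * r z)) \<le> 3 * \<eta> n * (2 * e1 * T + N * e2)"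
          using strip_estimate[OF r c\<xi> \<xi>(2) \<sigma> less_imp_le[OF T(1)] _ \<eta>(2,3) _ N \<delta>(2), where A="2 * e1"] \<eta>(1)[of n] e1(1) by auto
        have T3le: "T3 z \<le> (Bk * M / \<eta> n) * (?S z * (2 * e1 + N * r z))" for z
        proof -
          obtain t x where z: "z = (t, x)" by fastforce
          have nn: "0 \<le> 2 * e1 + N * r z" using e1(1) N r(2)[of z] by auto
          show ?thesis
          proof (cases "g t = 0 \<or> ?b z = 0")
            case True
            then have "T3 z = 0" by (auto simp: T3_def z)
            then show ?thesis using nn Bk(1) M(1) \<eta>(1)[of n] by simp
          next
            case False
            then have t: "t \<in> {a..b}" and Pz: "0 < P n z" "P n z < 1" using gD(3) smooth_bump_0[of "P n z"] by (auto simp: not_le[symmetric])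
            have "\<sigma> * (x - \<zeta> n t) < 2 * \<eta> n" using Pz(2) \<eta>(1)[of n] by (simp add: P_def z field_simps)
            then have "0 < \<sigma> * (x - \<xi> t)" "\<sigma> * (x - \<xi> t) < 3 * \<eta> n"
              using pos[OF ab[OF t], of n x] Pz(1) \<zeta>(2)[OF ab[OF t], of n] \<sigma> z by auto
            then have S1: "?S z = 1" using ab[OF t] by (simp add: z)
            have "T3 z \<le> ((\<bar>q (r z)\<bar> + (L * M) * r z) / \<eta> n * M) * Bk"
              unfolding T3_def by (rule mult_le_of_abs_le[OF E3]) (use Bk(2) gD(2) kD(2) in \<open>simp add: abs_mult\<close>)
            also have "\<dots> \<le> ((2 * e1 + N * r z) / \<eta> n * M) * Bk"
              using qC[OF r(2), of z] Bk(1) M(1) \<eta>(1)[of n]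
              by (intro mult_right_mono divide_right_mono) (auto simp: N_def algebra_simps)
            finally show ?thesis unfolding S1 by (simp add: mult.commute mult.left_commute)
          qed
        qed
        have "(LINT z|lborel. T3 z) \<le> (LINT z|lborel. (Bk * M / \<eta> n) * (?S z * (2 * e1 + N * r z)))"
          by (intro integral_mono iT3 integrable_mult_right strip(1) T3le)
        also have "\<dots> = (Bk * M / \<eta> n) * (LINT z|lborel. ?S z * (2 * e1 + N * r z))" by simp
        also have "\<dots> \<le> (Bk * M / \<eta> n) * (3 * \<eta> n * (2 * e1 * T + N * e2))"
          using Bk(1) M(1) \<eta>(1)[of n] by (intro mult_left_mono strip(2)) auto
        also have "\<dots> = Bk * M * 3 * (2 * e1 * T) + Bk * M * 3 * (N * e2)"
          using \<eta>(1)[of n] by (simp add: field_simps)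
        also have "\<dots> \<le> e" using e1(2) e2(2) by linarith
        finally have T3e: "(LINT z|lborel. T3 z) \<le> e" .
        have "0 \<le> (LINT z|lborel. \<bar>r z - \<kappa>\<bar> * Z1 z + sgn (snd z - \<xi> (fst z)) * kflux f (r z) \<kappa> * Z2 z)"
          unfolding Z1_def Z2_def by (rule ent[OF \<kappa> test \<Phi>0 \<Phi>\<xi>])
        also have "\<dots> = (LINT z|lborel. (G z * ?H z + T3 z) + (\<kappa> * Z1 z + F \<kappa> * Z2 z))"
          by (simp only: pw)
        also have "\<dots> = (LINT z|lborel. G z * ?H z) + (LINT z|lborel. T3 z)"
          using iGH iT3 iZ1 iZ2 Z10 Z20 by simp
        finally show ?thesis using T3e by linarith
      qed
      \<comment> \<open>At times in \<open>{a..b}\<close> the cutoffs tend to \<open>1\<close> on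
        the open side of the curve where \<open>u\<close> may be nonzero; everywhere else
        \<open>G\<close> is \<open>0\<close>.\<close>
      have lim: "(\<lambda>n. LINT z|lborel. G z * smooth_step (P n z)) \<longlonglongrightarrow> (LINT z|lborel. G z)"
      proof (rule integral_dominated_convergence[where w="\<lambda>z. norm (G z)"])
        show "integrable lborel (\<lambda>z. norm (G z))" using iG by (rule integrable_norm)
        show mG: "G \<in> borel_measurable lborel" using iG by (rule borel_measurable_integrable)
        show "(\<lambda>z. G z * smooth_step (P n z)) \<in> borel_measurable lborel" for n
          using mG by measurable
        have "norm (G z * smooth_step (P n z)) \<le> norm (G z)" for z n
          using mult_left_mono[of "\<bar>smooth_step (P n z)\<bar>" 1 "\<bar>G z\<bar>"] smooth_step_range[of "P n z"] by (simp add: abs_mult)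
        then show "AE z in lborel. norm (G z * smooth_step (P n z)) \<le> norm (G z)" for n by simp
        show "AE z in lborel. (\<lambda>n. G z * smooth_step (P n z)) \<longlonglongrightarrow> G z"
        proof (rule AE_I2, rule tendsto_eventually)
          fix z :: "real \<times> real"
          obtain t x where z: "z = (t, x)" by fastforce
          show "\<forall>\<^sub>F n in sequentially. G z * smooth_step (P n z) = G z"
          proof (cases "t \<in> {a..b} \<and> 0 < \<sigma> * (x - \<xi> t)")
            case False
            have "G z = 0"
            proof (cases "t \<in> {a..b}")
              case True
              then have "u z = 0" using False by (simp add: u_def z)
              then show ?thesis by (simp add: G_def E0 q0)
            next
              case False
              then have "g t = 0" "deriv g t = 0" using gD(3) cutoff_deriv_0[OF g] by blast+
              then show ?thesis by (simp add: G_def z)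
            qed
            then show ?thesis by simp
          next
            case True
            then have t: "t \<in> {0..T}" using \<open>0 < a\<close> T(2) by auto
            define w where "w = \<sigma> * (x - \<xi> t)"
            have w: "w > 0" using True by (simp add: w_def)
            obtain m :: nat where m: "real m > 3 / w" using reals_Archimedean2 by blast
            have "smooth_step (P n z) = 1" if "n \<ge> m" for n
            proof -
              have "3 / w < real (Suc n)" using m that by linarith
              then have "3 < w * real (Suc n)" using w by (simp add: field_simps)
              moreover have "\<eta> n * real (Suc n) \<le> 1" unfolding \<eta>_def by (simp del: of_nat_Suc)
              ultimately have "3 * \<eta> n * real (Suc n) < w * real (Suc n)" by linarith
              then have "3 * \<eta> n < w" by (simp del: of_nat_Suc)
              moreover have "\<bar>\<zeta> n t - \<xi> t\<bar> < \<eta> n" by (rule \<zeta>(2)[OF t])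
              ultimately have "2 * \<eta> n \<le> \<sigma> * (x - \<zeta> n t)" using \<sigma> unfolding w_def by auto
              then have "P n z \<ge> 1" using \<eta>(1)[of n] by (simp add: P_def z field_simps)
              then show ?thesis by (rule smooth_step_1)
            qed
            then show ?thesis by (auto simp: eventually_sequentially)
          qed
        qed
      qed
      have "0 \<le> (LINT z|lborel. G z) + e"
        by (rule LIMSEQ_le_const[OF tendsto_add[OF lim tendsto_const]]) (use bound in auto)
      then show "0 \<le> (LINT z|lborel. G z) + e" .
    qed
    have "(LINT z|lborel. \<bar>u z - \<kappa>\<bar> * (deriv g (fst z) * k (snd z)) + kflux F (u z) \<kappa> * (g (fst z) * deriv k (snd z)))
      = (LINT z|lborel. G z + (\<kappa> * (deriv g (fst z) * k (snd z)) + F \<kappa> * (g (fst z) * deriv k (snd z))))"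
      by (intro Bochner_Integration.integral_cong refl) (simp add: G_def E_def q_def algebra_simps)
    also have "\<dots> = (LINT z|lborel. G z)"
      using iG zero by simp
    finally show ?thesis using main by simp
  qed
  then have "kruzhkov R F u"
    unfolding kruzhkov_def using mu u by blast
  then show ?thesis unfolding F_def[abs_def] u_def[abs_def] .
qed

subsection \<open>Borel representatives\<close>

text \<open>Completeness of \<open>lebesgue\<close> makes \<open>F\<close> measurable as soon as it
  agrees almost everywhere with a Borel function. This is the bridge from the definitions, stated
  with \<open>lebesgue\<close>, to Fubini's theorem on \<open>lborel\<close>.\<close>

lemma integral_lebesgue_eq_lborel:
  fixes F G :: "'a::euclidean_space \<Rightarrow> real"
  assumes "AE x in lborel. F x = G x" "G \<in> borel_measurable borel"
  shows "(LINT x|lebesgue. F x) = (LINT x|lborel. G x)"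
proof -
  have G: "G \<in> borel_measurable lebesgue" using assms(2) by (simp add: measurable_completion)
  have ae: "AE x in lebesgue. G x = F x" using AE_completion[OF assms(1)] by (auto elim: eventually_mono)
  have F: "F \<in> borel_measurable lebesgue" by (rule borel_measurable_AE[OF G ae])
  have "(LINT x|lebesgue. F x) = (LINT x|lebesgue. G x)"
    by (rule integral_cong_AE[OF F G]) (use ae in \<open>auto elim: eventually_mono\<close>)
  also have "\<dots> = (LINT x|lborel. G x)"
    by (rule integral_completion) (use assms(2) in simp)
  finally show ?thesis .
qed

lemma AE_lborel_pair:
  fixes P :: "'a::euclidean_space \<times> 'b::euclidean_space \<Rightarrow> bool"
  assumes "AE z in lborel. P z"
  shows "AE x in lborel. AE y in lborel. P (x, y)"
  by (rule lborel_pair.AE_pair) (unfold lborel_prod, rule assms)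

text \<open>Integrability on an exhausting sequence of compact sets makes \<open>\<rho>\<close>, set
  to zero at negative times, a limit of measurable functions, and the completion provides a Borel
  version. Clamping that version to \<open>{0..R}\<close> changes it on a null set only and secures
  the range at every point.\<close>

lemma borel_representative:
  fixes \<rho> :: "real \<Rightarrow> real \<Rightarrow> real"
  assumes loc: "L1_loc_on ({0..} \<times> UNIV) (\<lambda>(t, x). \<rho> t x)"
    and rng: "AE (t, x) in lebesgue_on ({0..} \<times> UNIV). \<rho> t x \<in> {0..R}" and R: "0 \<le> R"
  obtains r where "r \<in> borel_measurable borel" "\<And>z. r z \<in> {0..R}"
    "AE z in lborel. 0 \<le> fst z \<longrightarrow> r z = \<rho> (fst z) (snd z) \<and> \<rho> (fst z) (snd z) \<in> {0..R}"
proof -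
  define K :: "nat \<Rightarrow> (real \<times> real) set" where "K n = {0..real n} \<times> {- real n..real n}" for n
  define \<rho>1 where "\<rho>1 z = indicator ({0..} \<times> UNIV) z * \<rho> (fst z) (snd z)" for z
  have "\<rho>1 \<in> borel_measurable lebesgue"
  proof (rule borel_measurable_LIMSEQ_real)
    show "(\<lambda>z. indicator (K n) z * \<rho> (fst z) (snd z)) \<in> borel_measurable lebesgue" for n
    proof -
      have "compact (K n)" unfolding K_def by (intro compact_Times compact_Icc)
      moreover have "K n \<subseteq> {0..} \<times> UNIV" by (auto simp: K_def)
      ultimately have "set_integrable lebesgue (K n) (\<lambda>(t, x). \<rho> t x)"
        using loc unfolding L1_loc_on_def by blast
      then show ?thesis
        unfolding set_integrable_def by (simp add: borel_measurable_integrable case_prod_unfold)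
    qed
    fix z :: "real \<times> real"
    obtain t x where z: "z = (t, x)" by fastforce
    obtain m :: nat where m: "real m > max \<bar>t\<bar> \<bar>x\<bar>" using reals_Archimedean2 by blast
    show "(\<lambda>n. indicator (K n) z * \<rho> (fst z) (snd z)) \<longlonglongrightarrow> \<rho>1 z"
    proof (rule tendsto_eventually, unfold eventually_sequentially, intro exI[of _ m] allI impI)
      fix n assume "m \<le> n"
      then have "real m \<le> real n" by simp
      then have "z \<in> K n \<longleftrightarrow> z \<in> {0..} \<times> UNIV" using m by (auto simp: K_def z abs_less_iff)
      then show "indicator (K n) z * \<rho> (fst z) (snd z) = \<rho>1 z" by (simp add: \<rho>1_def indicator_def)
    qed
  qed
  then obtain g where g: "g \<in> borel_measurable lborel" "AE z in lborel. \<rho>1 z = g z"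
    using completion_ex_borel_measurable_real by blast
  have S: "({0..} \<times> UNIV :: (real \<times> real) set) \<in> sets lebesgue"
    by (intro sets_completionI_sets) (simp add: closed_Times)
  have "AE z in lebesgue. z \<in> {0..} \<times> UNIV \<longrightarrow> \<rho> (fst z) (snd z) \<in> {0..R}"
    using rng S by (subst (asm) AE_restrict_space_iff) (auto simp: case_prod_unfold)
  then have "AE z in lborel. z \<in> {0..} \<times> UNIV \<longrightarrow> \<rho> (fst z) (snd z) \<in> {0..R}"
    by (simp add: AE_completion_iff)
  with g(2) have ae: "AE z in lborel. 0 \<le> fst z \<longrightarrow> max 0 (min R (g z)) = \<rho> (fst z) (snd z) \<and> \<rho> (fst z) (snd z) \<in> {0..R}"
  proof eventually_elim
    case (elim z)
    then show ?case by (cases z) (auto simp: \<rho>1_def)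
  qed
  show thesis
    by (rule that[of "\<lambda>z. max 0 (min R (g z))"]) (use g(1) R ae in auto)
qed

text \<open>Both partial derivatives are values of the Frechet derivative at fixed vectors, which
  \<open>C_order\<close> makes jointly continuous. Off the compact support, an open set, the
  derivative is zero.\<close>

lemma test_function_partials:
  fixes \<Phi> :: "real \<times> real \<Rightarrow> real"
  assumes "\<Phi> \<in> test_functions U"
  obtains K where "compact K" "K \<subseteq> U"
    "continuous_on UNIV (\<lambda>z. deriv (\<lambda>s. \<Phi> (s, snd z)) (fst z))"
    "continuous_on UNIV (\<lambda>z. deriv (\<lambda>y. \<Phi> (fst z, y)) (snd z))"
    "\<And>z. z \<notin> K \<Longrightarrow> deriv (\<lambda>s. \<Phi> (s, snd z)) (fst z) = 0"
    "\<And>z. z \<notin> K \<Longrightarrow> deriv (\<lambda>y. \<Phi> (fst z, y)) (snd z) = 0"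
proof -
  obtain K where K: "compact K" "K \<subseteq> U" "\<And>x. x \<notin> K \<Longrightarrow> \<Phi> x = 0" and sm: "\<And>k. C_order k \<Phi>"
    using assms unfolding test_functions_def by auto
  let ?D = "\<lambda>z. frechet_derivative \<Phi> (at z)"
  have D: "(\<Phi> has_derivative ?D z) (at z)" for z using C_order_SucD(1)[OF sm[of "Suc 0"]] .
  have lin: "linear (?D z)" for z using has_derivative_bounded_linear[OF D] by (rule bounded_linear.linear)
  have 1: "deriv (\<lambda>s. \<Phi> (s, snd z)) (fst z) = ?D z (1, 0)" for z
  proof -
    have "((\<lambda>s. (s, snd z)) has_derivative (\<lambda>h. (h, 0))) (at (fst z))"
      by (auto intro!: derivative_eq_intros)
    from has_derivative_compose[OF this, of \<Phi> "?D z"] D[of z]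
    have "((\<lambda>s. \<Phi> (s, snd z)) has_derivative (\<lambda>h. ?D z (h, 0))) (at (fst z))" by simp
    moreover have "(\<lambda>h. ?D z (h, 0)) = (*) (?D z (1, 0))"
    proof
      show "?D z (h, 0) = ?D z (1, 0) * h" for h
        using linear_scale[OF lin[of z], of h "(1, 0)"] by simp
    qed
    ultimately have "((\<lambda>s. \<Phi> (s, snd z)) has_real_derivative ?D z (1, 0)) (at (fst z))"
      unfolding has_field_derivative_def by (rule has_derivative_eq_rhs)
    then show ?thesis by (rule DERIV_imp_deriv)
  qed
  have 2: "deriv (\<lambda>y. \<Phi> (fst z, y)) (snd z) = ?D z (0, 1)" for z
  proof -
    have "((\<lambda>s. (fst z, s)) has_derivative (\<lambda>h. (0, h))) (at (snd z))"
      by (auto intro!: derivative_eq_intros)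
    from has_derivative_compose[OF this, of \<Phi> "?D z"] D[of z]
    have "((\<lambda>s. \<Phi> (fst z, s)) has_derivative (\<lambda>h. ?D z (0, h))) (at (snd z))" by simp
    moreover have "(\<lambda>h. ?D z (0, h)) = (*) (?D z (0, 1))"
    proof
      show "?D z (0, h) = ?D z (0, 1) * h" for h
        using linear_scale[OF lin[of z], of h "(0, 1)"] by simp
    qed
    ultimately have "((\<lambda>s. \<Phi> (fst z, s)) has_real_derivative ?D z (0, 1)) (at (snd z))"
      unfolding has_field_derivative_def by (rule has_derivative_eq_rhs)
    then show ?thesis by (rule DERIV_imp_deriv)
  qed
  have cont: "continuous_on UNIV (\<lambda>z. ?D z v)" for v
    using C_order_SucD(2)[OF sm[of "Suc 0"], of v] by simp
  have zero: "?D z v = 0" if "z \<notin> K" for z v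
  proof -
    have "((\<lambda>_. 0) has_derivative ?D z) (at z)"
      by (rule has_derivative_transform_within_open[OF D, of "- K"])
        (use K that in \<open>auto simp: open_Compl compact_imp_closed\<close>)
    then have "?D z = (\<lambda>_. 0)" using has_derivative_unique has_derivative_const by blast
    then show ?thesis by simp
  qed
  show thesis
    by (rule that[OF K(1,2)]) (simp_all add: 1 2 cont zero)
qed

text \<open>Clamping the argument of \<open>f\<close> and freezing \<open>\<xi>\<close> at negative
  times give functions that are continuous on the whole line and unchanged for densities in
  \<open>{0..R}\<close> and for nonnegative times. The rest transfers the entropy inequality and the
  traces from \<open>\<rho>\<close> to its Borel representative.\<close>

lemma well_separated_imp_kruzhkov:
  assumes R: "0 < R" and flux: "hughes_flux R f"
    and sol: "well_separated_entropy_solution R f c \<rho>0 \<rho> \<xi>"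
  obtains r where "r \<in> borel_measurable borel" "\<And>z. r z \<in> {0..R}"
    "AE z in lborel. 0 \<le> fst z \<longrightarrow> r z = \<rho> (fst z) (snd z) \<and> \<rho> (fst z) (snd z) \<in> {0..R}"
    "\<And>\<sigma>. \<sigma> = 1 \<or> \<sigma> = -1 \<Longrightarrow> kruzhkov R (\<lambda>s. \<sigma> * f (max 0 (min R s)))
      (\<lambda>z. if 0 < \<sigma> * (snd z - \<xi> (max 0 (fst z))) then r z else 0)"
proof -
  have es: "entropy_solution R f c \<rho>0 \<rho> \<xi>" and ws: "well_separated \<rho> \<xi>"
    using sol by (auto simp: well_separated_entropy_solution_def)
  have loc: "L1_loc_on ({0..} \<times> UNIV) (\<lambda>(t, x). \<rho> t x)"
    and rng: "AE (t, x) in lebesgue_on ({0..} \<times> UNIV). \<rho> t x \<in> {0..R}"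
    and \<xi>1: "\<And>t. t \<ge> 0 \<Longrightarrow> \<xi> t \<in> {-1<..<1}" and "\<exists>L. L-lipschitz_on {0..} \<xi>"
    and ent: "\<And>\<kappa> \<phi>. \<kappa> \<in> {0..R} \<Longrightarrow> \<phi> \<in> test_functions ({0<..} \<times> UNIV) \<Longrightarrow> (\<forall>z. 0 \<le> \<phi> z) \<Longrightarrow>
        0 \<le> (LINT t:{0<..}|lebesgue. LINT x|lebesgue.
               \<bar>\<rho> t x - \<kappa>\<bar> * deriv (\<lambda>s. \<phi> (s, x)) t
               + sgn (x - \<xi> t) * sgn (\<rho> t x - \<kappa>) * (f (\<rho> t x) - f \<kappa>)
                   * deriv (\<lambda>y. \<phi> (t, y)) x)
             + 2 * (LINT t:{0<..}|lebesgue. f \<kappa> * \<phi> (t, \<xi> t))"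
    using es unfolding entropy_solution_def by blast+
  then obtain L where L: "L-lipschitz_on {0..} \<xi>" by blast
  obtain r where r: "r \<in> borel_measurable borel" "\<And>z. r z \<in> {0..R}"
    "AE z in lborel. 0 \<le> fst z \<longrightarrow> r z = \<rho> (fst z) (snd z) \<and> \<rho> (fst z) (snd z) \<in> {0..R}"
    by (rule borel_representative[OF loc rng less_imp_le[OF R]]) (rule that)
  define \<Xi> where "\<Xi> t = \<xi> (max 0 t)" for t
  define fc where "fc s = f (max 0 (min R s))" for s
  have f: "continuous_on {0..R} f" "f 0 = 0" using flux by (auto simp: hughes_flux_def)
  have fc: "continuous_on UNIV fc" "fc 0 = 0" "\<And>s. s \<in> {0..R} \<Longrightarrow> fc s = f s"
  proof -
    show "continuous_on UNIV fc" unfolding fc_def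
      by (rule continuous_on_compose2[OF f(1)]) (use R in \<open>auto intro!: continuous_intros\<close>)
    show "fc 0 = 0" using R f(2) by (simp add: fc_def)
    show "fc s = f s" if "s \<in> {0..R}" for s using that by (simp add: fc_def)
  qed
  have \<Xi>L: "\<bar>\<Xi> s - \<Xi> t\<bar> \<le> L * \<bar>s - t\<bar>" for s t
  proof -
    have "\<bar>\<Xi> s - \<Xi> t\<bar> \<le> L * \<bar>max 0 s - max 0 t\<bar>"
      using lipschitz_onD[OF L, of "max 0 s" "max 0 t"] by (simp add: \<Xi>_def dist_real_def)
    also have "\<dots> \<le> L * \<bar>s - t\<bar>" using lipschitz_on_nonneg[OF L] by (intro mult_left_mono) auto
    finally show ?thesis .
  qed
  have \<Xi>1: "\<bar>\<Xi> t\<bar> \<le> 1" for t using \<xi>1[of "max 0 t"] by (auto simp: \<Xi>_def)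
  have c\<Xi>: "continuous_on UNIV \<Xi>"
  proof -
    have "L-lipschitz_on UNIV \<Xi>" using \<Xi>L lipschitz_on_nonneg[OF L] by (auto simp: lipschitz_on_def dist_real_def)
    then show ?thesis by (rule lipschitz_on_continuous_on)
  qed
  have mxi[measurable]: "\<Xi> \<in> borel_measurable borel" by (rule borel_measurable_continuous_onI[OF c\<Xi>])
  have mf[measurable]: "(fst :: real \<times> real \<Rightarrow> real) \<in> borel_measurable borel" "(snd :: real \<times> real \<Rightarrow> real) \<in> borel_measurable borel"
    by (intro borel_measurable_continuous_onI continuous_intros)+
  have aex: "AE t in lborel. 0 \<le> t \<longrightarrow> (AE x in lborel. r (t, x) = \<rho> t x \<and> \<rho> t x \<in> {0..R})"
    using AE_lborel_pair[OF r(3)] by eventually_elim simp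
  have ent': "0 \<le> (LINT z|lborel. \<bar>r z - \<kappa>\<bar> * deriv (\<lambda>s. \<Phi> (s, snd z)) (fst z)
        + sgn (snd z - \<Xi> (fst z)) * kflux fc (r z) \<kappa> * deriv (\<lambda>y. \<Phi> (fst z, y)) (snd z))"
    if \<kappa>: "\<kappa> \<in> {0..R}" and \<Phi>: "\<Phi> \<in> test_functions ({0<..} \<times> UNIV)" "\<And>z. 0 \<le> \<Phi> z"
      and \<Phi>0: "\<And>t. 0 < t \<Longrightarrow> \<Phi> (t, \<Xi> t) = 0" for \<kappa> \<Phi>
  proof -
    obtain K where K: "compact K" "K \<subseteq> {0<..} \<times> UNIV"
      "continuous_on UNIV (\<lambda>z. deriv (\<lambda>s. \<Phi> (s, snd z)) (fst z))"
      "continuous_on UNIV (\<lambda>z. deriv (\<lambda>y. \<Phi> (fst z, y)) (snd z))"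
      "\<And>z. z \<notin> K \<Longrightarrow> deriv (\<lambda>s. \<Phi> (s, snd z)) (fst z) = 0"
      "\<And>z. z \<notin> K \<Longrightarrow> deriv (\<lambda>y. \<Phi> (fst z, y)) (snd z) = 0"
      by (rule test_function_partials[OF \<Phi>(1)]) (rule that)
    define I where "I z = \<bar>r z - \<kappa>\<bar> * deriv (\<lambda>s. \<Phi> (s, snd z)) (fst z)
        + (sgn (snd z - \<Xi> (fst z)) * kflux fc (r z) \<kappa>) * deriv (\<lambda>y. \<Phi> (fst z, y)) (snd z)" for z
    obtain B where B: "B \<ge> 0" "\<And>a b. a \<in> {0..R} \<Longrightarrow> b \<in> {0..R} \<Longrightarrow> \<bar>a - b\<bar> \<le> B \<and> \<bar>kflux fc a b\<bar> \<le> B"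
      using flux_bounded[OF fc(1)] by blast
    have iI: "integrable lborel I" unfolding I_def
    proof (intro Bochner_Integration.integrable_add)
      show "integrable lborel (\<lambda>z. \<bar>r z - \<kappa>\<bar> * deriv (\<lambda>s. \<Phi> (s, snd z)) (fst z))"
        by (rule integrable_bounded_times_continuous[of _ B, OF _ _ K(3,1)])
          (use B(2)[OF r(2) \<kappa>] K(5) r(1) in auto)
      show "integrable lborel (\<lambda>z. (sgn (snd z - \<Xi> (fst z)) * kflux fc (r z) \<kappa>) * deriv (\<lambda>y. \<Phi> (fst z, y)) (snd z))"
      proof (rule integrable_bounded_times_continuous[of _ B, OF _ _ K(4,1)])
        have [measurable]: "(\<lambda>z. kflux fc (r z) \<kappa>) \<in> borel_measurable borel"
          by (rule kflux_measurable[OF fc(1) r(1)]) simp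
        show "(\<lambda>z. sgn (snd z - \<Xi> (fst z)) * kflux fc (r z) \<kappa>) \<in> borel_measurable borel"
          unfolding sgn_if by measurable
        show "\<bar>sgn (snd z - \<Xi> (fst z)) * kflux fc (r z) \<kappa>\<bar> \<le> B" for z
          using B(1) B(2)[OF r(2)[of z] \<kappa>] by (auto simp: sgn_if abs_mult)
      qed (simp add: K(6))
    qed
    have I0: "I z = 0" if "fst z \<le> 0" for z
    proof -
      have "z \<notin> K" using K(2) that by (cases z) auto
      then show ?thesis by (simp add: I_def K(5,6))
    qed
    have mI: "(\<lambda>x. I (t, x)) \<in> borel_measurable borel" for t
    proof -
      have "(\<lambda>x. (t, x)) \<in> borel \<rightarrow>\<^sub>M (borel :: (real \<times> real) measure)"
        by (intro borel_measurable_continuous_onI continuous_intros)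
      from measurable_compose[OF this] show ?thesis using borel_measurable_integrable[OF iI] by simp
    qed
    \<comment> \<open>The source on the curve meets a test function that vanishes there.\<close>
    have "(LINT t:{0<..}|lebesgue. f \<kappa> * \<Phi> (t, \<xi> t)) = 0"
    proof -
      have "indicator {0<..} t *\<^sub>R (f \<kappa> * \<Phi> (t, \<xi> t)) = 0" for t
        using \<Phi>0[of t] by (auto simp: indicator_def \<Xi>_def)
      then show ?thesis unfolding set_lebesgue_integral_def by (simp only: integral_zero)
    qed
    moreover have i2: "(LINT t:{0<..}|lebesgue. LINT x|lebesgue.
               \<bar>\<rho> t x - \<kappa>\<bar> * deriv (\<lambda>s. \<Phi> (s, x)) t
               + sgn (x - \<xi> t) * sgn (\<rho> t x - \<kappa>) * (f (\<rho> t x) - f \<kappa>) * deriv (\<lambda>y. \<Phi> (t, y)) x)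
        = (LINT t|lborel. LINT x|lborel. I (t, x))"
      unfolding set_lebesgue_integral_def
    proof (rule integral_lebesgue_eq_lborel)
      show "(\<lambda>t. LINT x|lborel. I (t, x)) \<in> borel_measurable borel"
        using borel_measurable_integrable[OF integral_lborel_prod(4)[OF iI]] by simp
      show "AE t in lborel. indicator {0<..} t *\<^sub>R (LINT x|lebesgue.
               \<bar>\<rho> t x - \<kappa>\<bar> * deriv (\<lambda>s. \<Phi> (s, x)) t
               + sgn (x - \<xi> t) * sgn (\<rho> t x - \<kappa>) * (f (\<rho> t x) - f \<kappa>) * deriv (\<lambda>y. \<Phi> (t, y)) x)
         = (LINT x|lborel. I (t, x))"
        using aex
      proof eventually_elim
        case (elim t)
        show ?case
        proof (cases "0 < t")
          case False
          then show ?thesis by (simp add: I0)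
        next
          case True
          have "AE x in lborel. r (t, x) = \<rho> t x \<and> \<rho> t x \<in> {0..R}" using elim True by simp
          then have "AE x in lborel. \<bar>\<rho> t x - \<kappa>\<bar> * deriv (\<lambda>s. \<Phi> (s, x)) t
               + sgn (x - \<xi> t) * sgn (\<rho> t x - \<kappa>) * (f (\<rho> t x) - f \<kappa>) * deriv (\<lambda>y. \<Phi> (t, y)) x = I (t, x)"
          proof eventually_elim
            case (elim x)
            then show ?case using True fc(3) \<kappa> by (simp add: I_def kflux_sgn \<Xi>_def)
          qed
          from integral_lebesgue_eq_lborel[OF this mI] show ?thesis using True by simp
        qed
      qed
    qed
    ultimately have "0 \<le> (LINT t|lborel. LINT x|lborel. I (t, x))"
      using ent[OF \<kappa> \<Phi>(1)] \<Phi>(2) by auto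
    then show ?thesis using integral_lborel_prod(1)[OF iI] by (simp add: I_def)
  qed
  obtain N where N0: "\<And>z. z \<in> space lborel - N \<Longrightarrow> 0 \<le> fst z \<longrightarrow> r z = \<rho> (fst z) (snd z) \<and> \<rho> (fst z) (snd z) \<in> {0..R}"
    and N2: "N \<in> null_sets lborel"
    by (rule AE_E3[OF r(3)]) (rule that)
  have N1: "r z = \<rho> (fst z) (snd z)" if "z \<notin> N" "0 \<le> fst z" for z
    using N0[of z] that by simp
  have sep: "\<exists>\<delta>>0. AE y in lborel. 0 < y \<and> y < \<delta> \<longrightarrow> (LINT t|lborel. indicator {0..T} t * r (t, \<Xi> t + \<sigma> * y)) < e"
    if T: "0 < T" and e: "0 < e" and \<sigma>: "\<sigma> = 1 \<or> \<sigma> = -1" for T e \<sigma> :: real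
  proof -
    have "ess_tendsto_right_0 (\<lambda>y. LINT t:{0..T}|lebesgue. \<rho> t (\<xi> t + \<sigma> * y)) 0"
      using ws T \<sigma> unfolding well_separated_def by auto
    then obtain \<delta> where \<delta>: "\<delta> > 0" "AE y in lebesgue. 0 < y \<and> y < \<delta> \<longrightarrow> \<bar>(LINT t:{0..T}|lebesgue. \<rho> t (\<xi> t + \<sigma> * y)) - 0\<bar> < e"
      using e unfolding ess_tendsto_right_0_def by blast
    have aey: "AE y in lborel. 0 < y \<and> y < \<delta> \<longrightarrow> \<bar>(LINT t:{0..T}|lebesgue. \<rho> t (\<xi> t + \<sigma> * y))\<bar> < e"
      using \<delta>(2) by (simp add: AE_completion_iff)
    have mT: "(\<lambda>z::real \<times> real. (fst z, \<Xi> (fst z) + \<sigma> * snd z)) \<in> borel \<rightarrow>\<^sub>M borel"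
      by (intro borel_measurable_continuous_onI continuous_intros continuous_on_compose2[OF c\<Xi>]) auto
    have Nb: "N \<in> sets borel" using null_setsD2[OF N2] by simp
    have "AE z in lborel. z \<notin> N" by (rule AE_not_in[OF N2])
    \<comment> \<open>For fixed \<open>t\<close> the affine map from \<open>y\<close> to
      \<open>\<Xi> t + \<sigma> * y\<close> preserves null sets. Exchanging the quantifiers, which
      the Borel set \<open>N\<close> makes possible, shows that for almost every fixed
      \<open>y\<close> the shifted curve avoids \<open>N\<close> at almost every time, so
      \<open>r\<close> may replace \<open>\<rho>\<close> along it.\<close>
    from AE_lborel_pair[OF this] have "AE t in lborel. AE y in lborel. (t, \<Xi> t + \<sigma> * y) \<notin> N"
    proof eventually_elim
      case (elim t)
      have "(\<lambda>x. (t, x)) \<in> borel \<rightarrow>\<^sub>M (borel :: (real \<times> real) measure)"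
        by (intro borel_measurable_continuous_onI continuous_intros)
      from measurable_sets[OF this Nb]
      have "Measurable.pred borel (\<lambda>x. (t, x) \<in> N)" by (simp add: pred_def vimage_def)
      then have "Measurable.pred borel (\<lambda>x. (t, x) \<notin> N)" by simp
      from AE_borel_affine[OF _ this elim, of \<sigma> "\<Xi> t"] show ?case using \<sigma> by auto
    qed
    then have "AE y in lborel. AE t in lborel. (t, \<Xi> t + \<sigma> * y) \<notin> N"
    proof (subst (asm) lborel_pair.AE_commute)
      have "(\<lambda>z::real \<times> real. (fst z, \<Xi> (fst z) + \<sigma> * snd z)) -` (- N) \<inter> space borel \<in> sets borel"
        by (rule measurable_sets[OF mT]) (use Nb in auto)
      then show "{z \<in> space (lborel \<Otimes>\<^sub>M lborel). (fst z, \<Xi> (fst z) + \<sigma> * snd z) \<notin> N} \<in> sets (lborel \<Otimes>\<^sub>M lborel)"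
        unfolding lborel_prod by (simp add: vimage_def)
    qed
    with aey have "AE y in lborel. 0 < y \<and> y < \<delta> \<longrightarrow> (LINT t|lborel. indicator {0..T} t * r (t, \<Xi> t + \<sigma> * y)) < e"
    proof eventually_elim
      case (elim y)
      have "(\<lambda>t. (t, \<Xi> t + \<sigma> * y)) \<in> borel \<rightarrow>\<^sub>M borel"
        by (intro borel_measurable_continuous_onI continuous_intros c\<Xi>)
      from measurable_compose[OF this r(1)] have [measurable]: "(\<lambda>t. r (t, \<Xi> t + \<sigma> * y)) \<in> borel_measurable borel" .
      have "(LINT t:{0..T}|lebesgue. \<rho> t (\<xi> t + \<sigma> * y)) = (LINT t|lborel. indicator {0..T} t * r (t, \<Xi> t + \<sigma> * y))"
        unfolding set_lebesgue_integral_def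
      proof (rule integral_lebesgue_eq_lborel)
        show "AE t in lborel. indicator {0..T} t *\<^sub>R \<rho> t (\<xi> t + \<sigma> * y) = indicator {0..T} t * r (t, \<Xi> t + \<sigma> * y)"
          using elim(2)
        proof eventually_elim
          case (elim t)
          then show ?case using N1[of "(t, \<Xi> t + \<sigma> * y)"] by (auto simp: indicator_def \<Xi>_def)
        qed
      qed measurable
      then show ?case using elim(1) by auto
    qed
    then show ?thesis using \<delta>(1) by blast
  qed
  show thesis
  proof (rule that[OF r])
    fix \<sigma> :: real assume \<sigma>: "\<sigma> = 1 \<or> \<sigma> = -1"
    show "kruzhkov R (\<lambda>s. \<sigma> * f (max 0 (min R s))) (\<lambda>z. if 0 < \<sigma> * (snd z - \<xi> (max 0 (fst z))) then r z else 0)"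
      using one_sided_kruzhkov[OF r(1,2) fc(1,2) \<sigma> \<Xi>L \<Xi>1 ent' sep[OF _ _ \<sigma>]] unfolding fc_def \<Xi>_def by blast
  qed
qed

subsection \<open>The balance equation\<close>

text \<open>A nonzero value would persist, by continuity, on an interval to the right of
  \<open>t\<close>, which lies in positive times and has positive measure. Looking to the right is
  what includes \<open>t = 0\<close>.\<close>

lemma continuous_AE_zero:
  fixes g :: "real \<Rightarrow> real"
  assumes g: "continuous_on {0..} g" "AE t in lborel. 0 < t \<longrightarrow> g t = 0" and "0 \<le> t"
  shows "g t = 0"
proof (rule ccontr)
  assume ne: "g t \<noteq> 0"
  then obtain d where d: "d > 0" "\<And>s. s \<in> {0..} \<Longrightarrow> dist s t < d \<Longrightarrow> dist (g s) (g t) < \<bar>g t\<bar>"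
    using g(1) \<open>0 \<le> t\<close> unfolding continuous_on_iff by (metis atLeast_iff zero_less_abs_iff)
  have "g s \<noteq> 0" if "s \<in> {t<..<t + d}" for s
    using d(2)[of s] that \<open>0 \<le> t\<close> by (auto simp: dist_real_def)
  then have "AE s in lborel. s \<notin> {t<..<t + d}"
    using g(2) \<open>0 \<le> t\<close> by (auto elim!: eventually_mono)
  then have "emeasure lborel {t<..<t + d} = 0"
    by (subst (asm) AE_iff_null_sets[symmetric]) auto
  then show False using d(1) by simp
qed

lemma continuous_L1D:
  assumes "continuous_L1 \<rho>" "0 \<le> t"
  shows "integrable lebesgue (\<rho> t)"
    "((\<lambda>s. LINT x|lebesgue. \<bar>\<rho> s x - \<rho> t x\<bar>) \<longlongrightarrow> 0) (at t within {0..})"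
  using assms by (auto simp: continuous_L1_def)

lemma integrable_cut:
  fixes \<phi> h :: "real \<Rightarrow> real"
  assumes "\<phi> \<in> borel_measurable lebesgue" "\<And>x. \<bar>\<phi> x\<bar> \<le> 1" "integrable lebesgue h"
  shows "integrable lebesgue (\<lambda>x. \<phi> x * h x)"
proof (rule Bochner_Integration.integrable_bound[OF assms(3)])
  show "(\<lambda>x. \<phi> x * h x) \<in> borel_measurable lebesgue"
    using assms(1) borel_measurable_integrable[OF assms(3)] by measurable
  have "norm (\<phi> x * h x) \<le> norm (h x)" for x
    using mult_right_mono[OF assms(2)[of x], of "\<bar>h x\<bar>"] by (simp add: abs_mult)
  then show "AE x in lebesgue. norm (\<phi> x * h x) \<le> norm (h x)" by simp
qed

text \<open>In the splitting \<open>\<phi> s * (\<rho> s - \<rho> t) + (\<phi> s - \<phi> t) *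
  \<rho> t\<close> the first term is controlled by continuity in L1, the second by dominated
  convergence with bound \<open>\<bar>\<rho> t\<bar>\<close>. The factor \<open>\<phi>\<close> is
  the indicator of a region bounded by the moving curve, hence depends on time.\<close>

lemma cut_tendsto:
  fixes \<phi> \<rho> :: "real \<Rightarrow> real \<Rightarrow> real"
  assumes \<rho>: "continuous_L1 \<rho>" and t: "0 \<le> t" and m: "\<And>s. \<phi> s \<in> borel_measurable lebesgue"
    and b: "\<And>s x. 0 \<le> \<phi> s x \<and> \<phi> s x \<le> 1"
    and lim: "AE x in lebesgue. ((\<lambda>s. \<phi> s x) \<longlongrightarrow> \<phi> t x) (at t within {0..})"
  shows "((\<lambda>s. LINT x|lebesgue. \<bar>\<phi> s x * \<rho> s x - \<phi> t x * \<rho> t x\<bar>) \<longlongrightarrow> 0) (at t within {0..})"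
proof -
  note it = continuous_L1D(1)[OF \<rho>]
  have ab: "\<bar>\<phi> s x\<bar> \<le> 1" "\<bar>\<phi> s x - \<phi> t x\<bar> \<le> 1" for s x using b[of s x] b[of t x] by auto
  have m2: "(\<lambda>x. \<phi> s x - \<phi> t x) \<in> borel_measurable lebesgue" for s using m[of s] m[of t] by measurable
  have lim2: "((\<lambda>s. LINT x|lebesgue. \<bar>(\<phi> s x - \<phi> t x) * \<rho> t x\<bar>) \<longlongrightarrow> 0) (at t within {0..})"
    \<comment> \<open>Dominated convergence is available along sequences of times.\<close>
    unfolding tendsto_at_iff_sequentially comp_def
  proof (intro allI impI)
    fix X :: "nat \<Rightarrow> real" assume X: "\<forall>i. X i \<in> {0..} - {t}" "X \<longlonglongrightarrow> t"
    have Xl: "filterlim X (at t within {0..}) sequentially"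
      using X by (auto simp: filterlim_at)
    have "(\<lambda>i. LINT x|lebesgue. \<bar>(\<phi> (X i) x - \<phi> t x) * \<rho> t x\<bar>) \<longlonglongrightarrow> (LINT x|(lebesgue :: real measure). 0)"
    proof (rule integral_dominated_convergence[where w="\<lambda>x. \<bar>\<rho> t x\<bar>"])
      show "integrable lebesgue (\<lambda>x. \<bar>\<rho> t x\<bar>)" using it[OF t] by simp
      show "(\<lambda>x. \<bar>(\<phi> (X i) x - \<phi> t x) * \<rho> t x\<bar>) \<in> borel_measurable lebesgue" for i
        using m2 borel_measurable_integrable[OF it[OF t]] by measurable
      show "AE x in lebesgue. (\<lambda>i. \<bar>(\<phi> (X i) x - \<phi> t x) * \<rho> t x\<bar>) \<longlonglongrightarrow> 0"
        using lim
      proof eventually_elim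
        case (elim x)
        have "(\<lambda>i. \<phi> (X i) x) \<longlonglongrightarrow> \<phi> t x" by (rule filterlim_compose[OF elim Xl])
        then have "(\<lambda>i. \<bar>(\<phi> (X i) x - \<phi> t x) * \<rho> t x\<bar>) \<longlonglongrightarrow> \<bar>(\<phi> t x - \<phi> t x) * \<rho> t x\<bar>"
          by (intro tendsto_intros)
        then show ?case by simp
      qed
      show "AE x in lebesgue. norm \<bar>(\<phi> (X i) x - \<phi> t x) * \<rho> t x\<bar> \<le> \<bar>\<rho> t x\<bar>" for i
        using mult_right_mono[OF ab(2), of "\<bar>\<rho> t x\<bar>" for x] by (intro AE_I2) (simp add: abs_mult)
    qed simp
    then show "(\<lambda>i. LINT x|lebesgue. \<bar>(\<phi> (X i) x - \<phi> t x) * \<rho> t x\<bar>) \<longlonglongrightarrow> 0" by simp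
  qed
  have up: "((\<lambda>s. (LINT x|lebesgue. \<bar>\<rho> s x - \<rho> t x\<bar>) + (LINT x|lebesgue. \<bar>(\<phi> s x - \<phi> t x) * \<rho> t x\<bar>)) \<longlongrightarrow> 0) (at t within {0..})"
    using tendsto_add[OF continuous_L1D(2)[OF \<rho> t] lim2] by simp
  show ?thesis
  proof (rule tendsto_sandwich[OF _ _ tendsto_const up])
    show "\<forall>\<^sub>F s in at t within {0..}. 0 \<le> (LINT x|lebesgue. \<bar>\<phi> s x * \<rho> s x - \<phi> t x * \<rho> t x\<bar>)"
      by (intro always_eventually allI integral_nonneg_AE) auto
    have "(LINT x|lebesgue. \<bar>\<phi> s x * \<rho> s x - \<phi> t x * \<rho> t x\<bar>) \<le>
      (LINT x|lebesgue. \<bar>\<rho> s x - \<rho> t x\<bar>) + (LINT x|lebesgue. \<bar>(\<phi> s x - \<phi> t x) * \<rho> t x\<bar>)" if s: "0 \<le> s" for s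
    proof -
      have i: "integrable lebesgue (\<lambda>x. \<bar>\<phi> s x * \<rho> s x - \<phi> t x * \<rho> t x\<bar>)"
        by (intro integrable_abs Bochner_Integration.integrable_diff integrable_cut m ab(1) it s t)
      have i1: "integrable lebesgue (\<lambda>x. \<bar>\<rho> s x - \<rho> t x\<bar>)"
        by (intro integrable_abs Bochner_Integration.integrable_diff it s t)
      have i2: "integrable lebesgue (\<lambda>x. \<bar>(\<phi> s x - \<phi> t x) * \<rho> t x\<bar>)"
        by (intro integrable_abs integrable_cut m2 ab(2) it t)
      have "\<bar>\<phi> s x * \<rho> s x - \<phi> t x * \<rho> t x\<bar> \<le> \<bar>\<rho> s x - \<rho> t x\<bar> + \<bar>(\<phi> s x - \<phi> t x) * \<rho> t x\<bar>" for x
      proof -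
        have "\<phi> s x * \<rho> s x - \<phi> t x * \<rho> t x = \<phi> s x * (\<rho> s x - \<rho> t x) + (\<phi> s x - \<phi> t x) * \<rho> t x"
          by (simp add: algebra_simps)
        moreover have "\<bar>\<phi> s x * (\<rho> s x - \<rho> t x)\<bar> \<le> \<bar>\<rho> s x - \<rho> t x\<bar>"
          using mult_right_mono[OF ab(1)[of s x], of "\<bar>\<rho> s x - \<rho> t x\<bar>"] by (simp add: abs_mult)
        ultimately show ?thesis by linarith
      qed
      then have "(LINT x|lebesgue. \<bar>\<phi> s x * \<rho> s x - \<phi> t x * \<rho> t x\<bar>) \<le>
        (LINT x|lebesgue. \<bar>\<rho> s x - \<rho> t x\<bar> + \<bar>(\<phi> s x - \<phi> t x) * \<rho> t x\<bar>)"
        by (intro integral_mono i Bochner_Integration.integrable_add i1 i2)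
      then show ?thesis using i1 i2 by simp
    qed
    then show "\<forall>\<^sub>F s in at t within {0..}. (LINT x|lebesgue. \<bar>\<phi> s x * \<rho> s x - \<phi> t x * \<rho> t x\<bar>) \<le>
      (LINT x|lebesgue. \<bar>\<rho> s x - \<rho> t x\<bar>) + (LINT x|lebesgue. \<bar>(\<phi> s x - \<phi> t x) * \<rho> t x\<bar>)"
      by (auto simp: eventually_at_filter)
  qed
qed

lemma cut_integral_continuous:
  fixes \<phi> \<rho> :: "real \<Rightarrow> real \<Rightarrow> real"
  assumes \<rho>: "continuous_L1 \<rho>" and m: "\<And>s. \<phi> s \<in> borel_measurable lebesgue"
    and b: "\<And>s x. 0 \<le> \<phi> s x \<and> \<phi> s x \<le> 1"
    and lim: "\<And>t. 0 \<le> t \<Longrightarrow> AE x in lebesgue. ((\<lambda>s. \<phi> s x) \<longlongrightarrow> \<phi> t x) (at t within {0..})"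
  shows "continuous_on {0..} (\<lambda>t. LINT x|lebesgue. \<phi> t x * \<rho> t x)"
  unfolding continuous_on
proof
  fix t :: real assume "t \<in> {0..}"
  then have t: "0 \<le> t" by simp
  have ab: "\<bar>\<phi> s x\<bar> \<le> 1" for s x using b[of s x] by auto
  have i: "integrable lebesgue (\<lambda>x. \<phi> s x * \<rho> s x)" if "0 \<le> s" for s
    by (intro integrable_cut m ab continuous_L1D(1)[OF \<rho> that])
  have "((\<lambda>s. (LINT x|lebesgue. \<phi> s x * \<rho> s x) - (LINT x|lebesgue. \<phi> t x * \<rho> t x)) \<longlongrightarrow> 0) (at t within {0..})"
  proof (rule Lim_null_comparison[OF _ cut_tendsto[OF \<rho> t m b lim[OF t]]])
    have "norm ((LINT x|lebesgue. \<phi> s x * \<rho> s x) - (LINT x|lebesgue. \<phi> t x * \<rho> t x)) \<le> (LINT x|lebesgue. \<bar>\<phi> s x * \<rho> s x - \<phi> t x * \<rho> t x\<bar>)"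
      if "0 \<le> s" for s
      using integral_norm_bound[of lebesgue "\<lambda>x. \<phi> s x * \<rho> s x - \<phi> t x * \<rho> t x"] i[OF that] i[OF t] by simp
    then show "\<forall>\<^sub>F s in at t within {0..}. norm ((LINT x|lebesgue. \<phi> s x * \<rho> s x) - (LINT x|lebesgue. \<phi> t x * \<rho> t x)) \<le> (LINT x|lebesgue. \<bar>\<phi> s x * \<rho> s x - \<phi> t x * \<rho> t x\<bar>)"
      by (auto simp: eventually_at_filter)
  qed
  then show "((\<lambda>t. LINT x|lebesgue. \<phi> t x * \<rho> t x) \<longlongrightarrow> (LINT x|lebesgue. \<phi> t x * \<rho> t x)) (at t within {0..})"
    by (rule Lim_null[THEN iffD2])
qed

text \<open>For \<open>x \<noteq> \<xi> t\<close> the side of the curve on which \<open>x\<close>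
  lies is the same for all times near \<open>t\<close>, so each indicator is eventually constant;
  the one remaining point is a null set.\<close>

lemma cut_limits:
  assumes \<xi>: "continuous_on {0..} \<xi>" and "0 \<le> (t::real)" and \<sigma>: "\<sigma> = 1 \<or> \<sigma> = (-1::real)"
  shows "AE x in lebesgue. ((\<lambda>s. indicator {0<..} (\<sigma> * (x - \<xi> s)) :: real) \<longlongrightarrow> indicator {0<..} (\<sigma> * (x - \<xi> t))) (at t within {0..})"
    and "AE x in lebesgue. ((\<lambda>s. indicator {-1..\<xi> s} x :: real) \<longlongrightarrow> indicator {-1..\<xi> t} x) (at t within {0..})"
    and "AE x in lebesgue. ((\<lambda>s. indicator {\<xi> s..1} x :: real) \<longlongrightarrow> indicator {\<xi> t..1} x) (at t within {0..})"
proof -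
  have lim: "(\<xi> \<longlongrightarrow> \<xi> t) (at t within {0..})" using \<xi> \<open>0 \<le> t\<close> by (auto simp: continuous_on)
  have ne: "AE x in lebesgue. x \<noteq> \<xi> t" by (rule AE_completion[OF AE_lborel_singleton])
  have ev: "\<forall>\<^sub>F s in at t within {0..}. (x < \<xi> s \<longleftrightarrow> x < \<xi> t) \<and> (\<xi> s < x \<longleftrightarrow> \<xi> t < x)" if "x \<noteq> \<xi> t" for x
  proof (cases "x < \<xi> t")
    case True
    show ?thesis using order_tendstoD(1)[OF lim True] by eventually_elim (use True in auto)
  next
    case False
    then have "\<xi> t < x" using that by simp
    from order_tendstoD(2)[OF lim this] show ?thesis by eventually_elim (use False that in auto)
  qed
  show "AE x in lebesgue. ((\<lambda>s. indicator {0<..} (\<sigma> * (x - \<xi> s)) :: real) \<longlongrightarrow> indicator {0<..} (\<sigma> * (x - \<xi> t))) (at t within {0..})"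
    using ne
  proof eventually_elim
    case (elim x)
    show ?case
      by (rule tendsto_eventually, use ev[OF elim] in eventually_elim) (use \<sigma> in \<open>auto simp: indicator_def\<close>)
  qed
  show "AE x in lebesgue. ((\<lambda>s. indicator {-1..\<xi> s} x :: real) \<longlongrightarrow> indicator {-1..\<xi> t} x) (at t within {0..})"
    using ne
  proof eventually_elim
    case (elim x)
    show ?case
      by (rule tendsto_eventually, use ev[OF elim] in eventually_elim) (auto simp: indicator_def not_less[symmetric])
  qed
  show "AE x in lebesgue. ((\<lambda>s. indicator {\<xi> s..1} x :: real) \<longlongrightarrow> indicator {\<xi> t..1} x) (at t within {0..})"
    using ne
  proof eventually_elim
    case (elim x)
    show ?case
      by (rule tendsto_eventually, use ev[OF elim] in eventually_elim) (auto simp: indicator_def not_less[symmetric])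
  qed
qed

lemma cut_measurable:
  "(\<lambda>x. indicator {0<..} (\<sigma> * (x - c)) :: real) \<in> borel_measurable lebesgue"
  "(\<lambda>x. indicator {a..b} x :: real) \<in> borel_measurable lebesgue" for a b c \<sigma> :: real
  by (rule measurable_completion, measurable)+

lemma integral_lebesgue_Icc:
  "integrable lebesgue (indicator {a..b::real} :: real \<Rightarrow> real)"
  "a \<le> b \<Longrightarrow> (LINT x|lebesgue. indicator {a..b} x :: real) = b - a"
proof -
  have i: "integrable lborel (indicator {a..b::real} :: real \<Rightarrow> real)"
    by (intro integrable_real_indicator) (auto simp: emeasure_lborel_Icc_eq)
  show "integrable lebesgue (indicator {a..b::real} :: real \<Rightarrow> real)"
    by (subst integrable_completion) (use i in auto)
  show "(LINT x|lebesgue. indicator {a..b} x :: real) = b - a" if "a \<le> b"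
    by (subst integral_completion) (use that in auto)
qed

lemma affine_cost_integral:
  assumes h: "integrable lebesgue h" and "a \<le> b"
  shows "set_integrable lebesgue {a..b} (\<lambda>y. affine_cost \<alpha> (h y))"
    "(LINT y:{a..b}|lebesgue. affine_cost \<alpha> (h y)) = (b - a) + \<alpha> * (LINT y|lebesgue. indicator {a..b} y * h y)"
proof -
  have i: "integrable lebesgue (\<lambda>y. indicator {a..b} y * h y)"
    by (rule integrable_cut[OF cut_measurable(2) _ h]) (simp add: indicator_def)
  have eq: "indicator {a..b} y *\<^sub>R affine_cost \<alpha> (h y) = indicator {a..b} y + \<alpha> * (indicator {a..b} y * h y)" for y
    by (simp add: affine_cost_def algebra_simps)
  show "set_integrable lebesgue {a..b} (\<lambda>y. affine_cost \<alpha> (h y))"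
    unfolding set_integrable_def eq using i integral_lebesgue_Icc(1) by simp
  show "(LINT y:{a..b}|lebesgue. affine_cost \<alpha> (h y)) = (b - a) + \<alpha> * (LINT y|lebesgue. indicator {a..b} y * h y)"
    unfolding set_lebesgue_integral_def eq using i integral_lebesgue_Icc assms(2) by simp
qed

text \<open>The defect of the balance is continuous in time and vanishes at almost every positive
  time. The instance that matters for stability is \<open>t = 0\<close>, where the two initial
  turning points are compared.\<close>

lemma balance_all_times:
  assumes \<rho>: "continuous_L1 \<rho>" and \<xi>: "continuous_on {0..} \<xi>" "\<And>t. 0 \<le> t \<Longrightarrow> \<xi> t \<in> {-1<..<1}"
    and bal: "AE t in lebesgue_on {0<..}.
      (LINT y:{-1..\<xi> t}|lebesgue. affine_cost \<alpha> (\<rho> t y)) = (LINT y:{\<xi> t..1}|lebesgue. affine_cost \<alpha> (\<rho> t y))"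
    and t: "0 \<le> t"
  shows "(LINT y:{-1..\<xi> t}|lebesgue. affine_cost \<alpha> (\<rho> t y)) = (LINT y:{\<xi> t..1}|lebesgue. affine_cost \<alpha> (\<rho> t y))"
proof -
  \<comment> \<open>The constant part of the costs contributes
    \<open>(\<xi> t + 1) - (1 - \<xi> t) = 2 * \<xi> t\<close>.\<close>
  define G where "G t = 2 * \<xi> t + \<alpha> * (LINT y|lebesgue. indicator {-1..\<xi> t} y * \<rho> t y) - \<alpha> * (LINT y|lebesgue. indicator {\<xi> t..1} y * \<rho> t y)" for t
  have G: "(LINT y:{-1..\<xi> t}|lebesgue. affine_cost \<alpha> (\<rho> t y)) - (LINT y:{\<xi> t..1}|lebesgue. affine_cost \<alpha> (\<rho> t y)) = G t" if "0 \<le> t" for t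
    using affine_cost_integral(2)[OF continuous_L1D(1)[OF \<rho> that], of "-1" "\<xi> t"]
      affine_cost_integral(2)[OF continuous_L1D(1)[OF \<rho> that], of "\<xi> t" 1] \<xi>(2)[OF that]
    by (simp add: G_def)
  have cG: "continuous_on {0..} G"
    unfolding G_def
    by (intro continuous_intros \<xi>(1) cut_integral_continuous[OF \<rho> cut_measurable(2)] cut_limits(2,3)[OF \<xi>(1)]) (auto simp: indicator_def)
  have "AE t in lebesgue. 0 < t \<longrightarrow> (LINT y:{-1..\<xi> t}|lebesgue. affine_cost \<alpha> (\<rho> t y)) = (LINT y:{\<xi> t..1}|lebesgue. affine_cost \<alpha> (\<rho> t y))"
    using bal by (subst (asm) AE_restrict_space_iff) auto
  then have "AE t in lborel. 0 < t \<longrightarrow> G t = 0"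
    unfolding AE_completion_iff
  proof eventually_elim
    case (elim t)
    show ?case
    proof
      assume "0 < t"
      then show "G t = 0" using G[of t] elim by simp
    qed
  qed
  from continuous_AE_zero[OF cG this t] show ?thesis using G[OF t] by simp
qed

text \<open>Each balance says that its cost has integral \<open>0\<close> against the weight that is
  \<open>1\<close> to the left and \<open>-1\<close> to the right of its turning point. In the
  difference of the two identities the integrand outside \<open>{x1..x2}\<close> is plus or minus
  \<open>c1 y - c2 y\<close> and is absorbed by \<open>\<bar>c1 y - c2 y\<bar>\<close>. Between the
  points it is \<open>c1 y + c2 y\<close>, and adding \<open>\<bar>c1 y - c2 y\<bar>\<close> gives
  \<open>2 * max (c1 y) (c2 y) \<ge> 2\<close>.\<close>

lemma balance_distance:
  fixes c1 c2 :: "real \<Rightarrow> real"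
  assumes c: "set_integrable lebesgue {-1..1} c1" "set_integrable lebesgue {-1..1} c2" "AE y in lebesgue. 1 \<le> c2 y"
    and x: "-1 < x1" "x1 \<le> x2" "x2 < 1"
    and bal: "(LINT y:{-1..x1}|lebesgue. c1 y) = (LINT y:{x1..1}|lebesgue. c1 y)"
      "(LINT y:{-1..x2}|lebesgue. c2 y) = (LINT y:{x2..1}|lebesgue. c2 y)"
  shows "2 * (x2 - x1) \<le> (LINT y:{-1..1}|lebesgue. \<bar>c1 y - c2 y\<bar>)"
proof -
  define s :: "real \<Rightarrow> real \<Rightarrow> real \<Rightarrow> real" where "s a b y = indicator {-1..a} y - indicator {b..1} y" for a b y
  have i: "integrable lebesgue (\<lambda>y. indicator {a..b} y * ci y)" if "set_integrable lebesgue {-1..1} ci" "-1 \<le> a" "b \<le> 1" for a b and ci :: "real \<Rightarrow> real"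
    using set_integrable_subset[OF that(1), of "{a..b}"] that(2,3) by (simp add: set_integrable_def)
  have z1: "(LINT y|lebesgue. s x1 x1 y * c1 y) = 0"
    using bal(1) i[OF c(1)] x by (simp add: s_def left_diff_distrib set_lebesgue_integral_def)
  have z2: "(LINT y|lebesgue. s x2 x2 y * c2 y) = 0"
    using bal(2) i[OF c(2)] x by (simp add: s_def left_diff_distrib set_lebesgue_integral_def)
  have iS: "integrable lebesgue (\<lambda>y. s a b y * ci y)" if "set_integrable lebesgue {-1..1} ci" "a \<le> 1" "-1 \<le> b" for a b and ci :: "real \<Rightarrow> real"
    unfolding s_def left_diff_distrib using that by (intro Bochner_Integration.integrable_diff i) auto
  have id: "integrable lebesgue (\<lambda>y. indicator {-1..1} y * \<bar>c1 y - c2 y\<bar>)"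
    using set_integrable_abs[OF set_integral_diff(1)[OF c(1,2)]] by (simp add: set_integrable_def)
  have ae: "AE y in lebesgue. y \<noteq> x1 \<and> y \<noteq> x2"
    using AE_completion[OF AE_lborel_singleton[of x1]] AE_completion[OF AE_lborel_singleton[of x2]] by eventually_elim simp
  have "(LINT y|lebesgue. 2 * indicator {x1..x2} y) \<le>
    (LINT y|lebesgue. (s x2 x2 y * c2 y - s x1 x1 y * c1 y) + indicator {-1..1} y * \<bar>c1 y - c2 y\<bar>)"
  proof (rule integral_mono_AE)
    show "integrable lebesgue (\<lambda>y. 2 * indicator {x1..x2} y :: real)" using integral_lebesgue_Icc(1) by simp
    show "integrable lebesgue (\<lambda>y. (s x2 x2 y * c2 y - s x1 x1 y * c1 y) + indicator {-1..1} y * \<bar>c1 y - c2 y\<bar>)"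
      using x by (intro Bochner_Integration.integrable_add Bochner_Integration.integrable_diff iS c id) auto
    show "AE y in lebesgue. 2 * indicator {x1..x2} y \<le> (s x2 x2 y * c2 y - s x1 x1 y * c1 y) + indicator {-1..1} y * \<bar>c1 y - c2 y\<bar>"
      using ae c(3)
    proof eventually_elim
      case (elim y)
      then show ?case using x by (auto simp: s_def indicator_def abs_if)
    qed
  qed
  also have "\<dots> = (LINT y|lebesgue. indicator {-1..1} y * \<bar>c1 y - c2 y\<bar>)"
    using z1 z2 iS[OF c(1), of x1 x1] iS[OF c(2), of x2 x2] x id by simp
  finally show ?thesis using integral_lebesgue_Icc[of x1 x2] x by (simp add: set_lebesgue_integral_def)
qed

subsection \<open>Stability\<close>

text \<open>By the reverse triangle inequality the norm of the difference changes by at most the sum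
  of the changes of \<open>g1\<close> and \<open>g2\<close>. With \<open>g2 = 0\<close> this is
  continuity of a single norm.\<close>

lemma L1_norm_difference_continuous:
  fixes g1 g2 :: "real \<Rightarrow> real \<Rightarrow> real"
  assumes i: "\<And>t. 0 \<le> t \<Longrightarrow> integrable lebesgue (g1 t)" "\<And>t. 0 \<le> t \<Longrightarrow> integrable lebesgue (g2 t)"
    and l: "\<And>t. 0 \<le> t \<Longrightarrow> ((\<lambda>s. LINT x|lebesgue. \<bar>g1 s x - g1 t x\<bar>) \<longlongrightarrow> 0) (at t within {0..})"
      "\<And>t. 0 \<le> t \<Longrightarrow> ((\<lambda>s. LINT x|lebesgue. \<bar>g2 s x - g2 t x\<bar>) \<longlongrightarrow> 0) (at t within {0..})"
  shows "continuous_on {0..} (\<lambda>t. LINT x|lebesgue. \<bar>g1 t x - g2 t x\<bar>)"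
  unfolding continuous_on
proof
  fix t :: real assume "t \<in> {0..}"
  then have t: "0 \<le> t" by simp
  define n where "n s = (LINT x|lebesgue. \<bar>g1 s x - g2 s x\<bar>)" for s
  have "((\<lambda>s. n s - n t) \<longlongrightarrow> 0) (at t within {0..})"
  proof (rule Lim_null_comparison)
    show "((\<lambda>s. (LINT x|lebesgue. \<bar>g1 s x - g1 t x\<bar>) + (LINT x|lebesgue. \<bar>g2 s x - g2 t x\<bar>)) \<longlongrightarrow> 0) (at t within {0..})"
      using tendsto_add[OF l[OF t]] by simp
    have "norm (n s - n t) \<le> (LINT x|lebesgue. \<bar>g1 s x - g1 t x\<bar>) + (LINT x|lebesgue. \<bar>g2 s x - g2 t x\<bar>)" if s: "0 \<le> s" for s
    proof -
      have ii: "integrable lebesgue (\<lambda>x. \<bar>g1 s x - g2 s x\<bar>)" "integrable lebesgue (\<lambda>x. \<bar>g1 t x - g2 t x\<bar>)"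
        "integrable lebesgue (\<lambda>x. \<bar>g1 s x - g1 t x\<bar>)" "integrable lebesgue (\<lambda>x. \<bar>g2 s x - g2 t x\<bar>)"
        using i s t by simp_all
      have "norm (n s - n t) = norm (LINT x|lebesgue. \<bar>g1 s x - g2 s x\<bar> - \<bar>g1 t x - g2 t x\<bar>)"
        using ii by (simp add: n_def)
      also have "\<dots> \<le> (LINT x|lebesgue. norm (\<bar>g1 s x - g2 s x\<bar> - \<bar>g1 t x - g2 t x\<bar>))"
        by (rule integral_norm_bound)
      also have "\<dots> \<le> (LINT x|lebesgue. \<bar>g1 s x - g1 t x\<bar> + \<bar>g2 s x - g2 t x\<bar>)"
      proof (rule integral_mono)
        show "integrable lebesgue (\<lambda>x. norm (\<bar>g1 s x - g2 s x\<bar> - \<bar>g1 t x - g2 t x\<bar>))"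
          by (intro integrable_norm Bochner_Integration.integrable_diff ii)
        show "integrable lebesgue (\<lambda>x. \<bar>g1 s x - g1 t x\<bar> + \<bar>g2 s x - g2 t x\<bar>)"
          by (intro Bochner_Integration.integrable_add ii)
      qed auto
      finally show ?thesis using ii by simp
    qed
    then show "\<forall>\<^sub>F s in at t within {0..}. norm (n s - n t) \<le> (LINT x|lebesgue. \<bar>g1 s x - g1 t x\<bar>) + (LINT x|lebesgue. \<bar>g2 s x - g2 t x\<bar>)"
      by (auto simp: eventually_at_filter)
  qed
  then have "(n \<longlongrightarrow> n t) (at t within {0..})" by (rule Lim_null[THEN iffD2])
  then show "((\<lambda>t. LINT x|lebesgue. \<bar>g1 t x - g2 t x\<bar>) \<longlongrightarrow> (LINT x|lebesgue. \<bar>g1 t x - g2 t x\<bar>)) (at t within {0..})"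
    by (simp add: n_def[abs_def])
qed

lemma Pair_measurable_borel:
  "h \<in> borel_measurable borel \<Longrightarrow> (\<lambda>x::real. h (t::real, x)) \<in> borel_measurable borel"
  by (rule measurable_compose[of "\<lambda>x. (t, x)" borel borel])
    (auto intro!: borel_measurable_continuous_onI continuous_intros)

text \<open>Continuity in L1 makes the norm of the slices continuous, hence integrable over
  \<open>{0..T}\<close>; together with integrability of the slices this is Tonelli's criterion on
  the product. It is the integrability at infinity that removes the spatial cutoff.\<close>

lemma strip_L1:
  assumes \<rho>: "continuous_L1 \<rho>" and r: "r \<in> borel_measurable borel" "\<And>z. 0 \<le> r z"
    and ae: "AE z in lborel. 0 \<le> fst z \<longrightarrow> r z = \<rho> (fst z) (snd z)"
  shows "integrable lborel (\<lambda>z. indicator ({0..T} \<times> UNIV) z * r z)"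
proof -
  define h where "h z = indicator {0..T} (fst z) * r z" for z :: "real \<times> real"
  have mf[measurable]: "(fst :: real \<times> real \<Rightarrow> real) \<in> borel_measurable borel"
    by (intro borel_measurable_continuous_onI continuous_intros)
  have mh: "h \<in> borel_measurable borel" unfolding h_def using r(1) by measurable
  define n where "n t = (LINT x|lebesgue. \<bar>\<rho> t x - 0\<bar>)" for t
  have cn: "continuous_on {0..} n" unfolding n_def
    by (rule L1_norm_difference_continuous) (auto intro: continuous_L1D[OF \<rho>])
  have ax: "AE t in lborel. 0 \<le> t \<longrightarrow> (AE x in lborel. r (t, x) = \<rho> t x)"
    using AE_lborel_pair[OF ae] by eventually_elim simp
  have slice: "integrable lborel (\<lambda>x. h (t, x)) \<and> (LINT x|lborel. norm (h (t, x))) = indicator {0..T} t *\<^sub>R n t"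
    if "0 \<le> t \<longrightarrow> (AE x in lborel. r (t, x) = \<rho> t x)" for t
  proof (cases "t \<in> {0..T}")
    case False
    then show ?thesis by (simp add: h_def)
  next
    case True
    then have e: "AE x in lborel. h (t, x) = \<rho> t x" using that by (simp add: h_def)
    have mht: "(\<lambda>x. h (t, x)) \<in> borel_measurable borel" by (rule Pair_measurable_borel[OF mh])
    have "integrable lebesgue (\<lambda>x. h (t, x))"
    proof (rule integrable_cong_AE_imp[OF continuous_L1D(1)[OF \<rho>, of t]])
      show "AE x in lebesgue. \<rho> t x = h (t, x)"
        by (rule AE_completion) (use e in eventually_elim, simp)
      show "(\<lambda>x. h (t, x)) \<in> borel_measurable lebesgue"
        by (rule measurable_completion) (use mht in simp)
    qed (use True in simp)
    then have "integrable lborel (\<lambda>x. h (t, x))"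
      using integrable_completion[of "\<lambda>x. h (t, x)" lborel] mht by simp
    moreover have "n t = (LINT x|lborel. norm (h (t, x)))"
      unfolding n_def by (rule integral_lebesgue_eq_lborel) (use e mht in \<open>auto elim!: eventually_mono\<close>)
    ultimately show ?thesis using True by simp
  qed
  have "integrable (lborel \<Otimes>\<^sub>M lborel) h"
  proof (rule lborel_pair.Fubini_integrable)
    show mh': "h \<in> borel_measurable (lborel \<Otimes>\<^sub>M lborel)" using mh unfolding lborel_prod by simp
    show "AE t in lborel. integrable lborel (\<lambda>x. h (t, x))"
      using ax by eventually_elim (use slice in blast)
    show "integrable lborel (\<lambda>t. LINT x|lborel. norm (h (t, x)))"
    proof (rule integrable_cong_AE_imp)
      show "integrable lborel (\<lambda>t. indicator {0..T} t *\<^sub>R n t)"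
        by (intro borel_integrable_compact continuous_on_subset[OF cn]) auto
      show "(\<lambda>t. LINT x|lborel. norm (h (t, x))) \<in> borel_measurable lborel"
        by (rule lborel.borel_measurable_lebesgue_integral) (use mh' in measurable)
      show "AE t in lborel. indicator {0..T} t *\<^sub>R n t = (LINT x|lborel. norm (h (t, x)))"
        using ax by eventually_elim (use slice in simp)
    qed
  qed
  moreover have "h = (\<lambda>z. indicator ({0..T} \<times> UNIV) z * r z)"
    by (auto simp: h_def fun_eq_iff indicator_def)
  ultimately show ?thesis by (simp add: lborel_prod)
qed

lemma well_separated_solutionD:
  assumes "well_separated_entropy_solution R f c \<rho>0 \<rho> \<xi>"
  shows "continuous_L1 \<rho>" "continuous_on {0..} \<xi>" "\<And>t. 0 \<le> t \<Longrightarrow> \<xi> t \<in> {-1<..<1}"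
    "AE t in lebesgue_on {0<..}. (LINT y:{-1..\<xi> t}|lebesgue. c (\<rho> t y)) = (LINT y:{\<xi> t..1}|lebesgue. c (\<rho> t y))"
    "AE x in lebesgue. \<rho> 0 x = \<rho>0 x" "initial_datum R \<rho>0"
proof -
  have es: "entropy_solution R f c \<rho>0 \<rho> \<xi>"
    using assms by (simp add: well_separated_entropy_solution_def)
  then show "continuous_L1 \<rho>" "AE x in lebesgue. \<rho> 0 x = \<rho>0 x" "initial_datum R \<rho>0"
    "AE t in lebesgue_on {0<..}. (LINT y:{-1..\<xi> t}|lebesgue. c (\<rho> t y)) = (LINT y:{\<xi> t..1}|lebesgue. c (\<rho> t y))"
    "\<And>t. 0 \<le> t \<Longrightarrow> \<xi> t \<in> {-1<..<1}"
    unfolding entropy_solution_def by blast+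
  obtain L where "L-lipschitz_on {0..} \<xi>" using es unfolding entropy_solution_def by blast
  then show "continuous_on {0..} \<xi>" by (rule lipschitz_on_continuous_on)
qed

text \<open>The two solutions have different curves, but their parts on the side
  \<open>\<sigma>\<close> satisfy \<open>kruzhkov\<close> with one and the same flux, so the
  contraction applies at positive times. Continuity of \<open>m\<close> up to time \<open>0\<close>
  carries the bound down to the initial data.\<close>

lemma side_contraction:
  assumes R: "0 < R" and flux: "hughes_flux R f"
    and sol1: "well_separated_entropy_solution R f c1 \<rho>01 \<rho>1 \<xi>1"
    and sol2: "well_separated_entropy_solution R f c2 \<rho>02 \<rho>2 \<xi>2"
    and \<sigma>: "\<sigma> = 1 \<or> \<sigma> = (-1 :: real)" and t: "0 \<le> t"
  defines "m \<equiv> \<lambda>t. LINT x|lebesgue. \<bar>indicator {0<..} (\<sigma> * (x - \<xi>1 t)) * \<rho>1 t x - indicator {0<..} (\<sigma> * (x - \<xi>2 t)) * \<rho>2 t x\<bar>"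
  shows "m t \<le> m 0"
proof -
  note s1 = well_separated_solutionD[OF sol1] and s2 = well_separated_solutionD[OF sol2]
  obtain r1 where r1: "r1 \<in> borel_measurable borel" "\<And>z. r1 z \<in> {0..R}"
    "AE z in lborel. 0 \<le> fst z \<longrightarrow> r1 z = \<rho>1 (fst z) (snd z) \<and> \<rho>1 (fst z) (snd z) \<in> {0..R}"
    "\<And>\<sigma>. \<sigma> = 1 \<or> \<sigma> = -1 \<Longrightarrow> kruzhkov R (\<lambda>s. \<sigma> * f (max 0 (min R s)))
      (\<lambda>z. if 0 < \<sigma> * (snd z - \<xi>1 (max 0 (fst z))) then r1 z else 0)"
    by (rule well_separated_imp_kruzhkov[OF R flux sol1]) (rule that)
  obtain r2 where r2: "r2 \<in> borel_measurable borel" "\<And>z. r2 z \<in> {0..R}"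
    "AE z in lborel. 0 \<le> fst z \<longrightarrow> r2 z = \<rho>2 (fst z) (snd z) \<and> \<rho>2 (fst z) (snd z) \<in> {0..R}"
    "\<And>\<sigma>. \<sigma> = 1 \<or> \<sigma> = -1 \<Longrightarrow> kruzhkov R (\<lambda>s. \<sigma> * f (max 0 (min R s)))
      (\<lambda>z. if 0 < \<sigma> * (snd z - \<xi>2 (max 0 (fst z))) then r2 z else 0)"
    by (rule well_separated_imp_kruzhkov[OF R flux sol2]) (rule that)
  define u1 where "u1 z = (if 0 < \<sigma> * (snd z - \<xi>1 (max 0 (fst z))) then r1 z else 0)" for z
  define u2 where "u2 z = (if 0 < \<sigma> * (snd z - \<xi>2 (max 0 (fst z))) then r2 z else 0)" for z
  define F where "F s = \<sigma> * f (max 0 (min R s))" for s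
  have k1: "kruzhkov R F u1" and k2: "kruzhkov R F u2"
    using r1(4)[OF \<sigma>] r2(4)[OF \<sigma>] by (simp_all add: u1_def[abs_def] u2_def[abs_def] F_def[abs_def])
  have cF: "continuous_on UNIV F"
  proof -
    have "continuous_on {0..R} f" using flux by (simp add: hughes_flux_def)
    then have "continuous_on UNIV (\<lambda>s. f (max 0 (min R s)))"
      by (rule continuous_on_compose2) (use R in \<open>auto intro!: continuous_intros\<close>)
    then show ?thesis unfolding F_def by (intro continuous_on_mult continuous_on_const)
  qed
  have strip: "integrable lborel (\<lambda>z. indicator ({0..T} \<times> UNIV) z * \<bar>u1 z - u2 z\<bar>)" for T
  proof (rule Bochner_Integration.integrable_bound)
    have "AE z in lborel. 0 \<le> fst z \<longrightarrow> r1 z = \<rho>1 (fst z) (snd z)"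
      using r1(3) by eventually_elim simp
    moreover have "AE z in lborel. 0 \<le> fst z \<longrightarrow> r2 z = \<rho>2 (fst z) (snd z)"
      using r2(3) by eventually_elim simp
    ultimately show "integrable lborel (\<lambda>z. indicator ({0..T} \<times> UNIV) z * r1 z + indicator ({0..T} \<times> UNIV) z * r2 z)"
      using r1(2) r2(2) by (intro Bochner_Integration.integrable_add strip_L1[OF s1(1) r1(1)] strip_L1[OF s2(1) r2(1)]) auto
    have "{0..T} \<times> UNIV \<in> sets (borel :: (real \<times> real) measure)"
      by (intro borel_closed closed_Times) auto
    then show "(\<lambda>z. indicator ({0..T} \<times> UNIV) z * \<bar>u1 z - u2 z\<bar>) \<in> borel_measurable lborel"
      using kruzhkovD(1)[OF k1] kruzhkovD(1)[OF k2] by measurable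
    have "\<bar>u1 z - u2 z\<bar> \<le> r1 z + r2 z" for z
      using r1(2)[of z] r2(2)[of z] by (auto simp: u1_def u2_def)
    then have "norm (indicator ({0..T} \<times> UNIV) z * \<bar>u1 z - u2 z\<bar>) \<le> norm (indicator ({0..T} \<times> UNIV) z * r1 z + indicator ({0..T} \<times> UNIV) z * r2 z)" for z
      using r1(2)[of z] r2(2)[of z] by (auto simp: indicator_def)
    then show "AE z in lborel. norm (indicator ({0..T} \<times> UNIV) z * \<bar>u1 z - u2 z\<bar>) \<le> norm (indicator ({0..T} \<times> UNIV) z * r1 z + indicator ({0..T} \<times> UNIV) z * r2 z)"
      by simp
  qed
  have ind: "0 \<le> (indicator A y :: real) \<and> (indicator A y :: real) \<le> 1" for A and y :: real
    by (simp add: indicator_def)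
  have inda: "\<bar>indicator A y :: real\<bar> \<le> 1" for A and y :: real
    by (simp add: indicator_def)
  have cm: "continuous_on {0..} m"
    unfolding m_def
    by (rule L1_norm_difference_continuous)
      (intro integrable_cut cut_measurable inda continuous_L1D(1) s1(1) s2(1)
        cut_tendsto[OF s1(1) _ cut_measurable(1) ind cut_limits(1)[OF s1(2) _ \<sigma>]]
        cut_tendsto[OF s2(1) _ cut_measurable(1) ind cut_limits(1)[OF s2(2) _ \<sigma>]]; assumption)+
  have "AE t in lborel. 0 < t \<longrightarrow> (LINT x|lborel. \<bar>u1 (t, x) - u2 (t, x)\<bar>) = m t"
    using AE_lborel_pair[OF r1(3)] AE_lborel_pair[OF r2(3)]
  proof eventually_elim
    case (elim t)
    show ?case
    proof
      assume t: "0 < t"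
      have "m t = (LINT x|lborel. \<bar>u1 (t, x) - u2 (t, x)\<bar>)"
        unfolding m_def
      proof (rule integral_lebesgue_eq_lborel)
        show "AE x in lborel. \<bar>indicator {0<..} (\<sigma> * (x - \<xi>1 t)) * \<rho>1 t x - indicator {0<..} (\<sigma> * (x - \<xi>2 t)) * \<rho>2 t x\<bar> = \<bar>u1 (t, x) - u2 (t, x)\<bar>"
          using elim by eventually_elim (use t in \<open>auto simp: u1_def u2_def\<close>)
        show "(\<lambda>x. \<bar>u1 (t, x) - u2 (t, x)\<bar>) \<in> borel_measurable borel"
          using Pair_measurable_borel[OF kruzhkovD(1)[OF k1], of t] Pair_measurable_borel[OF kruzhkovD(1)[OF k2], of t] by measurable
      qed
      then show "(LINT x|lborel. \<bar>u1 (t, x) - u2 (t, x)\<bar>) = m t" by simp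
    qed
  qed
  moreover have "continuous_on {0<..} m" by (rule continuous_on_subset[OF cm]) auto
  ultimately have contr: "m b \<le> m a" if "0 < a" "a < b" for a b
    using kruzhkov_contraction[OF k1 k2 cF strip _ _ that] by blast
  show ?thesis
  proof (cases "t = 0")
    case False
    then have t: "0 < t" using t by simp
    have "(m \<longlongrightarrow> m 0) (at 0 within {0..})" using cm by (auto simp: continuous_on)
    then have lim: "(m \<longlongrightarrow> m 0) (at_right 0)" by (rule tendsto_within_subset) auto
    have "\<forall>\<^sub>F a in at_right 0. m t \<le> m a"
      using eventually_at_right_less[of 0] eventually_at_right_real[OF t]
      by eventually_elim (use contr in auto)
    then show ?thesis by (rule tendsto_lowerbound[OF lim]) simp
  qed simp
qed

section \<open>From the balance to the stability constant\<close>

lemma initial_datum_integrable: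
  assumes "initial_datum R h"
  shows "integrable lebesgue h" "(LINT x|lebesgue. indicator {-1..1} x * h x) \<le> 2 * R"
proof -
  have h: "h \<in> borel_measurable lebesgue" "\<And>x. h x \<in> {0..R}" "\<And>x. x \<notin> {-1<..<1} \<Longrightarrow> h x = 0"
    using assms by (auto simp: initial_datum_def)
  have iR: "integrable lebesgue (\<lambda>x. R * indicator {-1..1::real} x)"
    using integral_lebesgue_Icc(1)[of "-1" 1] by simp
  have le: "h x \<le> R * indicator {-1..1} x" "0 \<le> h x" for x
    using h(2)[of x] h(3)[of x] by (auto simp: indicator_def)
  show i: "integrable lebesgue h"
    by (rule Bochner_Integration.integrable_bound[OF iR h(1)])
      (use le order_trans[OF le(1) abs_ge_self] in \<open>auto intro!: AE_I2\<close>)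
  have eq: "indicator {-1..1} x * h x = h x" for x
    using h(3)[of x] by (cases "x \<in> {-1<..<1}") (auto simp: indicator_def)
  have "(LINT x|lebesgue. h x) \<le> (LINT x|lebesgue. R * indicator {-1..1::real} x)"
    by (rule integral_mono[OF i iR le(1)])
  also have "\<dots> = 2 * R" using integral_lebesgue_Icc[of "-1" 1] by simp
  finally show "(LINT x|lebesgue. indicator {-1..1} x * h x) \<le> 2 * R" by (simp add: eq)
qed

text \<open>Writing the difference of the costs as \<open>(\<alpha>1 - \<alpha>2) * \<rho>1 +
  \<alpha>2 * (\<rho>1 - \<rho>2)\<close> pairs the parameters with a mass and the densities with a
  distance. Nonnegative densities make both costs at least \<open>1\<close>, so that
  \<open>balance_distance\<close> applies for either order of the turning points.\<close>

lemma turning_point_stability: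
  assumes sol1: "well_separated_entropy_solution R f (affine_cost \<alpha>1) \<rho>01 \<rho>1 \<xi>1"
    and sol2: "well_separated_entropy_solution R f (affine_cost \<alpha>2) \<rho>02 \<rho>2 \<xi>2"
    and \<alpha>: "0 \<le> \<alpha>1" "0 \<le> \<alpha>2" and t: "0 \<le> t"
    and nn: "AE x in lebesgue. 0 \<le> \<rho>1 t x" "AE x in lebesgue. 0 \<le> \<rho>2 t x"
  shows "2 * \<bar>\<xi>1 t - \<xi>2 t\<bar> \<le> \<bar>\<alpha>1 - \<alpha>2\<bar> * (LINT x|lebesgue. indicator {-1..1} x * \<rho>1 t x)
    + \<alpha>2 * (LINT x|lebesgue. \<bar>\<rho>1 t x - \<rho>2 t x\<bar>)"
proof -
  note s1 = well_separated_solutionD[OF sol1] and s2 = well_separated_solutionD[OF sol2]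
  define c1 where "c1 y = affine_cost \<alpha>1 (\<rho>1 t y)" for y
  define c2 where "c2 y = affine_cost \<alpha>2 (\<rho>2 t y)" for y
  have i1: "integrable lebesgue (\<rho>1 t)" by (rule continuous_L1D(1)[OF s1(1) t])
  have i2: "integrable lebesgue (\<rho>2 t)" by (rule continuous_L1D(1)[OF s2(1) t])
  have ci: "set_integrable lebesgue {-1..1} c1" "set_integrable lebesgue {-1..1} c2"
    unfolding c1_def[abs_def] c2_def[abs_def]
    by (rule affine_cost_integral(1)[OF i1], simp, rule affine_cost_integral(1)[OF i2], simp)
  have c1: "AE y in lebesgue. 1 \<le> c1 y"
    using nn(1) by eventually_elim (use \<alpha>(1) in \<open>simp add: c1_def affine_cost_def\<close>)
  have c2: "AE y in lebesgue. 1 \<le> c2 y"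
    using nn(2) by eventually_elim (use \<alpha>(2) in \<open>simp add: c2_def affine_cost_def\<close>)
  have b1: "(LINT y:{-1..\<xi>1 t}|lebesgue. c1 y) = (LINT y:{\<xi>1 t..1}|lebesgue. c1 y)"
    unfolding c1_def by (rule balance_all_times[OF s1(1-3) s1(4) t])
  have b2: "(LINT y:{-1..\<xi>2 t}|lebesgue. c2 y) = (LINT y:{\<xi>2 t..1}|lebesgue. c2 y)"
    unfolding c2_def by (rule balance_all_times[OF s2(1-3) s2(4) t])
  have x: "-1 < \<xi>1 t" "\<xi>1 t < 1" "-1 < \<xi>2 t" "\<xi>2 t < 1" using s1(3)[OF t] s2(3)[OF t] by auto
  have "2 * \<bar>\<xi>1 t - \<xi>2 t\<bar> \<le> (LINT y:{-1..1}|lebesgue. \<bar>c1 y - c2 y\<bar>)"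
  proof (cases "\<xi>1 t \<le> \<xi>2 t")
    case True
    then show ?thesis using balance_distance[OF ci c2 x(1) True x(4) b1 b2] by simp
  next
    case False
    then show ?thesis using balance_distance[OF ci(2,1) c1 x(3) _ x(2) b2 b1] by (simp add: abs_minus_commute[of "c1 _"])
  qed
  also have "\<dots> \<le> (LINT y|lebesgue. \<bar>\<alpha>1 - \<alpha>2\<bar> * (indicator {-1..1} y * \<rho>1 t y) + \<alpha>2 * \<bar>\<rho>1 t y - \<rho>2 t y\<bar>)"
    unfolding set_lebesgue_integral_def
  proof (rule integral_mono_AE)
    show "integrable lebesgue (\<lambda>y. indicator {-1..1} y *\<^sub>R \<bar>c1 y - c2 y\<bar>)"
      using set_integrable_abs[OF set_integral_diff(1)[OF ci(1,2)]] by (simp add: set_integrable_def)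
    have "integrable lebesgue (\<lambda>y. indicator {-1..1} y * \<rho>1 t y)"
      by (rule integrable_cut[OF cut_measurable(2) _ i1]) (simp add: indicator_def)
    then show "integrable lebesgue (\<lambda>y. \<bar>\<alpha>1 - \<alpha>2\<bar> * (indicator {-1..1} y * \<rho>1 t y) + \<alpha>2 * \<bar>\<rho>1 t y - \<rho>2 t y\<bar>)"
      using i1 i2 by simp
    show "AE y in lebesgue. indicator {-1..1} y *\<^sub>R \<bar>c1 y - c2 y\<bar> \<le> \<bar>\<alpha>1 - \<alpha>2\<bar> * (indicator {-1..1} y * \<rho>1 t y) + \<alpha>2 * \<bar>\<rho>1 t y - \<rho>2 t y\<bar>"
      using nn(1)
    proof eventually_elim
      case (elim y)
      have "c1 y - c2 y = (\<alpha>1 - \<alpha>2) * \<rho>1 t y + \<alpha>2 * (\<rho>1 t y - \<rho>2 t y)"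
        by (simp add: c1_def c2_def affine_cost_def algebra_simps)
      also have "\<bar>\<dots>\<bar> \<le> \<bar>(\<alpha>1 - \<alpha>2) * \<rho>1 t y\<bar> + \<bar>\<alpha>2 * (\<rho>1 t y - \<rho>2 t y)\<bar>" by (rule abs_triangle_ineq)
      also have "\<dots> = \<bar>\<alpha>1 - \<alpha>2\<bar> * \<rho>1 t y + \<alpha>2 * \<bar>\<rho>1 t y - \<rho>2 t y\<bar>"
        using elim \<alpha>(2) by (simp add: abs_mult)
      finally show ?case using \<alpha>(2) by (simp add: indicator_def)
    qed
  qed
  also have "\<dots> = \<bar>\<alpha>1 - \<alpha>2\<bar> * (LINT y|lebesgue. indicator {-1..1} y * \<rho>1 t y) + \<alpha>2 * (LINT y|lebesgue. \<bar>\<rho>1 t y - \<rho>2 t y\<bar>)"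
  proof -
    have "integrable lebesgue (\<lambda>y. indicator {-1..1} y * \<rho>1 t y)"
      by (rule integrable_cut[OF cut_measurable(2) _ i1]) (simp add: indicator_def)
    then show ?thesis using i1 i2 by simp
  qed
  finally show ?thesis .
qed

lemma L1_stability:
  assumes R: "0 < R" and flux: "hughes_flux R f"
    and sol1: "well_separated_entropy_solution R f (affine_cost \<alpha>1) \<rho>01 \<rho>1 \<xi>1"
    and sol2: "well_separated_entropy_solution R f (affine_cost \<alpha>2) \<rho>02 \<rho>2 \<xi>2"
    and \<alpha>: "0 \<le> \<alpha>1" "0 \<le> \<alpha>2" and t: "0 \<le> t"
  shows "(LINT x|lebesgue. \<bar>\<rho>1 t x - \<rho>2 t x\<bar>) \<le> (1 + 2 * R\<^sup>2 + R * max \<alpha>1 \<alpha>2) *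
    (\<bar>\<alpha>1 - \<alpha>2\<bar> + (LINT x|lebesgue. \<bar>\<rho>01 x - \<rho>02 x\<bar>))"
proof -
  note s1 = well_separated_solutionD[OF sol1] and s2 = well_separated_solutionD[OF sol2]
  define A1 where "A1 \<sigma> s x = indicator {0<..} (\<sigma> * (x - \<xi>1 s)) * \<rho>1 s x" for \<sigma> s x :: real
  define A2 where "A2 \<sigma> s x = indicator {0<..} (\<sigma> * (x - \<xi>2 s)) * \<rho>2 s x" for \<sigma> s x :: real
  define m where "m \<sigma> s = (LINT x|lebesgue. \<bar>A1 \<sigma> s x - A2 \<sigma> s x\<bar>)" for \<sigma> s :: real
  define D where "D = (LINT x|lebesgue. \<bar>\<rho>01 x - \<rho>02 x\<bar>)"
  have m: "m \<sigma> t \<le> m \<sigma> 0" if "\<sigma> = 1 \<or> \<sigma> = -1" for \<sigma>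
    unfolding m_def A1_def A2_def by (rule side_contraction[OF R flux sol1 sol2 that t])
  have iA: "integrable lebesgue (A1 \<sigma> s)" "integrable lebesgue (A2 \<sigma> s)" if "0 \<le> s" for \<sigma> s
    unfolding A1_def[abs_def] A2_def[abs_def]
    by (rule integrable_cut[OF cut_measurable(1) _ continuous_L1D(1)[OF s1(1) that]], simp add: indicator_def,
      rule integrable_cut[OF cut_measurable(1) _ continuous_L1D(1)[OF s2(1) that]], simp add: indicator_def)
  have im: "integrable lebesgue (\<lambda>x. \<bar>A1 \<sigma> s x - A2 \<sigma> s x\<bar>)" if "0 \<le> s" for \<sigma> s
    by (intro integrable_abs Bochner_Integration.integrable_diff iA that)
  have i1: "integrable lebesgue (\<rho>1 t)" by (rule continuous_L1D(1)[OF s1(1) t])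
  have i2: "integrable lebesgue (\<rho>2 t)" by (rule continuous_L1D(1)[OF s2(1) t])
  have ne: "AE x in lebesgue. x \<noteq> c" for c :: real by (rule AE_completion[OF AE_lborel_singleton])
  \<comment> \<open>Off the two curves each density is the sum of its right and left parts.\<close>
  have "(LINT x|lebesgue. \<bar>\<rho>1 t x - \<rho>2 t x\<bar>) \<le> (LINT x|lebesgue. \<bar>A1 1 t x - A2 1 t x\<bar> + \<bar>A1 (-1) t x - A2 (-1) t x\<bar>)"
  proof (rule integral_mono_AE)
    show "integrable lebesgue (\<lambda>x. \<bar>\<rho>1 t x - \<rho>2 t x\<bar>)" using i1 i2 by simp
    show "integrable lebesgue (\<lambda>x. \<bar>A1 1 t x - A2 1 t x\<bar> + \<bar>A1 (-1) t x - A2 (-1) t x\<bar>)"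
      by (intro Bochner_Integration.integrable_add im t)
    show "AE x in lebesgue. \<bar>\<rho>1 t x - \<rho>2 t x\<bar> \<le> \<bar>A1 1 t x - A2 1 t x\<bar> + \<bar>A1 (-1) t x - A2 (-1) t x\<bar>"
      using ne[of "\<xi>1 t"] ne[of "\<xi>2 t"]
    proof eventually_elim
      case (elim x)
      then show ?case by (auto simp: A1_def A2_def indicator_def)
    qed
  qed
  also have "\<dots> = m 1 t + m (-1) t" using im[OF t] by (simp add: m_def)
  also have "\<dots> \<le> m 1 0 + m (-1) 0" by (intro add_mono m) auto
  also have "\<dots> = (LINT x|lebesgue. \<bar>A1 1 0 x - A2 1 0 x\<bar> + \<bar>A1 (-1) 0 x - A2 (-1) 0 x\<bar>)"
    using im[OF order_refl] by (simp add: m_def)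
  \<comment> \<open>Strictly between the initial turning points each side compares one datum with
    \<open>0\<close>, and the sum \<open>\<rho>01 x + \<rho>02 x\<close> is at most
    \<open>2 * R\<close>. Outside, one side gives \<open>\<bar>\<rho>01 x - \<rho>02 x\<bar>\<close>
    and the other \<open>0\<close>.\<close>
  also have "\<dots> \<le> (LINT x|lebesgue. \<bar>\<rho>01 x - \<rho>02 x\<bar> + 2 * R * indicator {min (\<xi>1 0) (\<xi>2 0)..max (\<xi>1 0) (\<xi>2 0)} x)"
  proof (rule integral_mono_AE)
    show "integrable lebesgue (\<lambda>x. \<bar>A1 1 0 x - A2 1 0 x\<bar> + \<bar>A1 (-1) 0 x - A2 (-1) 0 x\<bar>)"
      by (intro Bochner_Integration.integrable_add im order_refl)
    show "integrable lebesgue (\<lambda>x. \<bar>\<rho>01 x - \<rho>02 x\<bar> + 2 * R * indicator {min (\<xi>1 0) (\<xi>2 0)..max (\<xi>1 0) (\<xi>2 0)} x)"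
      using initial_datum_integrable(1)[OF s1(6)] initial_datum_integrable(1)[OF s2(6)] integral_lebesgue_Icc(1) by simp
    show "AE x in lebesgue. \<bar>A1 1 0 x - A2 1 0 x\<bar> + \<bar>A1 (-1) 0 x - A2 (-1) 0 x\<bar>
      \<le> \<bar>\<rho>01 x - \<rho>02 x\<bar> + 2 * R * indicator {min (\<xi>1 0) (\<xi>2 0)..max (\<xi>1 0) (\<xi>2 0)} x"
      using s1(5) s2(5)
    proof eventually_elim
      case (elim x)
      have "\<rho>01 x \<in> {0..R}" "\<rho>02 x \<in> {0..R}" using s1(6) s2(6) by (simp_all add: initial_datum_def)
      then have "0 \<le> \<rho>01 x" "\<rho>01 x \<le> R" "0 \<le> \<rho>02 x" "\<rho>02 x \<le> R" by auto
      then show ?case by (auto simp: A1_def A2_def elim indicator_def min_def max_def split: if_splits)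
    qed
  qed
  also have "\<dots> = D + 2 * R * \<bar>\<xi>1 0 - \<xi>2 0\<bar>"
  proof -
    have "max (\<xi>1 0) (\<xi>2 0) - min (\<xi>1 0) (\<xi>2 0) = \<bar>\<xi>1 0 - \<xi>2 0\<bar>" "min (\<xi>1 0) (\<xi>2 0) \<le> max (\<xi>1 0) (\<xi>2 0)"
      by auto
    then show ?thesis
      using initial_datum_integrable(1)[OF s1(6)] initial_datum_integrable(1)[OF s2(6)] integral_lebesgue_Icc
      by (simp add: D_def)
  qed
  finally have 1: "(LINT x|lebesgue. \<bar>\<rho>1 t x - \<rho>2 t x\<bar>) \<le> D + R * (2 * \<bar>\<xi>1 0 - \<xi>2 0\<bar>)" by simp
  have D0: "D = (LINT x|lebesgue. \<bar>\<rho>1 0 x - \<rho>2 0 x\<bar>)"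
    unfolding D_def
  proof (rule integral_cong_AE)
    show "(\<lambda>x. \<bar>\<rho>01 x - \<rho>02 x\<bar>) \<in> borel_measurable lebesgue"
      using initial_datum_integrable(1)[OF s1(6)] initial_datum_integrable(1)[OF s2(6)] by (intro borel_measurable_integrable) simp
    show "(\<lambda>x. \<bar>\<rho>1 0 x - \<rho>2 0 x\<bar>) \<in> borel_measurable lebesgue"
      using continuous_L1D(1)[OF s1(1), of 0] continuous_L1D(1)[OF s2(1), of 0] by (intro borel_measurable_integrable) simp
    show "AE x in lebesgue. \<bar>\<rho>01 x - \<rho>02 x\<bar> = \<bar>\<rho>1 0 x - \<rho>2 0 x\<bar>"
      using s1(5) s2(5) by eventually_elim simp
  qed
  have mass: "(LINT x|lebesgue. indicator {-1..1} x * \<rho>1 0 x) \<le> 2 * R"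
  proof -
    have "(LINT x|lebesgue. indicator {-1..1} x * \<rho>1 0 x) = (LINT x|lebesgue. indicator {-1..1} x * \<rho>01 x)"
    proof (rule integral_cong_AE)
      show "(\<lambda>x. indicator {-1..1} x * \<rho>1 0 x) \<in> borel_measurable lebesgue"
        by (intro borel_measurable_times cut_measurable borel_measurable_integrable continuous_L1D(1)[OF s1(1)] order_refl)
      show "(\<lambda>x. indicator {-1..1} x * \<rho>01 x) \<in> borel_measurable lebesgue"
        by (intro borel_measurable_times cut_measurable borel_measurable_integrable initial_datum_integrable(1)[OF s1(6)])
      show "AE x in lebesgue. indicator {-1..1} x * \<rho>1 0 x = indicator {-1..1} x * \<rho>01 x"
        using s1(5) by eventually_elim simp
    qed
    then show ?thesis using initial_datum_integrable(2)[OF s1(6)] by simp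
  qed
  have nn1: "AE x in lebesgue. 0 \<le> \<rho>1 0 x"
    using s1(5) by eventually_elim (use s1(6) in \<open>simp add: initial_datum_def\<close>)
  have nn2: "AE x in lebesgue. 0 \<le> \<rho>2 0 x"
    using s2(5) by eventually_elim (use s2(6) in \<open>simp add: initial_datum_def\<close>)
  have Dnn: "0 \<le> D" unfolding D_def by (intro integral_nonneg_AE) auto
  define d where "d = \<bar>\<alpha>1 - \<alpha>2\<bar>"
  have d: "0 \<le> d" by (simp add: d_def)
  have "2 * \<bar>\<xi>1 0 - \<xi>2 0\<bar> \<le> d * (2 * R) + max \<alpha>1 \<alpha>2 * D"
    using turning_point_stability[OF sol1 sol2 \<alpha> order_refl nn1 nn2] mult_left_mono[OF mass d] mult_right_mono[OF max.cobounded2 Dnn, of \<alpha>2 \<alpha>1]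
    unfolding D0[symmetric] d_def by linarith
  from mult_left_mono[OF this, of R] R
  have "(LINT x|lebesgue. \<bar>\<rho>1 t x - \<rho>2 t x\<bar>) \<le> D + R * (d * (2 * R) + max \<alpha>1 \<alpha>2 * D)" using 1 by linarith
  \<comment> \<open>The slack
    \<open>d + R * (max \<alpha>1 \<alpha>2 * d) + 2 * R\<^sup>2 * D\<close> is given away to have a
    single factor in front of \<open>d + D\<close>.\<close>
  also have "\<dots> \<le> (1 + 2 * R\<^sup>2 + R * max \<alpha>1 \<alpha>2) * (d + D)"
  proof -
    have "0 \<le> d + R * (max \<alpha>1 \<alpha>2 * d) + 2 * R\<^sup>2 * D"
      using d Dnn R \<alpha> by (intro add_nonneg_nonneg mult_nonneg_nonneg) auto
    then show ?thesis by (simp add: algebra_simps power2_eq_square)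
  qed
  finally show ?thesis by (simp add: d_def D_def)
qed

text \<open>At time \<open>t\<close> mass may lie outside the interval, so restricting the norm on
  the left can only decrease it; the data vanish outside, so for them the two norms agree.\<close>

lemma L1_stability_interval:
  assumes "0 < R" "hughes_flux R f"
    and sol: "well_separated_entropy_solution R f (affine_cost \<alpha>1) \<rho>01 \<rho>1 \<xi>1"
      "well_separated_entropy_solution R f (affine_cost \<alpha>2) \<rho>02 \<rho>2 \<xi>2"
    and \<alpha>: "0 \<le> \<alpha>1" "0 \<le> \<alpha>2" and t: "0 \<le> t"
  shows "(LINT x:{-1<..<1}|lebesgue. \<bar>\<rho>1 t x - \<rho>2 t x\<bar>) \<le> (1 + 2 * R\<^sup>2 + R * max \<alpha>1 \<alpha>2) *
    (\<bar>\<alpha>1 - \<alpha>2\<bar> + (LINT x:{-1<..<1}|lebesgue. \<bar>\<rho>01 x - \<rho>02 x\<bar>))"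
proof -
  have id: "initial_datum R \<rho>01" "initial_datum R \<rho>02"
    using well_separated_solutionD(6)[OF sol(1)] well_separated_solutionD(6)[OF sol(2)] by blast+
  have out: "\<bar>\<rho>01 x - \<rho>02 x\<bar> = indicator {-1<..<1} x *\<^sub>R \<bar>\<rho>01 x - \<rho>02 x\<bar>" for x
    using id by (cases "x \<in> {-1<..<1}") (auto simp: initial_datum_def)
  have i: "integrable lebesgue (\<lambda>x. \<bar>\<rho>1 t x - \<rho>2 t x\<bar>)"
    using continuous_L1D(1)[OF well_separated_solutionD(1)[OF sol(1)] t]
      continuous_L1D(1)[OF well_separated_solutionD(1)[OF sol(2)] t] by simp
  have "(LINT x:{-1<..<1}|lebesgue. \<bar>\<rho>1 t x - \<rho>2 t x\<bar>) \<le> (LINT x|lebesgue. \<bar>\<rho>1 t x - \<rho>2 t x\<bar>)"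
    unfolding set_lebesgue_integral_def
    by (rule integral_mono[OF _ i]) (use integrable_mult_indicator[OF _ i, of "{-1<..<1}"] in \<open>auto simp: indicator_def\<close>)
  also have "\<dots> \<le> (1 + 2 * R\<^sup>2 + R * max \<alpha>1 \<alpha>2) * (\<bar>\<alpha>1 - \<alpha>2\<bar> + (LINT x|lebesgue. \<bar>\<rho>01 x - \<rho>02 x\<bar>))"
    by (rule L1_stability[OF assms(1,2) sol \<alpha> t])
  also have "(LINT x|lebesgue. \<bar>\<rho>01 x - \<rho>02 x\<bar>) = (LINT x:{-1<..<1}|lebesgue. \<bar>\<rho>01 x - \<rho>02 x\<bar>)"
    unfolding set_lebesgue_integral_def by (subst out) (rule refl)
  finally show ?thesis .
qed

text \<open>For equal parameters and data the stability estimate has right-hand side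
  \<open>0\<close>, which settles the densities. The balance then identifies the curves at the times
  when the densities are known to be nonnegative, that is at almost every time, and continuity does
  so at the others.\<close>

lemma well_separated_solution_unique:
  assumes "0 < R" "hughes_flux R f"
    and sol: "well_separated_entropy_solution R f (affine_cost \<alpha>) \<rho>0 \<rho>1 \<xi>1"
      "well_separated_entropy_solution R f (affine_cost \<alpha>) \<rho>0 \<rho>2 \<xi>2"
    and \<alpha>: "0 \<le> \<alpha>" and t: "0 \<le> t"
  shows "\<xi>1 t = \<xi>2 t" "AE x in lebesgue. \<rho>1 t x = \<rho>2 t x"
proof -
  have i: "integrable lebesgue (\<lambda>x. \<bar>\<rho>1 s x - \<rho>2 s x\<bar>)" if "0 \<le> s" for s
    using continuous_L1D(1)[OF well_separated_solutionD(1)[OF sol(1)] that]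
      continuous_L1D(1)[OF well_separated_solutionD(1)[OF sol(2)] that] by simp
  have zero: "(LINT x|lebesgue. \<bar>\<rho>1 s x - \<rho>2 s x\<bar>) = 0" if "0 \<le> s" for s
  proof (rule antisym)
    show "(LINT x|lebesgue. \<bar>\<rho>1 s x - \<rho>2 s x\<bar>) \<le> 0" using L1_stability[OF assms(1,2) sol \<alpha> \<alpha> that] by simp
    show "0 \<le> (LINT x|lebesgue. \<bar>\<rho>1 s x - \<rho>2 s x\<bar>)" by (intro integral_nonneg_AE) simp
  qed
  have "AE x in lebesgue. \<bar>\<rho>1 t x - \<rho>2 t x\<bar> = 0"
    using integral_nonneg_eq_0_iff_AE[OF i[OF t]] zero[OF t] by simp
  then show "AE x in lebesgue. \<rho>1 t x = \<rho>2 t x" by eventually_elim simp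
  obtain r1 where r1: "AE z in lborel. 0 \<le> fst z \<longrightarrow> r1 z = \<rho>1 (fst z) (snd z) \<and> \<rho>1 (fst z) (snd z) \<in> {0..R}"
    by (rule well_separated_imp_kruzhkov[OF assms(1,2) sol(1)]) (rule that)
  obtain r2 where r2: "AE z in lborel. 0 \<le> fst z \<longrightarrow> r2 z = \<rho>2 (fst z) (snd z) \<and> \<rho>2 (fst z) (snd z) \<in> {0..R}"
    by (rule well_separated_imp_kruzhkov[OF assms(1,2) sol(2)]) (rule that)
  have "AE s in lborel. 0 < s \<longrightarrow> \<xi>1 s - \<xi>2 s = 0"
    using AE_lborel_pair[OF r1] AE_lborel_pair[OF r2]
  proof eventually_elim
    case (elim s)
    show ?case
    proof
      assume s: "0 < s"
      have "AE x in lborel. 0 \<le> \<rho>1 s x" using elim(1) by eventually_elim (use s in simp)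
      moreover have "AE x in lborel. 0 \<le> \<rho>2 s x" using elim(2) by eventually_elim (use s in simp)
      ultimately have "2 * \<bar>\<xi>1 s - \<xi>2 s\<bar> \<le> \<bar>\<alpha> - \<alpha>\<bar> * (LINT x|lebesgue. indicator {-1..1} x * \<rho>1 s x)
        + \<alpha> * (LINT x|lebesgue. \<bar>\<rho>1 s x - \<rho>2 s x\<bar>)"
        using s by (intro turning_point_stability[OF sol \<alpha> \<alpha>] AE_completion) auto
      then show "\<xi>1 s - \<xi>2 s = 0" using zero[of s] s by simp
    qed
  qed
  moreover have "continuous_on {0..} (\<lambda>s. \<xi>1 s - \<xi>2 s)"
    by (intro continuous_on_diff well_separated_solutionD(2)[OF sol(1)] well_separated_solutionD(2)[OF sol(2)])
  ultimately have "\<xi>1 t - \<xi>2 t = 0" using continuous_AE_zero t by blast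
  then show "\<xi>1 t = \<xi>2 t" by simp
qed

theorem theorem3p2:
  fixes R :: real and f :: "real \<Rightarrow> real"
  assumes "R > 0" and "hughes_flux R f"
  shows
    "(\<exists>C :: real \<Rightarrow> real \<Rightarrow> real.
        (\<forall>t>0. \<forall>\<alpha>\<ge>0. C t \<alpha> \<ge> 0) \<and>
        (\<forall>\<alpha>\<ge>0. mono_on {0<..} (\<lambda>t. C t \<alpha>)) \<and>
        (\<forall>t>0. mono_on {0..} (\<lambda>\<alpha>. C t \<alpha>)) \<and>
        (\<forall>\<alpha>1 \<alpha>2 \<rho>01 \<rho>02 \<rho>1 \<rho>2 \<xi>1 \<xi>2.
           \<alpha>1 \<ge> 0 \<longrightarrow> \<alpha>2 \<ge> 0 \<longrightarrow>
           initial_datum R \<rho>01 \<longrightarrow> initial_datum R \<rho>02 \<longrightarrow>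
           well_separated_entropy_solution R f (affine_cost \<alpha>1) \<rho>01 \<rho>1 \<xi>1 \<longrightarrow>
           well_separated_entropy_solution R f (affine_cost \<alpha>2) \<rho>02 \<rho>2 \<xi>2 \<longrightarrow>
           BV \<rho>01 \<longrightarrow>
           (AE t in lebesgue_on {0<..}.
              (LINT x:{-1<..<1}|lebesgue. \<bar>\<rho>1 t x - \<rho>2 t x\<bar>)
                \<le> C t (max \<alpha>1 \<alpha>2) *
                    (\<bar>\<alpha>1 - \<alpha>2\<bar> + (LINT x:{-1<..<1}|lebesgue. \<bar>\<rho>01 x - \<rho>02 x\<bar>))))) \<and>
     (\<forall>\<alpha> \<rho>0. \<alpha> \<ge> 0 \<longrightarrow> initial_datum R \<rho>0 \<longrightarrow> BV \<rho>0 \<longrightarrow>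
        (\<forall>\<rho>1 \<xi>1 \<rho>2 \<xi>2.
           well_separated_entropy_solution R f (affine_cost \<alpha>) \<rho>0 \<rho>1 \<xi>1 \<longrightarrow>
           well_separated_entropy_solution R f (affine_cost \<alpha>) \<rho>0 \<rho>2 \<xi>2 \<longrightarrow>
           (\<forall>t\<ge>0. \<xi>1 t = \<xi>2 t \<and> (AE x in lebesgue. \<rho>1 t x = \<rho>2 t x))))"
\<comment> \<open>The witness is constant in \<open>t\<close>, hence monotone in it. The estimate is
  available at every \<open>t \<ge> 0\<close>, which gives the almost everywhere statement.\<close>
proof (intro conjI exI[of _ "\<lambda>t \<alpha>. 1 + 2 * R\<^sup>2 + R * \<alpha>"] allI impI)
  show "0 \<le> 1 + 2 * R\<^sup>2 + R * \<alpha>" if "0 \<le> \<alpha>" for \<alpha>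
    using assms(1) that by (intro add_nonneg_nonneg mult_nonneg_nonneg) auto
  show "mono_on {0<..} (\<lambda>t. 1 + 2 * R\<^sup>2 + R * \<alpha>)" for \<alpha> by (simp add: mono_on_def)
  show "mono_on {0..} (\<lambda>\<alpha>. 1 + 2 * R\<^sup>2 + R * \<alpha>)" using assms(1) by (simp add: mono_on_def)
qed (use L1_stability_interval[OF assms] well_separated_solution_unique[OF assms] in \<open>auto intro!: AE_I2\<close>)

end
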